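(* The $\omega$-language emptiness problem is decidable for parametric non-resetting test Timed Automata (nrtTA) that have at most 2 clocks and 1 parameter. That is, there is an algorithm which, given a parametric nrtTA $\mathcal{A}$ with at most two clocks and one parameter $\mu$, decides whether there exist a parameter evaluation $\mathcal{I}$ and a timed $\omega$-word $(\pi,\tau)$ such that $\mathcal{A}$ has an accepting parametric run over $(\pi,\tau)$ with parameter evaluation $\mathcal{I}$.
   Context: Timed words. Let $\Sigma$ be a finite alphabet. A timed $\omega$-word over $\Sigma$ is a pair $(\pi,\tau)$ with $\pi:\mathbb{N}_{>0}\to\Sigma$ and $\tau:\mathbb{N}_{>0}\to\mathbb{R}_{\ge 0}$ such that $\tau(i)<\tau(i+1)$ for all $i>0$; conventionally $\tau(0)=0$. Clocks and constraints. Let $X$ be a finite set of clocks and $P$ a finite set of parameters. $\Gamma(X)$ is the set of clock constraints $\gamma := x\sim c \mid x\sim \mu \mid \neg\gamma \mid \gamma\wedge\gamma$, where $\sim\in\{<,=\}$, $x\in X$, $c\in\mathbb{N}_{\ge 0}$, $\mu\in P$. A clock valuation is a function $v:X\to\mathbb{R}_{\ge 0}$; for $t\in\mathbb{R}_{\geq 0}$, $(v+t)(x)=v(x)+t$ for all $x\in X$. A parameter evaluation is a map $\mathcal{I}:P\to\mathbb{R}$. $v,\mathcal{I}\models\gamma$ means that $\gamma$ is satisfied when clocks are interpreted by $v$ and parameters by $\mathcal{I}$. Parametric Timed Automata. A parametric Timed Automaton (TA) is a tuple $\mathcal{A}=(\Sigma,Q,T,q_0,B,P)$ where $Q$ is a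 finite set of control states, $q_0\in Q$ is the initial state, $B\subseteq Q$ (Büchi condition), and $T\subseteq Q\times Q\times\Gamma(X)\times\Sigma\times 2^X$ is a finite set of transitions, written $q\xrightarrow{\gamma,a,S}q'$ ($\gamma$ is the guard, $a$ the letter read, $S$ the set of clocks that are reset). Runs. A configuration is a pair $(q,v)$ with $q\in Q$ and $v$ a clock valuation. A parametric run of $\mathcal{A}$ over $(\pi,\tau)$ with parameter evaluation $\mathcal{I}$ is an infinite sequence of configurations $(q_{i_0},v_0)(q_{i_1},v_1)(q_{i_2},v_2)\dots$ such that $q_{i_0}=q_0$; there is a sequence of transitions $q_{i_0}\xrightarrow{\gamma_1,\pi(1),S_1}q_{i_1}\xrightarrow{\gamma_2,\pi(2),S_2}q_{i_2}\dots$ of $T$ with $v_{i-1}+\tau(i)-\tau(i-1),\mathcal{I}\models\gamma_i$ for all $i>0$; and, for all $x\in X$, $v_0(x)=0$ and for all $i>0$, $v_i(x)=0$ if $x\in S_i$ and $v_i(x)=v_{i-1}(x)+\tau(i)-\tau(i-1)$ otherwise. The run is accepting if some state of $B$ occurs in it infinitely often. nrtTA. A (parametric) TA is a (parametric) non-resetting test TA (nrtTA) if, for every transition $q\xrightarrow{\gamma,a,S}q'$ in $T$, no clock occurring in $\gamma$ belongs to $S$. *)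

theory Defs
  imports Complex_Main "HOL-Library.Nat_Bijection" "HOL-Library.Infinite_Set"
begin

section \<open>Timed words, clock constraints, parametric timed automata\<close>

text \<open>Words are indexed from 1. The value of the letter sequence at 0 is junk, and the
  convention \<open>\<tau> 0 = 0\<close> is made part of the definition.\<close>

definition timed_word :: "'a set \<Rightarrow> (nat \<Rightarrow> 'a) \<Rightarrow> (nat \<Rightarrow> real) \<Rightarrow> bool" where
  "timed_word \<Sigma> \<pi> \<tau> \<longleftrightarrow>
     (\<forall>i>0. \<pi> i \<in> \<Sigma>) \<and> \<tau> 0 = 0 \<and> (\<forall>i>0. 0 \<le> \<tau> i) \<and> (\<forall>i>0. \<tau> i < \<tau> (i + 1))"

datatype comparison = Less | Equal

datatype 'p bound = Const nat | Param 'p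

datatype ('x, 'p) constraint =
    Atom 'x comparison "'p bound"
  | Neg "('x, 'p) constraint"
  | Conj "('x, 'p) constraint" "('x, 'p) constraint"

fun constraint_clocks :: "('x, 'p) constraint \<Rightarrow> 'x set" where
  "constraint_clocks (Atom x r b) = {x}"
| "constraint_clocks (Neg \<gamma>) = constraint_clocks \<gamma>"
| "constraint_clocks (Conj \<gamma> \<gamma>') = constraint_clocks \<gamma> \<union> constraint_clocks \<gamma>'"

fun constraint_params :: "('x, 'p) constraint \<Rightarrow> 'p set" where
  "constraint_params (Atom x r (Const c)) = {}"
| "constraint_params (Atom x r (Param \<mu>)) = {\<mu>}"
| "constraint_params (Neg \<gamma>) = constraint_params \<gamma>"
| "constraint_params (Conj \<gamma> \<gamma>') = constraint_params \<gamma> \<union> constraint_params \<gamma>'"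

definition constraints_over :: "'x set \<Rightarrow> 'p set \<Rightarrow> ('x, 'p) constraint set" where
  "constraints_over X P = {\<gamma>. constraint_clocks \<gamma> \<subseteq> X \<and> constraint_params \<gamma> \<subseteq> P}"

fun eval_bound :: "('p \<Rightarrow> real) \<Rightarrow> 'p bound \<Rightarrow> real" where
  "eval_bound I (Const c) = real c"
| "eval_bound I (Param \<mu>) = I \<mu>"

fun eval_comparison :: "comparison \<Rightarrow> real \<Rightarrow> real \<Rightarrow> bool" where
  "eval_comparison Less a b \<longleftrightarrow> a < b"
| "eval_comparison Equal a b \<longleftrightarrow> a = b"

fun satisfies :: "('x \<Rightarrow> real) \<Rightarrow> ('p \<Rightarrow> real) \<Rightarrow> ('x, 'p) constraint \<Rightarrow> bool" where
  "satisfies v I (Atom x r b) \<longleftrightarrow> eval_comparison r (v x) (eval_bound I b)"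
| "satisfies v I (Neg \<gamma>) \<longleftrightarrow> \<not> satisfies v I \<gamma>"
| "satisfies v I (Conj \<gamma> \<gamma>') \<longleftrightarrow> satisfies v I \<gamma> \<and> satisfies v I \<gamma>'"

text \<open>A transition \<open>(q, q', \<gamma>, a, S)\<close> leads from \<open>q\<close> to \<open>q'\<close>, has guard \<open>\<gamma>\<close>, reads \<open>a\<close>
  and resets the clocks in \<open>S\<close>.\<close>

type_synonym ('a, 'q, 'x, 'p) transition = "'q \<times> 'q \<times> ('x, 'p) constraint \<times> 'a \<times> 'x set"

record ('a, 'q, 'x, 'p) pta =
  alphabet :: "'a set"
  states :: "'q set"
  clocks :: "'x set"
  params :: "'p set"
  transitions :: "('a, 'q, 'x, 'p) transition set"
  initial :: 'q
  buechi :: "'q set"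

definition parametric_TA :: "('a, 'q, 'x, 'p) pta \<Rightarrow> bool" where
  "parametric_TA A \<longleftrightarrow>
     finite (alphabet A) \<and> finite (states A) \<and> finite (clocks A) \<and> finite (params A) \<and>
     finite (transitions A) \<and>
     transitions A \<subseteq> states A \<times> states A \<times> constraints_over (clocks A) (params A)
                      \<times> alphabet A \<times> Pow (clocks A) \<and>
     initial A \<in> states A \<and> buechi A \<subseteq> states A"

definition parametric_nrtTA :: "('a, 'q, 'x, 'p) pta \<Rightarrow> bool" where
  "parametric_nrtTA A \<longleftrightarrow> parametric_TA A \<and>
     (\<forall>(q, q', \<gamma>, a, S) \<in> transitions A. constraint_clocks \<gamma> \<inter> S = {})"

text \<open>Clock valuations and parameter evaluations are total functions whose values outside
  \<open>clocks A\<close> and \<open>params A\<close> are irrelevant.\<close>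

definition parametric_run ::
  "('a, 'q, 'x, 'p) pta \<Rightarrow> ('p \<Rightarrow> real) \<Rightarrow> (nat \<Rightarrow> 'a) \<Rightarrow> (nat \<Rightarrow> real)
     \<Rightarrow> (nat \<Rightarrow> 'q \<times> ('x \<Rightarrow> real)) \<Rightarrow> bool" where
  "parametric_run A I \<pi> \<tau> \<rho> \<longleftrightarrow>
     (let q = (\<lambda>i. fst (\<rho> i)); v = (\<lambda>i. snd (\<rho> i)) in
       (\<forall>i. q i \<in> states A \<and> (\<forall>x\<in>clocks A. 0 \<le> v i x)) \<and>
       q 0 = initial A \<and> (\<forall>x\<in>clocks A. v 0 x = 0) \<and>
       (\<exists>\<gamma> S. \<forall>i>0.
          (q (i - 1), q i, \<gamma> i, \<pi> i, S i) \<in> transitions A \<and>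
          satisfies (\<lambda>x. v (i - 1) x + (\<tau> i - \<tau> (i - 1))) I (\<gamma> i) \<and>
          (\<forall>x\<in>clocks A. v i x = (if x \<in> S i then 0 else v (i - 1) x + (\<tau> i - \<tau> (i - 1))))))"

definition accepting_run :: "('a, 'q, 'x, 'p) pta \<Rightarrow> (nat \<Rightarrow> 'q \<times> ('x \<Rightarrow> real)) \<Rightarrow> bool" where
  "accepting_run A \<rho> \<longleftrightarrow> (\<exists>b\<in>buechi A. \<exists>\<^sub>\<infinity>i. fst (\<rho> i) = b)"

definition parametric_language ::
  "('a, 'q, 'x, 'p) pta \<Rightarrow> ('p \<Rightarrow> real) \<Rightarrow> ((nat \<Rightarrow> 'a) \<times> (nat \<Rightarrow> real)) set" where
  "parametric_language A I =
     {(\<pi>, \<tau>). timed_word (alphabet A) \<pi> \<tau> \<and> (\<exists>\<rho>. parametric_run A I \<pi> \<tau> \<rho> \<and> accepting_run A \<rho>)}"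

definition nonempty_language :: "('a, 'q, 'x, 'p) pta \<Rightarrow> bool" where
  "nonempty_language A \<longleftrightarrow> (\<exists>I. parametric_language A I \<noteq> {})"


section \<open>Partial recursive functions and decidable problems\<close>

datatype recf =
    Zero
  | Succ
  | Proj nat
  | Comp recf "recf list"
  | PrimRec recf recf
  | Minimize recf

text \<open>\<open>rec_eval f xs y\<close>: the program \<open>f\<close> halts on the argument tuple \<open>xs\<close> with value \<open>y\<close>.
  Programs carry no arity annotation; on a tuple of unsuitable length no rule may apply.
  The recursion and minimization variables come first.\<close>

inductive rec_eval :: "recf \<Rightarrow> nat list \<Rightarrow> nat \<Rightarrow> bool" where
  "rec_eval Zero xs 0"
| "rec_eval Succ [x] (Suc x)"
| "i < length xs \<Longrightarrow> rec_eval (Proj i) xs (xs ! i)"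
| "list_all2 (\<lambda>g y. rec_eval g xs y) gs ys \<Longrightarrow> rec_eval f ys z \<Longrightarrow> rec_eval (Comp f gs) xs z"
| "rec_eval f xs y \<Longrightarrow> rec_eval (PrimRec f g) (0 # xs) y"
| "rec_eval (PrimRec f g) (n # xs) r \<Longrightarrow> rec_eval g (n # r # xs) y
     \<Longrightarrow> rec_eval (PrimRec f g) (Suc n # xs) y"
| "rec_eval f (n # xs) 0 \<Longrightarrow> \<forall>m<n. \<exists>y. rec_eval f (m # xs) (Suc y)
     \<Longrightarrow> rec_eval (Minimize f) xs n"

inductive_cases rec_evalE:
  "rec_eval Zero xs y" "rec_eval Succ xs y" "rec_eval (Proj i) xs y"
  "rec_eval (Comp f gs) xs y" "rec_eval (PrimRec f g) xs y" "rec_eval (Minimize f) xs y"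

lemma rec_eval_deterministic:
  assumes "rec_eval f xs y" and "rec_eval f xs z"
  shows "z = y"
  using assms
proof (induction arbitrary: z rule: rec_eval.induct)
  case (4 xs gs ys f y)
  from "4.prems" obtain ys' where ys': "list_all2 (\<lambda>g. rec_eval g xs) gs ys'" "rec_eval f ys' z"
    by (auto elim: rec_evalE)
  have "ys' = ys"
    using "4.IH"(1) ys'(1) by (auto simp: list_all2_conv_all_nth intro!: nth_equalityI)
  with "4.IH"(2) ys'(2) show ?case by simp
next
  case (7 f n xs)
  from "7.prems" have z: "rec_eval f (z # xs) 0" "\<forall>m<z. \<exists>y. rec_eval f (m # xs) (Suc y)"
    by (auto elim: rec_evalE)
  have "\<not> z < n" using "7.IH"(2) z(1) by fastforce
  moreover have "\<not> n < z" using "7.IH"(1) z(2) by fastforce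
  ultimately show ?case by simp
qed (blast elim: rec_evalE)+

text \<open>The problem \<open>Q\<close> with set of instances \<open>D\<close>, each instance \<open>d\<close> being presented to the
  algorithm as the number \<open>code d\<close>, is decidable. As usual, the algorithm has to be correct on
  codes of instances only.\<close>

definition decidable_problem :: "('d \<Rightarrow> nat) \<Rightarrow> 'd set \<Rightarrow> ('d \<Rightarrow> bool) \<Rightarrow> bool" where
  "decidable_problem code D Q \<longleftrightarrow>
     (\<exists>f. \<forall>d\<in>D. rec_eval f [code d] (if Q d then 1 else 0))"


section \<open>Goedel numbers of automata\<close>

text \<open>As inputs to an algorithm, automata have natural numbers as names of letters, states, clocks
  and parameters. This is no restriction, since every automaton is isomorphic to such a one.\<close>

fun comparison_code :: "comparison \<Rightarrow> nat" where
  "comparison_code Less = 0"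
| "comparison_code Equal = 1"

fun bound_code :: "nat bound \<Rightarrow> nat" where
  "bound_code (Const c) = prod_encode (0, c)"
| "bound_code (Param \<mu>) = prod_encode (1, \<mu>)"

fun constraint_code :: "(nat, nat) constraint \<Rightarrow> nat" where
  "constraint_code (Atom x r b) = list_encode [0, x, comparison_code r, bound_code b]"
| "constraint_code (Neg \<gamma>) = list_encode [1, constraint_code \<gamma>]"
| "constraint_code (Conj \<gamma> \<gamma>') = list_encode [2, constraint_code \<gamma>, constraint_code \<gamma>']"

fun transition_code :: "(nat, nat, nat, nat) transition \<Rightarrow> nat" where
  "transition_code (q, q', \<gamma>, a, S) = list_encode [q, q', constraint_code \<gamma>, a, set_encode S]"

definition pta_code :: "(nat, nat, nat, nat) pta \<Rightarrow> nat" where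
  "pta_code A = list_encode
     [set_encode (alphabet A), set_encode (states A), set_encode (clocks A), set_encode (params A),
      set_encode (transition_code ` transitions A), initial A, set_encode (buechi A)]"

lemma comparison_code_inject: "comparison_code r = comparison_code r' \<longleftrightarrow> r = r'"
  by (cases r; cases r') auto

lemma bound_code_inject: "bound_code b = bound_code b' \<longleftrightarrow> b = b'"
  by (cases b; cases b') auto

lemma constraint_code_inject: "constraint_code \<gamma> = constraint_code \<gamma>' \<longleftrightarrow> \<gamma> = \<gamma>'"
proof (induction \<gamma> arbitrary: \<gamma>')
  case (Atom x r b)
  then show ?case
    by (cases \<gamma>')
      (simp_all add: list_encode_eq comparison_code_inject bound_code_inject
        del: list_encode.simps)
next
  case (Neg \<gamma>)
  then show ?case by (cases \<gamma>') (simp_all add: list_encode_eq del: list_encode.simps)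
next
  case (Conj \<gamma>1 \<gamma>2)
  then show ?case by (cases \<gamma>') (simp_all add: list_encode_eq del: list_encode.simps)
qed

lemma inj_on_transition_code: "inj_on transition_code {(q, q', \<gamma>, a, S). finite S}"
  by (auto intro!: inj_onI
      simp: list_encode_eq constraint_code_inject set_encode_eq simp del: list_encode.simps)

lemma inj_on_pta_code: "inj_on pta_code {A. parametric_TA A}"
proof (rule inj_onI)
  fix A B :: "(nat, nat, nat, nat) pta"
  assume "A \<in> {A. parametric_TA A}" and "B \<in> {A. parametric_TA A}"
    and eq: "pta_code A = pta_code B"
  then have A: "parametric_TA A" and B: "parametric_TA B" by auto
  have fin: "transitions C \<subseteq> {(q, q', \<gamma>, a, S). finite S}"
    "finite (transition_code ` transitions C)"
    "finite (alphabet C)" "finite (states C)" "finite (clocks C)" "finite (params C)"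
    "finite (buechi C)"
    if "parametric_TA C" for C :: "(nat, nat, nat, nat) pta"
    using that by (auto simp: parametric_TA_def intro: finite_subset)
  have "transition_code ` transitions A = transition_code ` transitions B"
    using eq fin[OF A] fin[OF B]
    by (simp add: pta_code_def list_encode_eq set_encode_eq del: list_encode.simps)
  then have "transitions A = transitions B"
    using inj_on_image_eq_iff[OF inj_on_transition_code] fin[OF A] fin[OF B] by blast
  with eq fin[OF A] fin[OF B] show "A = B"
    by (simp add: pta_code_def list_encode_eq set_encode_eq del: list_encode.simps)
qed

end

theory Submission
  imports Defs "HOL-Library.FuncSet"
begin

text \<open>A guard only sees the cells of the clock values, i.e. their comparisons with \<open>0, \<dots>, C\<close> and
  \<open>\<mu>\<close>. As a clock that is reset is not tested, a resetting transition can be delayed as long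
  as the other clock stays in its cell; hence a path that resets one clock repeatedly, with
  the same state and cell at two of the resets, can be cut. When the two clocks are reset
  alternately, the timings of a fixed word form a system of difference constraints, and these
  are closed under pointwise minima. Together with delays this shows that what can be reached
  after such a word does not depend on what happened before, so that a path can be cut between
  two occurrences of the same word. Therefore two configurations that are connected by a path
  are connected by one whose length is bounded in terms of the automaton alone, whatever the
  value of \<open>\<mu>\<close>.

  An accepting run thus yields an accepting lasso of bounded length, where the loop either
  returns to the same values (up to values that exceed all constants) or, in the Zeno case,
  can be repeated in ever shorter time. That a lasso is consistent only depends on the signs
  of small integer linear forms in the time unit, the parameter and the delays, so these
  numbers may be replaced by integers of bounded size. Hence nonemptiness is expressed by an
  arithmetical formula all of whose quantifiers are bounded by computable functions.\<close>

section \<open>Computable functions and decidable predicates\<close>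

text \<open>The cells record neither fractional parts nor the difference of the two clocks. Regions
  fine enough to do so up to the parameter would grow in number with \<open>\<mu>\<close>, without a
  bound in terms of the automaton. The number of cells depends on the largest constant only, but the
  cells of a configuration do not determine what can happen later. Hence paths are cut with exact
  endpoints, and equality of cells is used only where a delay can make up for the difference in
  value. Such a delay is invisible to the guard as long as cells persist, and a clock that is reset
  by the delayed step does not remember it. Alternating resets are the hard case: delaying one reset
  changes the value with which the other clock enters the next test, which is why two timings have
  to be merged.

  Time may converge along an accepted word, so that a loop need not return to the same values at
  all. The first delay of a word may be 0 while all later ones are positive; therefore the first
  step is kept apart throughout. The parameter may be negative or irrational, but it matters only
  through comparisons, and it is written as a difference \<open>a - b\<close> of nonnegative numbers
  when natural numbers take over.\<close>

text \<open>A function of an environment is computable if one program computes it from every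
  sufficiently long initial segment of the environment; variables are thus de Bruijn indices and
  arities play no role.\<close>

definition computable :: "((nat \<Rightarrow> nat) \<Rightarrow> nat) \<Rightarrow> bool" where
  "computable F \<longleftrightarrow> (\<exists>f n. \<forall>\<rho> m. n \<le> m \<longrightarrow> rec_eval f (map \<rho> [0..<m]) (F \<rho>))"

definition decidable :: "((nat \<Rightarrow> nat) \<Rightarrow> bool) \<Rightarrow> bool" where
  "decidable P \<longleftrightarrow> computable (\<lambda>\<rho>. if P \<rho> then 1 else 0)"

lemma computableI: "(\<And>\<rho> m. n \<le> m \<Longrightarrow> rec_eval f (map \<rho> [0..<m]) (F \<rho>)) \<Longrightarrow> computable F"
  unfolding computable_def by (rule exI[of _ f], rule exI[of _ n]) simp

lemma computableE:
  assumes "computable F"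
  obtains f n where "\<And>\<rho> m. n \<le> m \<Longrightarrow> rec_eval f (map \<rho> [0..<m]) (F \<rho>)"
  using assms unfolding computable_def by auto

lemma computable_var: "computable (\<lambda>\<rho>. \<rho> i)"
proof (rule computableI)
  fix \<rho> m assume "Suc i \<le> m"
  then show "rec_eval (Proj i) (map \<rho> [0..<m]) (\<rho> i)"
    using rec_eval.intros(3)[of i "map \<rho> [0..<m]"] by simp
qed

text \<open>The program for \<open>G\<close> works on an initial segment of fixed length
  \<open>n\<close>, so only \<open>n\<close> of the infinitely many programs for
  \<open>\<sigma>\<close> have to be composed. The sum of their thresholds is a common
  threshold.\<close>

lemma computable_subst:
  assumes "computable G" and "\<And>i. computable (\<lambda>\<rho>. \<sigma> \<rho> i)"
  shows "computable (\<lambda>\<rho>. G (\<sigma> \<rho>))"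
proof -
  obtain g n where g: "\<And>\<rho> m. n \<le> m \<Longrightarrow> rec_eval g (map \<rho> [0..<m]) (G \<rho>)"
    using assms(1) by (rule computableE) blast
  have "\<forall>i. \<exists>f k. \<forall>\<rho> m. k \<le> m \<longrightarrow> rec_eval f (map \<rho> [0..<m]) (\<sigma> \<rho> i)"
    using assms(2) unfolding computable_def by blast
  then obtain f k where f: "\<And>i \<rho> m. k i \<le> m \<Longrightarrow> rec_eval (f i) (map \<rho> [0..<m]) (\<sigma> \<rho> i)" by metis
  show ?thesis
  proof (rule computableI)
    fix \<rho> m assume m: "(\<Sum>i<n. k i) \<le> m"
    have "k i \<le> m" if "i < n" for i
      using m member_le_sum[of i "{..<n}" k] that by simp
    then have "list_all2 (\<lambda>g y. rec_eval g (map \<rho> [0..<m]) y) (map f [0..<n]) (map (\<sigma> \<rho>) [0..<n])"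
      using f by (auto simp: list_all2_conv_all_nth)
    then show "rec_eval (Comp g (map f [0..<n])) (map \<rho> [0..<m]) (G (\<sigma> \<rho>))"
      using g[of n "\<sigma> \<rho>"] by (auto intro: rec_eval.intros(4))
  qed
qed

lemma computable_zero: "computable (\<lambda>\<rho>. 0)"
  by (rule computableI[of 0]) (rule rec_eval.intros(1))

lemma computable_Suc:
  assumes "computable F" shows "computable (\<lambda>\<rho>. Suc (F \<rho>))"
proof -
  obtain f n where f: "\<And>\<rho> m. n \<le> m \<Longrightarrow> rec_eval f (map \<rho> [0..<m]) (F \<rho>)"
    using assms by (rule computableE) blast
  show ?thesis
  proof (rule computableI)
    fix \<rho> m assume "n \<le> m"
    then have "list_all2 (\<lambda>g y. rec_eval g (map \<rho> [0..<m]) y) [f] [F \<rho>]" using f by simp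
    then show "rec_eval (Comp Succ [f]) (map \<rho> [0..<m]) (Suc (F \<rho>))"
      by (rule rec_eval.intros(4)) (rule rec_eval.intros(2))
  qed
qed

lemma computable_const: "computable (\<lambda>\<rho>. c)"
  by (induction c) (auto intro: computable_zero computable_Suc)

lemma list_all2_Proj: "N \<le> m \<Longrightarrow>
  list_all2 (\<lambda>g y. rec_eval g (map \<rho> [0..<m]) y) (map Proj [0..<N]) (map \<rho> [0..<N])"
  using rec_eval.intros(3)[of _ "map \<rho> [0..<m]"] by (auto simp: list_all2_conv_all_nth)

lemma map_upt_Suc: "x # map \<rho> [0..<m] = map (\<lambda>i. case i of 0 \<Rightarrow> x | Suc j \<Rightarrow> \<rho> j) [0..<Suc m]"
  by (simp only: upt_conv_Cons[of 0 "Suc m"] zero_less_Suc map_Suc_upt[symmetric] list.map map_map)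
    (simp add: comp_def)

text \<open>The premise on \<open>s\<close> presents the step with the counter as variable 0, the
  accumulator as variable 1 and the environment shifted by two. This is the argument order of
  \<open>PrimRec\<close>, and a form in which unification finds \<open>s\<close>.\<close>

lemma computable_rec:
  assumes "computable b" "computable (\<lambda>\<rho>. s (\<rho> 0) (\<rho> (Suc 0)) (\<lambda>i. \<rho> (Suc (Suc i))))" "computable h"
  shows "computable (\<lambda>\<rho>. rec_nat (b \<rho>) (\<lambda>k r. s k r \<rho>) (h \<rho>))"
proof -
  obtain fb nb where b: "\<And>\<rho> m. nb \<le> m \<Longrightarrow> rec_eval fb (map \<rho> [0..<m]) (b \<rho>)"
    using assms(1) by (rule computableE) blast
  obtain fs ns where s: "\<And>\<rho> m. ns \<le> m \<Longrightarrow> rec_eval fs (map \<rho> [0..<m]) (s (\<rho> 0) (\<rho> (Suc 0)) (\<lambda>i. \<rho> (Suc (Suc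
      i))))"
    using assms(2) by (rule computableE) blast
  obtain fh nh where h: "\<And>\<rho> m. nh \<le> m \<Longrightarrow> rec_eval fh (map \<rho> [0..<m]) (h \<rho>)"
    using assms(3) by (rule computableE) blast
  define N where "N = max nb ns"
  show ?thesis
  proof (rule computableI)
    fix \<rho> m assume m: "max N nh \<le> m"
    have 1: "list_all2 (\<lambda>g y. rec_eval g (map \<rho> [0..<m]) y) (fh # map Proj [0..<N]) (h \<rho> # map \<rho> [0..<N])"
      using h[of m \<rho>] list_all2_Proj[of N m \<rho>] m by simp
    have "rec_eval (PrimRec fb fs) (t # map \<rho> [0..<N]) (rec_nat (b \<rho>) (\<lambda>k r. s k r \<rho>) t)" for t
    proof (induction t)
      case 0
      have "nb \<le> N" unfolding N_def by simp
      then show ?case using rec_eval.intros(5)[OF b] by simp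
    next
      case (Suc t)
      let ?r = "rec_nat (b \<rho>) (\<lambda>k r. s k r \<rho>) t"
      have "ns \<le> Suc (Suc N)" unfolding N_def by simp
      from s[OF this, of "\<lambda>i. case i of 0 \<Rightarrow> t | Suc i \<Rightarrow> (case i of 0 \<Rightarrow> ?r | Suc j \<Rightarrow> \<rho> j)"]
      have "rec_eval fs (t # ?r # map \<rho> [0..<N]) (s t ?r \<rho>)"
        by (simp add: map_upt_Suc del: upt_Suc)
      then show ?case using rec_eval.intros(6)[OF Suc] by simp
    qed
    from rec_eval.intros(4)[OF 1 this]
    show "rec_eval (Comp (PrimRec fb fs) (fh # map Proj [0..<N])) (map \<rho> [0..<m])
      (rec_nat (b \<rho>) (\<lambda>k r. s k r \<rho>) (h \<rho>))" .
  qed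
qed

section \<open>Arithmetic operations and propositional connectives\<close>

lemma computable_add:
  assumes "computable f" "computable g" shows "computable (\<lambda>\<rho>. f \<rho> + g \<rho>)"
proof -
  have "rec_nat x (\<lambda>k r. Suc r) y = x + y" for x y :: nat by (induction y) auto
  moreover have "computable (\<lambda>\<rho>. rec_nat (f \<rho>) (\<lambda>k r. Suc r) (g \<rho>))"
    by (intro computable_rec assms computable_Suc computable_var)
  ultimately show ?thesis by simp
qed

lemma computable_shift: "computable f \<Longrightarrow> computable (\<lambda>\<rho>. f (\<lambda>i. \<rho> (Suc i)))"
  by (erule computable_subst) (rule computable_var)

lemma computable_mult:
  assumes "computable f" "computable g" shows "computable (\<lambda>\<rho>. f \<rho> * g \<rho>)"
proof -
  have "rec_nat 0 (\<lambda>k r. r + x) y = x * y" for x y :: nat by (induction y) auto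
  moreover have "computable (\<lambda>\<rho>. rec_nat 0 (\<lambda>k r. r + f \<rho>) (g \<rho>))"
    by (intro computable_rec assms computable_zero computable_add computable_var
        computable_shift[OF computable_shift[OF assms(1)]])
  ultimately show ?thesis by simp
qed

lemma computable_power:
  assumes "computable f" "computable g" shows "computable (\<lambda>\<rho>. f \<rho> ^ g \<rho>)"
proof -
  have "rec_nat 1 (\<lambda>k r. r * x) y = x ^ y" for x y :: nat by (induction y) auto
  moreover have "computable (\<lambda>\<rho>. rec_nat 1 (\<lambda>k r. r * f \<rho>) (g \<rho>))"
    by (intro computable_rec assms computable_const computable_mult computable_var
        computable_shift[OF computable_shift[OF assms(1)]])
  ultimately show ?thesis by simp
qed

lemma computable_diff:
  assumes "computable f" "computable g" shows "computable (\<lambda>\<rho>. f \<rho> - g \<rho>)"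
proof -
  \<comment> \<open>The predecessor is a recursion that returns its counter; iterating it gives
    truncated subtraction.\<close>
  have pred: "rec_nat 0 (\<lambda>k r. k) x = x - 1" for x :: nat by (cases x) auto
  have "rec_nat x (\<lambda>k r. rec_nat 0 (\<lambda>k r. k) r) y = x - y" for x y :: nat
    unfolding pred by (induction y) auto
  moreover have "computable (\<lambda>\<rho>. rec_nat (f \<rho>) (\<lambda>k r. rec_nat 0 (\<lambda>k r. k) r) (g \<rho>))"
    by (intro computable_rec assms computable_zero computable_var)
  ultimately show ?thesis by simp
qed

lemma decidable_zero: "computable f \<Longrightarrow> decidable (\<lambda>\<rho>. f \<rho> = 0)"
proof -
  assume f: "computable f"
  have "(if f \<rho> = 0 then 1 else 0) = 1 - f \<rho>" for \<rho> by simp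
  moreover have "computable (\<lambda>\<rho>. 1 - f \<rho>)" by (intro computable_diff computable_const f)
  ultimately show ?thesis unfolding decidable_def by presburger
qed

lemma decidable_le:
  assumes "computable f" "computable g" shows "decidable (\<lambda>\<rho>. f \<rho> \<le> g \<rho>)"
proof -
  have "decidable (\<lambda>\<rho>. f \<rho> - g \<rho> = 0)" by (intro decidable_zero computable_diff assms)
  then show ?thesis by simp
qed

lemma decidable_less:
  assumes "computable f" "computable g" shows "decidable (\<lambda>\<rho>. f \<rho> < g \<rho>)"
proof -
  have "decidable (\<lambda>\<rho>. Suc (f \<rho>) \<le> g \<rho>)" by (intro decidable_le computable_Suc assms)
  then show ?thesis by (simp add: Suc_le_eq)
qed

lemma decidable_not: assumes "decidable P" shows "decidable (\<lambda>\<rho>. \<not> P \<rho>)"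
  using decidable_zero[OF assms[unfolded decidable_def]] by (simp split: if_splits cong: if_cong)

lemma decidable_conj:
  assumes "decidable P" "decidable Q" shows "decidable (\<lambda>\<rho>. P \<rho> \<and> Q \<rho>)"
proof -
  have "(if P \<rho> \<and> Q \<rho> then 1 else 0) = (if P \<rho> then 1 else 0) * (if Q \<rho> then 1 else (0::nat))" for \<rho>
    by simp
  then show ?thesis using computable_mult[OF assms[unfolded decidable_def]]
    unfolding decidable_def by presburger
qed

lemma decidable_disj:
  assumes "decidable P" "decidable Q" shows "decidable (\<lambda>\<rho>. P \<rho> \<or> Q \<rho>)"
proof -
  have "decidable (\<lambda>\<rho>. \<not> (\<not> P \<rho> \<and> \<not> Q \<rho>))" by (intro decidable_not decidable_conj assms)
  then show ?thesis by simp
qed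

lemma decidable_imp:
  assumes "decidable P" "decidable Q" shows "decidable (\<lambda>\<rho>. P \<rho> \<longrightarrow> Q \<rho>)"
proof -
  have "decidable (\<lambda>\<rho>. \<not> (P \<rho> \<and> \<not> Q \<rho>))" by (intro decidable_not decidable_conj assms)
  then show ?thesis by simp
qed

lemma decidable_eq:
  assumes "computable f" "computable g" shows "decidable (\<lambda>\<rho>. f \<rho> = g \<rho>)"
proof -
  have "decidable (\<lambda>\<rho>. f \<rho> \<le> g \<rho> \<and> g \<rho> \<le> f \<rho>)" by (intro decidable_conj decidable_le assms)
  then show ?thesis by (simp add: eq_iff[of "f _"])
qed

lemma decidable_iff:
  assumes "decidable P" "decidable Q" shows "decidable (\<lambda>\<rho>. P \<rho> \<longleftrightarrow> Q \<rho>)"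
proof -
  have "decidable (\<lambda>\<rho>. (P \<rho> \<longrightarrow> Q \<rho>) \<and> (Q \<rho> \<longrightarrow> P \<rho>))" by (intro decidable_conj decidable_imp assms)
  moreover have "(\<lambda>\<rho>. (P \<rho> \<longrightarrow> Q \<rho>) \<and> (Q \<rho> \<longrightarrow> P \<rho>)) = (\<lambda>\<rho>. P \<rho> \<longleftrightarrow> Q \<rho>)" by (intro ext) blast
  ultimately show ?thesis by simp
qed

lemma computable_if:
  assumes "decidable P" "computable f" "computable g" shows "computable (\<lambda>\<rho>. if P \<rho> then f \<rho> else g \<rho>)"
proof -
  let ?d = "\<lambda>\<rho>. if P \<rho> then 1 else (0::nat)"
  have "computable (\<lambda>\<rho>. ?d \<rho> * f \<rho> + (1 - ?d \<rho>) * g \<rho>)"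
    using assms unfolding decidable_def
    by (intro computable_add computable_mult computable_diff computable_const)
  moreover have "(\<lambda>\<rho>. ?d \<rho> * f \<rho> + (1 - ?d \<rho>) * g \<rho>) = (\<lambda>\<rho>. if P \<rho> then f \<rho> else g \<rho>)" by (intro ext) simp
  ultimately show ?thesis by simp
qed

section \<open>Minimization, bounded quantifiers and division\<close>

lemma computable_Least:
  assumes P: "decidable (\<lambda>\<rho>. P (\<rho> 0) (\<lambda>i. \<rho> (Suc i)))" and ex: "\<And>\<rho>. \<exists>k. P k \<rho>"
  shows "computable (\<lambda>\<rho>. LEAST k. P k \<rho>)"
proof -
  \<comment> \<open>\<open>Minimize\<close> searches for a zero, hence the characteristic function
    of the negation.\<close>
  have "computable (\<lambda>\<rho>. if \<not> P (\<rho> 0) (\<lambda>i. \<rho> (Suc i)) then 1 else 0)"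
    using decidable_not[OF P] unfolding decidable_def .
  then obtain f n where f: "\<And>\<rho> m. n \<le> m \<Longrightarrow>
      rec_eval f (map \<rho> [0..<m]) (if \<not> P (\<rho> 0) (\<lambda>i. \<rho> (Suc i)) then 1 else 0)"
    by (rule computableE) blast
  show ?thesis
  proof (rule computableI)
    fix \<rho> m assume m: "n \<le> m"
    have e: "rec_eval f (k # map \<rho> [0..<n]) (if \<not> P k \<rho> then 1 else 0)" for k
      unfolding map_upt_Suc using f[of "Suc n" "\<lambda>i. case i of 0 \<Rightarrow> k | Suc j \<Rightarrow> \<rho> j"] by simp
    let ?l = "LEAST k. P k \<rho>"
    have l: "P ?l \<rho>" using ex by (rule LeastI_ex)
    have "rec_eval f (?l # map \<rho> [0..<n]) 0" using e[of ?l] l by simp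
    moreover have "\<forall>k<?l. \<exists>y. rec_eval f (k # map \<rho> [0..<n]) (Suc y)"
    proof (intro allI impI exI)
      fix k assume "k < ?l"
      then have "\<not> P k \<rho>" by (rule not_less_Least)
      then show "rec_eval f (k # map \<rho> [0..<n]) (Suc 0)" using e[of k] by simp
    qed
    ultimately have "rec_eval (Minimize f) (map \<rho> [0..<n]) ?l" by (rule rec_eval.intros(7))
    with list_all2_Proj[OF m]
    show "rec_eval (Comp (Minimize f) (map Proj [0..<n])) (map \<rho> [0..<m]) ?l"
      by (rule rec_eval.intros(4))
  qed
qed

lemma decidable_subst:
  "decidable P \<Longrightarrow> (\<And>i. computable (\<lambda>\<rho>. \<sigma> \<rho> i)) \<Longrightarrow> decidable (\<lambda>\<rho>. P (\<sigma> \<rho>))"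
  unfolding decidable_def using computable_subst[of "\<lambda>\<rho>. if P \<rho> then 1 else 0" \<sigma>] by simp

text \<open>The search must not run forever, so it also stops at the bound: the least
  \<open>k\<close> that satisfies \<open>P\<close> or equals \<open>b \<rho>\<close> always exists,
  and some \<open>k\<close> up to the bound satisfies \<open>P\<close> iff this one does. The
  quantified variable becomes de Bruijn index 0, so nested bounded quantifiers can be handled by
  resolution alone.\<close>

lemma decidable_ex:
  assumes b: "computable b" and P: "decidable (\<lambda>\<rho>. P (\<rho> 0) (\<lambda>i. \<rho> (Suc i)))"
  shows "decidable (\<lambda>\<rho>. \<exists>k\<le>b \<rho>. P k \<rho>)"
proof -
  let ?l = "\<lambda>\<rho>. LEAST k. P k \<rho> \<or> k = b \<rho>"
  have l: "computable ?l"
    by (rule computable_Least, intro decidable_disj P decidable_eq computable_var computable_shift b) blast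
  have "decidable (\<lambda>\<rho>. P (?l \<rho>) \<rho>)"
  proof -
    have "computable (\<lambda>\<rho>. case i of 0 \<Rightarrow> ?l \<rho> | Suc j \<Rightarrow> \<rho> j)" for i
      using l computable_var by (cases i) simp_all
    from decidable_subst[OF P, of "\<lambda>\<rho> i. case i of 0 \<Rightarrow> ?l \<rho> | Suc j \<Rightarrow> \<rho> j", OF this]
    show ?thesis by simp
  qed
  moreover have "P (?l \<rho>) \<rho> \<longleftrightarrow> (\<exists>k\<le>b \<rho>. P k \<rho>)" for \<rho>
  proof
    have "?l \<rho> \<le> b \<rho>" by (rule Least_le) simp
    then show "P (?l \<rho>) \<rho> \<Longrightarrow> \<exists>k\<le>b \<rho>. P k \<rho>" by blast
  next
    assume "\<exists>k\<le>b \<rho>. P k \<rho>"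
    then obtain k where k: "k \<le> b \<rho>" "P k \<rho>" by blast
    have "?l \<rho> \<le> k" using k(2) by (intro Least_le) simp
    moreover have "P (?l \<rho>) \<rho> \<or> ?l \<rho> = b \<rho>" by (rule LeastI[of _ k]) (simp add: k)
    ultimately show "P (?l \<rho>) \<rho>" using k by (metis le_antisym)
  qed
  ultimately show ?thesis by simp
qed

lemma decidable_all:
  assumes b: "computable b" and P: "decidable (\<lambda>\<rho>. P (\<rho> 0) (\<lambda>i. \<rho> (Suc i)))"
  shows "decidable (\<lambda>\<rho>. \<forall>k\<le>b \<rho>. P k \<rho>)"
proof -
  have "decidable (\<lambda>\<rho>. \<not> (\<exists>k\<le>b \<rho>. \<not> P k \<rho>))" by (intro decidable_not decidable_ex b P)
  then show ?thesis by simp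
qed

lemma computable_div:
  assumes "computable f" "computable g" shows "computable (\<lambda>\<rho>. f \<rho> div g \<rho>)"
proof -
  \<comment> \<open>The second disjunct makes the search end at 0 when \<open>y = 0\<close>, in
    accordance with \<open>x div 0 = 0\<close>.\<close>
  have "(LEAST q. x < Suc q * y \<or> y = 0) = x div y" for x y :: nat
  proof (rule Least_equality)
    show "x < Suc (x div y) * y \<or> y = 0" using dividend_less_times_div[of y x] by (auto simp: algebra_simps)
    fix q assume "x < Suc q * y \<or> y = 0"
    then show "x div y \<le> q" using less_mult_imp_div_less[of x "Suc q" y] by auto
  qed
  moreover have "computable (\<lambda>\<rho>. LEAST q. f \<rho> < Suc q * g \<rho> \<or> g \<rho> = 0)"
  proof (rule computable_Least)
    show "\<exists>q. f \<rho> < Suc q * g \<rho> \<or> g \<rho> = 0" for \<rho>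
      by (intro exI[of _ "f \<rho>"]) (cases "g \<rho>"; simp)
  qed (intro decidable_disj decidable_less decidable_eq computable_mult computable_Suc computable_const
      computable_var computable_shift assms)
  ultimately show ?thesis by simp
qed

lemma computable_mod:
  assumes "computable f" "computable g" shows "computable (\<lambda>\<rho>. f \<rho> mod g \<rho>)"
  unfolding minus_div_mult_eq_mod[symmetric]
  by (intro computable_diff computable_mult computable_div assms)

lemma computable_prod_encode:
  assumes "computable f" "computable g" shows "computable (\<lambda>\<rho>. prod_encode (f \<rho>, g \<rho>))"
  unfolding prod_encode_def triangle_def prod.case
  by (intro computable_add computable_div computable_mult computable_Suc computable_const assms)

lemma decidable_mem_set_decode:
  assumes "computable f" "computable g" shows "decidable (\<lambda>\<rho>. f \<rho> \<in> set_decode (g \<rho>))"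
proof -
  have "decidable (\<lambda>\<rho>. (g \<rho> div 2 ^ f \<rho>) mod 2 = 1)"
    by (intro decidable_eq computable_mod computable_div computable_power computable_const assms)
  then show ?thesis unfolding set_decode_def by (simp add: odd_iff_mod_2_eq_one)
qed

text \<open>An instance is a single number, whereas \<open>f\<close> is only known to work on tuples
  of length at least \<open>n\<close>; the input is therefore padded with zeros.\<close>

lemma decidable_problemI:
  assumes "decidable (\<lambda>\<rho>. P (\<rho> 0))" and "\<And>d. d \<in> D \<Longrightarrow> P (code d) \<longleftrightarrow> Q d"
  shows "decidable_problem code D Q"
proof -
  obtain f n where f: "\<And>\<rho> m. n \<le> m \<Longrightarrow> rec_eval f (map \<rho> [0..<m]) (if P (\<rho> 0) then 1 else 0)"
    using assms(1) unfolding decidable_def by (rule computableE) blast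
  have "rec_eval (Comp f (Proj 0 # replicate n Zero)) [x] (if P x then 1 else 0)" for x
  proof (rule rec_eval.intros(4))
    show "list_all2 (\<lambda>g. rec_eval g [x]) (Proj 0 # replicate n Zero) (x # replicate n 0)"
      using rec_eval.intros(1) rec_eval.intros(3)[of 0 "[x]"] by (auto simp: list_all2_conv_all_nth nth_Cons
          split: nat.split)
    have "x # replicate n 0 = map (\<lambda>i. case i of 0 \<Rightarrow> x | Suc j \<Rightarrow> 0) [0..<Suc n]"
      using map_upt_Suc[of x "\<lambda>_. 0" n] by (simp add: map_replicate_const del: upt_Suc)
    then show "rec_eval f (x # replicate n 0) (if P x then 1 else 0)"
      using f[of "Suc n" "\<lambda>i. case i of 0 \<Rightarrow> x | Suc j \<Rightarrow> 0"] by simp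
  qed
  note run = this
  show ?thesis unfolding decidable_problem_def
  proof (intro exI ballI)
    fix d assume "d \<in> D"
    then show "rec_eval (Comp f (Proj 0 # replicate n Zero)) [code d] (if Q d then 1 else 0)"
      using run[of "code d"] assms(2) by simp
  qed
qed

section \<open>Integer vectors with prescribed signs of small linear forms\<close>

definition lin :: "nat \<Rightarrow> (nat \<Rightarrow> int) \<Rightarrow> (nat \<Rightarrow> real) \<Rightarrow> real" where
  "lin n k v = (\<Sum>i<n. real_of_int (k i) * v i)"

text \<open>The bound produced by the elimination below. Comparing two thresholds of the last
  variable by cross-multiplication leads to coefficients up to \<open>2 * K ^ 2\<close>, which also
  bounds the denominator of the new last value; the factor in parentheses bounds the absolute value
  of that fraction.\<close>

fun sign_bound :: "nat \<Rightarrow> nat \<Rightarrow> nat" where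
  "sign_bound 0 K = 0"
| "sign_bound (Suc n) K = 2 * K ^ 2 * (n * K * sign_bound n (2 * K ^ 2) + 1)"

lemma lin_Suc: "lin (Suc n) k v = lin n k v + real_of_int (k n) * v n"
  unfolding lin_def by simp

lemma lin_scale: "lin n k (\<lambda>i. D * v i) = D * lin n k v"
  unfolding lin_def by (simp add: sum_distrib_left algebra_simps)

lemma lin_comb: "lin n (\<lambda>i. a * k i - b * l i) v = of_int a * lin n k v - of_int b * lin n l v"
  unfolding lin_def by (simp add: sum_distrib_left sum_subtractf[symmetric] algebra_simps)

lemma lin_uminus: "lin n (\<lambda>i. - k i) v = - lin n k v"
  unfolding lin_def by (simp add: sum_negf)

lemma lin_cong: "(\<And>i. i < n \<Longrightarrow> k i = l i) \<Longrightarrow> (\<And>i. i < n \<Longrightarrow> v i = w i) \<Longrightarrow> lin n k v = lin n l w"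
  unfolding lin_def by (intro sum.cong) auto

lemma threshold:
  fixes A j u :: real
  assumes "0 < j"
  shows "0 < A + j * u \<longleftrightarrow> - A / j < u"
  using assms by (intro iffI; simp add: field_simps)

lemma of_int_le_nat: "\<bar>z\<bar> \<le> int k \<Longrightarrow> \<bar>real_of_int z\<bar> \<le> real k"
  by linarith

lemma lin_bound:
  assumes "\<And>i. i < n \<Longrightarrow> \<bar>k i\<bar> \<le> int K" "\<And>i. i < n \<Longrightarrow> \<bar>v i\<bar> \<le> B"
  shows "\<bar>lin n k v\<bar> \<le> real n * (real K * B)"
proof -
  have "\<bar>real_of_int (k i) * v i\<bar> \<le> real K * B" if "i < n" for i
  proof -
    have "\<bar>real_of_int (k i)\<bar> \<le> real K"
      using assms(1)[OF that] by (rule of_int_le_nat)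
    then show ?thesis unfolding abs_mult using assms(2)[OF that] by (intro mult_mono) auto
  qed
  then have "(\<Sum>i<n. \<bar>real_of_int (k i) * v i\<bar>) \<le> (\<Sum>i<n. real K * B)" by (intro sum_mono) simp
  then have "(\<Sum>i<n. \<bar>real_of_int (k i) * v i\<bar>) \<le> real n * (real K * B)" by simp
  then show ?thesis unfolding lin_def by (rule order_trans[OF sum_abs])
qed

text \<open>Between the two halves of a finite set of fractions there is a fraction of controlled
  denominator; this is one step of a Fourier--Motzkin elimination.\<close>

lemma separating_fraction:
  fixes I :: "'i set" and N :: "'i \<Rightarrow> int" and j :: "'i \<Rightarrow> nat" and \<theta> :: "'i \<Rightarrow> real" and w :: real
  assumes fin: "finite I" and ne: "I \<noteq> {}" and K: "K \<ge> 1"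
    and j: "\<And>x. x \<in> I \<Longrightarrow> 1 \<le> j x \<and> j x \<le> K"
    and M: "\<And>x. x \<in> I \<Longrightarrow> \<bar>real_of_int (N x) / real (j x)\<bar> \<le> M"
    and mono: "\<And>x y. x \<in> I \<Longrightarrow> y \<in> I \<Longrightarrow> \<theta> x < \<theta> y \<longleftrightarrow> real_of_int (N x) / real (j x) < real_of_int (N y) / real (j
        y)"
  shows "\<exists>u D. 1 \<le> D \<and> D \<le> 2 * K ^ 2 \<and> \<bar>u\<bar> \<le> M + 1 \<and> real D * u \<in> \<int> \<and>
    (\<forall>x\<in>I. (w < \<theta> x \<longleftrightarrow> u < real_of_int (N x) / real (j x)) \<and> (\<theta> x < w \<longleftrightarrow> real_of_int (N x) / real (j x) < u))"
proof -
  define \<phi> where "\<phi> x = real_of_int (N x) / real (j x)" for x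
  have int: "real (j x) * \<phi> x \<in> \<int>" if "x \<in> I" for x
    using j[OF that] unfolding \<phi>_def by simp
  have KK: "K \<le> 2 * K ^ 2" using K by (simp add: power2_eq_square)
  define L where "L = {x \<in> I. \<theta> x < w}"
  define U where "U = {x \<in> I. w < \<theta> x}"
  have fLU: "finite L" "finite U" unfolding L_def U_def using fin by auto
  have M0: "\<bar>\<phi> x\<bar> \<le> M" if "x \<in> I" for x using M that unfolding \<phi>_def by auto
  have m: "\<theta> x < \<theta> y \<longleftrightarrow> \<phi> x < \<phi> y" if "x \<in> I" "y \<in> I" for x y using mono that unfolding \<phi>_def by auto
  have "\<exists>u D. 1 \<le> D \<and> D \<le> 2 * K ^ 2 \<and> \<bar>u\<bar> \<le> M + 1 \<and> real D * u \<in> \<int> \<and>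
    (\<forall>x\<in>I. (w < \<theta> x \<longleftrightarrow> u < \<phi> x) \<and> (\<theta> x < w \<longleftrightarrow> \<phi> x < u))"
  \<comment> \<open>If \<open>w\<close> hits a threshold, \<open>u\<close> has to be the fraction
    belonging to it; otherwise \<open>u\<close> may be chosen from an open interval.\<close>
  proof (cases "\<exists>x\<in>I. \<theta> x = w")
    case True
    then obtain x where x: "x \<in> I" "\<theta> x = w" by blast
    then show ?thesis using j[OF x(1)] int[OF x(1)] m M0[OF x(1)] KK
      by (intro exI[of _ "\<phi> x"] exI[of _ "j x"]) auto
  next
    case False
    then have LU: "x \<in> I \<Longrightarrow> x \<in> L \<or> x \<in> U" for x unfolding L_def U_def by force
    have maxL: "\<exists>x\<in>L. \<forall>y\<in>L. \<phi> y \<le> \<phi> x" if "L \<noteq> {}"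
    proof -
      have "Max (\<phi> ` L) \<in> \<phi> ` L" using fLU that by (intro Max_in) simp_all
      then obtain x where "Max (\<phi> ` L) = \<phi> x" "x \<in> L" by (rule imageE)
      moreover have "\<forall>y\<in>L. \<phi> y \<le> Max (\<phi> ` L)" using fLU by simp
      ultimately show ?thesis by (intro bexI[of _ x]) simp_all
    qed
    have minU: "\<exists>x\<in>U. \<forall>y\<in>U. \<phi> x \<le> \<phi> y" if "U \<noteq> {}"
    proof -
      have "Min (\<phi> ` U) \<in> \<phi> ` U" using fLU that by (intro Min_in) simp_all
      then obtain x where "Min (\<phi> ` U) = \<phi> x" "x \<in> U" by (rule imageE)
      moreover have "\<forall>y\<in>U. Min (\<phi> ` U) \<le> \<phi> y" using fLU by simp
      ultimately show ?thesis by (intro bexI[of _ x]) simp_all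
    qed
    have goal: ?thesis if "1 \<le> D" "D \<le> 2 * K ^ 2" "\<bar>u\<bar> \<le> M + 1" "real D * u \<in> \<int>"
      "\<And>x. x \<in> L \<Longrightarrow> \<phi> x < u" "\<And>x. x \<in> U \<Longrightarrow> u < \<phi> x" for D u
    proof (intro exI[of _ u] exI[of _ D] conjI ballI that(1-4))
      fix x assume x: "x \<in> I"
      show "w < \<theta> x \<longleftrightarrow> u < \<phi> x" "\<theta> x < w \<longleftrightarrow> \<phi> x < u"
        using LU[OF x] that(5,6)[of x] unfolding L_def U_def by auto
    qed
    consider "L = {}" "U \<noteq> {}" | "L \<noteq> {}" "U = {}" | "L \<noteq> {}" "U \<noteq> {}" using LU ne by blast
    then show ?thesis
    proof cases
      case 1
      obtain x where x: "x \<in> U" "\<forall>y\<in>U. \<phi> x \<le> \<phi> y" using minU 1 by blast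
      then have xI: "x \<in> I" unfolding U_def by simp
      show ?thesis
        by (rule goal[of "j x" "\<phi> x - 1"])
          (use x 1 j[OF xI] KK M0[OF xI] int[OF xI] in \<open>auto simp: algebra_simps\<close>)
    next
      case 2
      obtain x where x: "x \<in> L" "\<forall>y\<in>L. \<phi> y \<le> \<phi> x" using maxL 2 by blast
      then have xI: "x \<in> I" unfolding L_def by simp
      show ?thesis
        by (rule goal[of "j x" "\<phi> x + 1"])
          (use x 2 j[OF xI] KK M0[OF xI] int[OF xI] in \<open>auto simp: algebra_simps\<close>)
    next
      case 3
      obtain x where x: "x \<in> L" "\<forall>y\<in>L. \<phi> y \<le> \<phi> x" using maxL 3 by blast
      obtain y where y: "y \<in> U" "\<forall>z\<in>U. \<phi> y \<le> \<phi> z" using minU 3 by blast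
      have I: "x \<in> I" "y \<in> I" using x y unfolding L_def U_def by auto
      have lt: "\<phi> x < \<phi> y" using m[OF I] x y unfolding L_def U_def by auto
      \<comment> \<open>The midpoint of the two neighbouring fractions has denominator
        \<open>2 * (j x * j y)\<close>. This is the origin of \<open>2 * K ^ 2\<close>.\<close>
      have "j x * j y \<le> K * K" using j[OF I(1)] j[OF I(2)] by (intro mult_mono) auto
      moreover have "1 \<le> j x * j y" using j[OF I(1)] j[OF I(2)] by (simp add: Suc_leI)
      moreover have "real (2 * (j x * j y)) * ((\<phi> x + \<phi> y) / 2) = real (j y) * (real (j x) * \<phi> x) + real (j x)
          * (real (j y) * \<phi> y)"
        by (simp add: algebra_simps)
      moreover have "\<dots> \<in> \<int>" 
        by (rule Ints_add[OF Ints_mult[OF Ints_of_nat int[OF I(1)]] Ints_mult[OF Ints_of_nat int[OF I(2)]]])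
      moreover have "\<bar>(\<phi> x + \<phi> y) / 2\<bar> \<le> M + 1" using M0[OF I(1)] M0[OF I(2)] by (simp add: abs_le_iff
          field_simps)
      moreover have "\<phi> z < (\<phi> x + \<phi> y) / 2" if "z \<in> L" for z using x(2) that lt by fastforce
      moreover have "(\<phi> x + \<phi> y) / 2 < \<phi> z" if "z \<in> U" for z using y(2) that lt by fastforce
      ultimately show ?thesis
        by (intro goal[of "2 * (j x * j y)" "(\<phi> x + \<phi> y) / 2"]) (simp_all add: power2_eq_square)
    qed
  qed
  then show ?thesis unfolding \<phi>_def .
qed

text \<open>Elimination of the last variable: a form whose last coefficient is positive is positive
  iff the last variable exceeds a threshold determined by the other variables. So the other
  variables are first replaced such that all these thresholds keep their order, and then the last
  one is put at the same place among them. The remaining signs follow by passing to negated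
  forms.\<close>

theorem sign_preserving_integers:
  assumes "K \<ge> 1"
  shows "\<exists>a :: nat \<Rightarrow> int. (\<forall>i<n. \<bar>a i\<bar> \<le> int (sign_bound n K)) \<and>
    (\<forall>k. (\<forall>i<n. \<bar>k i\<bar> \<le> int K) \<longrightarrow> (0 < lin n k (\<lambda>i. of_int (a i)) \<longleftrightarrow> 0 < lin n k v))"
  using assms
proof (induction n arbitrary: K)
  case 0 then show ?case by (auto simp: lin_def)
next
  case (Suc n)
  let ?K = "2 * K ^ 2"
  have K: "K \<ge> 1" by fact
  then have KK: "K \<le> ?K" by (simp add: power2_eq_square)
  then have "?K \<ge> 1" using K by linarith
  from Suc.IH[OF this] obtain a :: "nat \<Rightarrow> int" where a: "\<And>i. i < n \<Longrightarrow> \<bar>a i\<bar> \<le> int (sign_bound n ?K)"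
    and pos: "\<And>k. (\<And>i. i < n \<Longrightarrow> \<bar>k i\<bar> \<le> int ?K) \<Longrightarrow> 0 < lin n k (\<lambda>i. of_int (a i)) \<longleftrightarrow> 0 < lin n k v"
    by blast
  let ?a = "\<lambda>i. real_of_int (a i)"
  \<comment> \<open>The indices of the thresholds: the first \<open>n\<close> coefficients, and a
    positive last coefficient. A form with negative last coefficient is compared through its
    negative.\<close>
  define I where "I = PiE {..<n} (\<lambda>_. {- int K..int K}) \<times> {1..K}"
  define N where "N x = - (\<Sum>i<n. fst x i * a i)" for x :: "(nat \<Rightarrow> int) \<times> nat"
  define \<theta> where "\<theta> x = - lin n (fst x) v / real (snd x)" for x :: "(nat \<Rightarrow> int) \<times> nat"
  define M where "M = real (n * K * sign_bound n ?K)"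
  have N: "real_of_int (N x) = - lin n (fst x) ?a" for x unfolding N_def lin_def by simp
  have fstI: "\<bar>fst x i\<bar> \<le> int K" if "x \<in> I" "i < n" for x i
  proof -
    have "fst x \<in> PiE {..<n} (\<lambda>_. {- int K..int K})" using that(1) unfolding I_def by (simp add:
        mem_Times_iff)
    then have "fst x i \<in> {- int K..int K}" by (rule PiE_mem) (simp add: that(2))
    then show ?thesis by (simp add: abs_le_iff)
  qed
  have sndI: "1 \<le> snd x \<and> snd x \<le> K" if "x \<in> I" for x
    using that unfolding I_def by (simp add: mem_Times_iff)
  have mem: "(restrict l {..<n}, j) \<in> I" if "\<And>i. i < n \<Longrightarrow> \<bar>l i\<bar> \<le> int K" "1 \<le> j" "j \<le> K" for l j
  proof -
    have "l i \<in> {- int K..int K}" if "i < n" for i using \<open>\<And>i. i < n \<Longrightarrow> \<bar>l i\<bar> \<le> int K\<close>[OF that] by auto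
    then have "restrict l {..<n} \<in> PiE {..<n} (\<lambda>_. {- int K..int K})" by (intro restrict_PiE_iff[THEN iffD2]
        ballI) simp
    then show ?thesis unfolding I_def using that(2,3) by simp
  qed
  have "\<exists>u D. 1 \<le> D \<and> D \<le> 2 * K ^ 2 \<and> \<bar>u\<bar> \<le> M + 1 \<and> real D * u \<in> \<int> \<and>
    (\<forall>x\<in>I. (v n < \<theta> x \<longleftrightarrow> u < real_of_int (N x) / real (snd x)) \<and> (\<theta> x < v n \<longleftrightarrow> real_of_int (N x) / real (snd x)
        < u))"
  proof (rule separating_fraction[OF _ _ K sndI])
    show "finite I" unfolding I_def by (intro finite_cartesian_product finite_PiE) simp_all
    show "I \<noteq> {}" using mem[of "\<lambda>_. 0" 1] K by fastforce
    fix x assume x: "x \<in> I"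
    have "\<bar>lin n (fst x) ?a\<bar> \<le> real n * (real K * real (sign_bound n ?K))"
    proof (rule lin_bound)
      show "\<bar>fst x i\<bar> \<le> int K" if "i < n" for i using fstI x that by blast
      show "\<bar>?a i\<bar> \<le> real (sign_bound n ?K)" if "i < n" for i
        using a[OF that] by (rule of_int_le_nat)
    qed
    then have "\<bar>real_of_int (N x)\<bar> \<le> M" unfolding N M_def by (simp add: mult.assoc)
    moreover have "real (snd x) \<ge> 1" using sndI[OF x] by simp
    moreover from this have "\<bar>real_of_int (N x)\<bar> / real (snd x) \<le> \<bar>real_of_int (N x)\<bar> / 1"
      by (intro divide_left_mono) simp_all
    ultimately show "\<bar>real_of_int (N x) / real (snd x)\<bar> \<le> M"
      by (simp add: abs_divide)
    fix y assume y: "y \<in> I"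
    \<comment> \<open>After cross-multiplication, comparing two thresholds means determining the
      sign of this form in \<open>n\<close> variables.\<close>
    let ?k = "\<lambda>i. int (snd y) * fst x i - int (snd x) * fst y i"
    have "\<bar>?k i\<bar> \<le> int ?K" if "i < n" for i
    proof -
      have "\<bar>int (snd y) * fst x i\<bar> \<le> int K * int K" "\<bar>int (snd x) * fst y i\<bar> \<le> int K * int K"
        unfolding abs_mult using fstI[OF x that] fstI[OF y that] sndI[OF x] sndI[OF y] by (intro mult_mono;
            simp)+
      then show ?thesis by (simp add: power2_eq_square)
    qed
    from pos[of ?k, OF this] have e: "0 < lin n ?k ?a \<longleftrightarrow> 0 < lin n ?k v" .
    have cmp: "- p / real (snd x) < - q / real (snd y) \<longleftrightarrow> 0 < real (snd y) * p - real (snd x) * q" for p q ::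
        real
      using sndI[OF x] sndI[OF y] by (simp add: field_simps)
    show "\<theta> x < \<theta> y \<longleftrightarrow> real_of_int (N x) / real (snd x) < real_of_int (N y) / real (snd y)"
      unfolding N \<theta>_def cmp using e unfolding lin_comb by simp
  qed
  then obtain u D where D: "1 \<le> D" "D \<le> 2 * K ^ 2" and u: "\<bar>u\<bar> \<le> M + 1" "real D * u \<in> \<int>"
    and cut: "\<And>x. x \<in> I \<Longrightarrow> (v n < \<theta> x \<longleftrightarrow> u < real_of_int (N x) / real (snd x)) \<and>
       (\<theta> x < v n \<longleftrightarrow> real_of_int (N x) / real (snd x) < u)" by blast
  from u(2) obtain an where an: "real D * u = of_int an" by (auto elim: Ints_cases)
  \<comment> \<open>Multiplication by the positive \<open>D\<close> makes all entries integral and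
    changes no sign, because the forms are homogeneous.\<close>
  define b where "b i = (if i < n then int D * a i else an)" for i
  have rb: "real_of_int (b i) = real D * (if i < n then ?a i else u)" if "i < Suc n" for i
    unfolding b_def using an by simp
  have sb: "sign_bound (Suc n) K = ?K * (n * K * sign_bound n ?K + 1)" by simp
  have "\<bar>b i\<bar> \<le> int (sign_bound (Suc n) K)" if i: "i < Suc n" for i
  proof -
    have "\<bar>if i < n then ?a i else u\<bar> \<le> M + 1"
    proof (cases "i < n")
      case True
      have "\<bar>?a i\<bar> \<le> real (sign_bound n ?K)" using a[OF True] by (rule of_int_le_nat)
      moreover have "1 * sign_bound n ?K \<le> n * K * sign_bound n ?K" using True K by (intro mult_right_mono)
          (auto simp: Suc_leI)
      then have "real (sign_bound n ?K) \<le> M" unfolding M_def by linarith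
      ultimately show ?thesis using True by simp
    qed (use u in simp)
    then have "real D * \<bar>if i < n then ?a i else u\<bar> \<le> real ?K * (M + 1)"
      using of_nat_mono[OF D(2), where ?'a = real] by (intro mult_mono) simp_all
    then have "\<bar>real_of_int (b i)\<bar> \<le> real ?K * (M + 1)" using rb[OF i] D by (simp add: abs_mult)
    also have "\<dots> = real (sign_bound (Suc n) K)" unfolding sb M_def by (simp add: algebra_simps)
    finally show ?thesis by linarith
  qed
  moreover have "0 < lin (Suc n) k (\<lambda>i. of_int (b i)) \<longleftrightarrow> 0 < lin (Suc n) k v"
    if k: "\<And>i. i < Suc n \<Longrightarrow> \<bar>k i\<bar> \<le> int K" for k
  proof -
    have "lin (Suc n) k (\<lambda>i. of_int (b i)) = real D * (lin n k ?a + of_int (k n) * u)"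
    proof -
      have "lin (Suc n) k (\<lambda>i. of_int (b i)) = lin (Suc n) k (\<lambda>i. real D * (if i < n then ?a i else u))"
        using rb by (intro lin_cong) auto
      also have "\<dots> = real D * lin (Suc n) k (\<lambda>i. if i < n then ?a i else u)" by (rule lin_scale)
      also have "lin (Suc n) k (\<lambda>i. if i < n then ?a i else u) = lin n k ?a + of_int (k n) * u"
        unfolding lin_Suc by (simp cong: lin_cong)
      finally show ?thesis .
    qed
    then have 1: "0 < lin (Suc n) k (\<lambda>i. of_int (b i)) \<longleftrightarrow> 0 < lin n k ?a + of_int (k n) * u"
      using D(1) by (simp add: zero_less_mult_iff)
    define kk where "kk = restrict k {..<n}"
    have kn: "\<bar>k i\<bar> \<le> int K" if "i < n" for i using k that by simp
    have lr: "lin n (restrict l {..<n}) w = lin n l w" for l w by (rule lin_cong) auto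
    have "0 < lin n k ?a + of_int (k n) * u \<longleftrightarrow> 0 < lin n k v + of_int (k n) * v n"
    proof -
      consider "k n = 0" | "k n > 0" | "k n < 0" by linarith
      then show ?thesis
      proof cases
        case 1
        have "0 < lin n k ?a \<longleftrightarrow> 0 < lin n k v"
        proof (rule pos)
          fix i assume "i < n" then have "\<bar>k i\<bar> \<le> int K" by (rule kn)
          also have "\<dots> \<le> int ?K" using KK by (rule of_nat_mono)
          finally show "\<bar>k i\<bar> \<le> int ?K" .
        qed
        then show ?thesis using 1 by simp
      next
        case 2
        define j where "j = nat (k n)"
        have j: "1 \<le> j" "j \<le> K" "real_of_int (k n) = real j" using 2 k[of n] unfolding j_def by auto
        from cut[OF mem[of k j, OF kn j(1,2)]]
        have "- lin n k v / real j < v n \<longleftrightarrow> - lin n k ?a / real j < u" unfolding \<theta>_def N by (simp add: lr)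
        then show ?thesis unfolding j(3) using j(1) by (simp add: threshold)
      next
        case 3
        define j where "j = nat (- k n)"
        have j: "1 \<le> j" "j \<le> K" "real_of_int (k n) = - real j" using 3 k[of n] unfolding j_def by auto
        have kn': "\<bar>- k i\<bar> \<le> int K" if "i < n" for i using kn that by simp
        from cut[OF mem[of "\<lambda>i. - k i" j, OF kn' j(1,2)]]
        have "v n < lin n k v / real j \<longleftrightarrow> u < lin n k ?a / real j" unfolding \<theta>_def N by (simp add: lr
            lin_uminus)
        then show ?thesis unfolding j(3) using j(1) by (simp add: pos_less_divide_eq mult.commute)
      qed
    qed
    then show ?thesis using 1 unfolding lin_Suc by simp
  qed
  ultimately show ?case by blast
qed

section \<open>Shortening paths of two clocks without resetting tests\<close>

text \<open>In a shortest path no key can occur twice: \<open>cut\<close> would replace everything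
  from one step with this key through a later one by a single step. The source of the former and the
  target of the latter are kept, so the whole path keeps its endpoints.\<close>

lemma relpowp_shorten:
  fixes P :: "'c \<Rightarrow> 'c \<Rightarrow> bool"
  assumes K: "finite K" and lab: "\<And>a b. P a b \<Longrightarrow> \<exists>k\<in>K. Q k a b"
    and cut: "\<And>k a b c d. Q k a b \<Longrightarrow> P\<^sup>*\<^sup>* b c \<Longrightarrow> Q k c d \<Longrightarrow> P a d"
    and path: "P\<^sup>*\<^sup>* a b"
  shows "\<exists>n\<le>card K. (P ^^ n) a b"
proof -
  define n where "n = (LEAST n. (P ^^ n) a b)"
  have ex: "\<exists>n. (P ^^ n) a b" using path rtranclp_imp_relpowp by metis
  have n: "(P ^^ n) a b" and least: "\<And>m. (P ^^ m) a b \<Longrightarrow> n \<le> m"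
    unfolding n_def using LeastI_ex[OF ex] Least_le by auto
  obtain f where f: "f 0 = a" "f n = b" "\<And>i. i < n \<Longrightarrow> P (f i) (f (Suc i))"
    using n unfolding relpowp_fun_conv by blast
  have "\<forall>i. \<exists>k. i < n \<longrightarrow> k \<in> K \<and> Q k (f i) (f (Suc i))" using lab f(3) by blast
  then obtain k where k: "\<And>i. i < n \<Longrightarrow> k i \<in> K \<and> Q (k i) (f i) (f (Suc i))" by metis
  have sub: "(P ^^ (j - i)) (f i) (f j)" if "i \<le> j" "j \<le> n" for i j
    unfolding relpowp_fun_conv using that f(3) by (intro exI[of _ "\<lambda>l. f (i + l)"]) auto
  have "k i \<noteq> k j" if "i < j" "j < n" for i j
  proof
    assume eq: "k i = k j"
    have "P\<^sup>*\<^sup>* (f (Suc i)) (f j)" using sub[of "Suc i" j] that by (simp add: relpowp_imp_rtranclp)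
    then have "P (f i) (f (Suc j))" using cut k[of i] k[of j] eq that by (metis less_trans)
    moreover have "(P ^^ i) a (f i)" using sub[of 0 i] that f(1) by simp
    moreover have "(P ^^ (n - Suc j)) (f (Suc j)) b" using sub[of "Suc j" n] that f(2) by simp
    ultimately have "(P ^^ (Suc i + (n - Suc j))) a b"
      by (meson relpowp_Suc_I relpowp_trans)
    then show False using least[of "Suc i + (n - Suc j)"] that by simp
  qed
  then have "inj_on k {..<n}" by (intro linorder_inj_onI) auto
  then have "card {..<n} \<le> card K" using k by (intro card_inj_on_le[OF _ _ K]) auto
  then show ?thesis using n by auto
qed

definition reaches :: "('c \<Rightarrow> 'c \<Rightarrow> bool) \<Rightarrow> nat \<Rightarrow> 'c \<Rightarrow> 'c \<Rightarrow> bool" where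
  "reaches S n a b \<longleftrightarrow> (\<exists>m\<le>n. (S ^^ m) a b)"

lemma reaches_mono: "reaches S m a b \<Longrightarrow> m \<le> n \<Longrightarrow> reaches S n a b"
  unfolding reaches_def using le_trans by blast

lemma reaches_trans: "reaches S m a b \<Longrightarrow> reaches S n b c \<Longrightarrow> reaches S (m + n) a c"
  unfolding reaches_def by (blast intro: add_mono relpowp_trans)

lemma reaches_step: "S a b \<Longrightarrow> reaches S 1 a b"
  unfolding reaches_def by (intro exI[of _ 1]) auto

lemma reaches_weaken: "reaches S n a b \<Longrightarrow> (\<And>a b. S a b \<Longrightarrow> S' a b) \<Longrightarrow> reaches S' n a b"
  unfolding reaches_def using relpowp_mono[of S S'] by blast

lemma reaches_relpowp:
  assumes "\<And>a b. P a b \<Longrightarrow> reaches S p a b" "(P ^^ k) a b"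
  shows "reaches S (k * p) a b"
  using assms(2)
proof (induction k arbitrary: b)
  case 0 then show ?case by (auto simp: reaches_def)
next
  case (Suc k)
  then obtain c where "(P ^^ k) a c" "P c b" by auto
  then have "reaches S (k * p + p) a b" using Suc.IH assms(1) reaches_trans by metis
  then show ?case by (simp add: algebra_simps)
qed

text \<open>\<open>P\<close> is to be thought of as a macro step, made of at most \<open>p\<close>
  steps of \<open>S\<close>.\<close>

lemma reaches_shorten:
  assumes "\<And>a b. P\<^sup>*\<^sup>* a b \<Longrightarrow> \<exists>k\<le>n. (P ^^ k) a b" "\<And>a b. P a b \<Longrightarrow> reaches S p a b" "P\<^sup>*\<^sup>* a b"
  shows "reaches S (n * p) a b"
proof -
  obtain k where "k \<le> n" "(P ^^ k) a b" using assms(1,3) by blast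
  then show ?thesis using reaches_relpowp[OF assms(2)] reaches_mono mult_le_mono1 by metis
qed

lemma reaches_imp_rtranclp: "reaches S n a b \<Longrightarrow> S\<^sup>*\<^sup>* a b"
  unfolding reaches_def by (auto dest: relpowp_imp_rtranclp)

type_synonym 'q config = "'q \<times> (bool \<Rightarrow> real)"
type_synonym 'q trans = "'q \<times> 'q \<times> ((bool \<Rightarrow> real) \<Rightarrow> bool) \<times> bool set"

text \<open>The two clocks are indexed by truth values. In \<open>guard_cong\<close> two
  restrictions meet: a guard sees only cells, and only those of clocks that the same step does not
  reset. The number \<open>\<kappa>\<close> of cells will later not involve the parameter.\<close>

locale two_clocks =
  fixes Qs :: "'q set" and T :: "'q trans set" and cell :: "real \<Rightarrow> nat" and \<kappa> :: nat
  assumes finite_Qs: "finite Qs" and finite_T: "finite T"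
    and T_states: "(q, q', g, R) \<in> T \<Longrightarrow> q \<in> Qs \<and> q' \<in> Qs"
    and cell_less: "cell r < \<kappa>"
    and cell_convex: "cell a = cell b \<Longrightarrow> a \<le> m \<Longrightarrow> m \<le> b \<Longrightarrow> cell m = cell a"
    and guard_cong: "(q, q', g, R) \<in> T \<Longrightarrow> (\<And>z. z \<notin> R \<Longrightarrow> cell (v z) = cell (w z)) \<Longrightarrow> g v \<longleftrightarrow> g w"
begin

text \<open>Delays are positive here, as they are in every step of a run except possibly the
  first.\<close>

definition st :: "bool set \<Rightarrow> 'q config \<Rightarrow> 'q config \<Rightarrow> bool" where
  "st R c c' \<longleftrightarrow> (\<exists>q v q' g d. c = (q, v) \<and> c' = (q', \<lambda>z. if z \<in> R then 0 else v z + d) \<and>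
     (q, q', g, R) \<in> T \<and> d > 0 \<and> g (\<lambda>z. v z + d))"

text \<open>Paths are divided into such pieces, each of which ends with the next reset.\<close>

definition sreset :: "bool set \<Rightarrow> 'q config \<Rightarrow> 'q config \<Rightarrow> bool" where
  "sreset R = (st {})\<^sup>*\<^sup>* OO st R"

text \<open>The guard cannot notice the longer delay: clocks outside \<open>R\<close> keep their
  cells, those in \<open>R\<close> are not tested, and the reset removes the additional time from
  their values. This is what makes cuts with a prescribed target possible.\<close>

lemma st_delay:
  assumes "st R c (q, v)" and "\<And>z. z \<in> R \<Longrightarrow> w z = 0" and "\<delta> \<ge> 0"
    and "\<And>z. z \<notin> R \<Longrightarrow> w z = v z + \<delta> \<and> cell (w z) = cell (v z)"
  shows "st R c (q, w)"
proof -
  from assms(1) obtain p u g d where c: "c = (p, u)" and v: "v = (\<lambda>z. if z \<in> R then 0 else u z + d)"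
    and t: "(p, q, g, R) \<in> T" "d > 0" "g (\<lambda>z. u z + d)" unfolding st_def by auto
  have "g (\<lambda>z. u z + (d + \<delta>)) \<longleftrightarrow> g (\<lambda>z. u z + d)"
  proof (rule guard_cong[OF t(1)])
    fix z assume z: "z \<notin> R"
    then have "w z = u z + (d + \<delta>)" "v z = u z + d" using assms(4) v by auto
    then show "cell (u z + (d + \<delta>)) = cell (u z + d)" using assms(4) z by metis
  qed
  then have "g (\<lambda>z. u z + (d + \<delta>))" using t(3) by blast
  moreover have "w = (\<lambda>z. if z \<in> R then 0 else u z + (d + \<delta>))"
    using assms(2,4) v by (auto simp: fun_eq_iff)
  moreover have "d + \<delta> > 0" using t(2) assms(3) by simp
  ultimately show ?thesis unfolding st_def using c t(1) by blast
qed

lemma sreset_delay: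
  assumes "sreset R c (q, v)" and "\<And>z. z \<in> R \<Longrightarrow> w z = 0" and "\<delta> \<ge> 0"
    and "\<And>z. z \<notin> R \<Longrightarrow> w z = v z + \<delta> \<and> cell (w z) = cell (v z)"
  shows "sreset R c (q, w)"
proof -
  from assms(1) obtain m where "(st {})\<^sup>*\<^sup>* c m" "st R m (q, v)" unfolding sreset_def by blast
  moreover from this(2) have "st R m (q, w)" using assms(2-4) by (rule st_delay)
  ultimately show ?thesis unfolding sreset_def by blast
qed

lemma st_states: "st R c c' \<Longrightarrow> fst c' \<in> Qs"
  unfolding st_def using T_states by auto

lemma st_elapse: "st R c c' \<Longrightarrow> z \<notin> R \<Longrightarrow> snd c z < snd c' z"
  unfolding st_def by auto

lemma st_reset: "st R c c' \<Longrightarrow> z \<in> R \<Longrightarrow> snd c' z = 0"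
  unfolding st_def by auto

lemma nr_elapse: "(st {})\<^sup>*\<^sup>* c c' \<Longrightarrow> \<exists>\<delta>\<ge>0. \<forall>z. snd c' z = snd c z + \<delta>"
proof (induction rule: rtranclp_induct)
  case base then show ?case by (intro exI[of _ 0]) auto
next
  case (step y z)
  then obtain \<delta> where "\<delta> \<ge> 0" "\<forall>x. snd y x = snd c x + \<delta>" by blast
  moreover obtain d where "d > 0" "\<forall>x. snd z x = snd y x + d" using step(2) unfolding st_def by auto
  ultimately show ?case by (intro exI[of _ "\<delta> + d"]) auto
qed

definition "\<nu> = card Qs"
definition "nr_bound = \<nu> * (\<kappa> * \<kappa>)"

text \<open>Without resets both clocks advance by the same amount. Hence two targets with the same
  state and cells differ by a common delay, which the earlier of the two steps can absorb.\<close>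

lemma nr_short: assumes "(st {})\<^sup>*\<^sup>* a b" shows "\<exists>n\<le>nr_bound. ((st {}) ^^ n) a b"
proof -
  let ?Q = "\<lambda>(q, i, j) a b. st {} a b \<and> fst b = q \<and> cell (snd b True) = i \<and> cell (snd b False) = j"
  have "\<exists>n\<le>card (Qs \<times> {..<\<kappa>} \<times> {..<\<kappa>}). ((st {}) ^^ n) a b"
  proof (rule relpowp_shorten[where Q = ?Q, OF _ _ _ assms])
    show "finite (Qs \<times> {..<\<kappa>} \<times> {..<\<kappa>})" using finite_Qs by simp
    show "\<exists>k\<in>Qs \<times> {..<\<kappa>} \<times> {..<\<kappa>}. ?Q k a b" if "st {} a b" for a b
      using that st_states cell_less by auto
    show "st {} a d" if Q: "?Q k a b" "?Q k c d" and bc: "(st {})\<^sup>*\<^sup>* b c" for k a b c d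
    proof -
      obtain q i j where k: "k = (q, i, j)" by (metis prod_cases3)
      from Q have b: "st {} a b" "fst b = q" "cell (snd b True) = i" "cell (snd b False) = j"
        and d: "st {} c d" "fst d = q" "cell (snd d True) = i" "cell (snd d False) = j"
        by (simp_all add: k)
      obtain \<delta> where \<delta>: "\<delta> \<ge> 0" "\<forall>z. snd d z = snd b z + \<delta>"
        using nr_elapse[OF rtranclp.rtrancl_into_rtrancl[OF bc d(1)]] by blast
      have "st {} a (q, snd b)" using b by (metis prod.collapse)
      then have "st {} a (q, snd d)"
      proof (rule st_delay[OF _ _ \<delta>(1)])
        fix z show "snd d z = snd b z + \<delta> \<and> cell (snd d z) = cell (snd b z)"
          using \<delta>(2) b d by (cases z) simp_all
      qed simp
      then show ?thesis using d(2) by (metis prod.collapse)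
    qed
  qed
  then show ?thesis by (simp add: card_cartesian_product nr_bound_def \<nu>_def)
qed

definition "stp R c c' \<longleftrightarrow> (\<exists>R'\<subseteq>R. st R' c c')"

lemma nr_reaches: "(st {})\<^sup>*\<^sup>* a b \<Longrightarrow> reaches (stp R) nr_bound a b"
  by (rule reaches_weaken[of "st {}"]) (use nr_short in \<open>auto simp: reaches_def stp_def\<close>)

lemma sreset_reaches: "sreset R' a b \<Longrightarrow> R' \<subseteq> R \<Longrightarrow> reaches (stp R) (nr_bound + 1) a b"
  unfolding sreset_def by (blast intro: reaches_trans reaches_step nr_reaches stp_def[THEN iffD2])

section \<open>Paths that reset a single clock\<close>

lemma sreset_elapse:
  assumes "sreset R c c'" "z \<notin> R" shows "snd c z < snd c' z"
proof -
  from assms(1) obtain m where m: "(st {})\<^sup>*\<^sup>* c m" "st R m c'" unfolding sreset_def by auto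
  show ?thesis using nr_elapse[OF m(1)] st_elapse[OF m(2) assms(2)] by auto
qed

lemma sreset_elapse_star: "(sreset R)\<^sup>*\<^sup>* c c' \<Longrightarrow> z \<notin> R \<Longrightarrow> snd c z \<le> snd c' z"
  by (induction rule: rtranclp_induct) (use sreset_elapse in fastforce)+

lemma sreset_zero: "sreset R c c' \<Longrightarrow> z \<in> R \<Longrightarrow> snd c' z = 0"
  unfolding sreset_def using st_reset by blast

lemma sreset_states: "sreset R c c' \<Longrightarrow> fst c' \<in> Qs"
  unfolding sreset_def using st_states by blast

text \<open>Right after a reset of \<open>z\<close> only the value of the other clock matters. That
  clock is never reset here, so it is larger at the later of two such moments; if state and cell
  agree, the earlier reset can be postponed until the later value is reached.\<close>

lemma sreset_single_short:
  assumes "(sreset {z})\<^sup>*\<^sup>* a b" shows "\<exists>n\<le>\<nu> * \<kappa>. ((sreset {z}) ^^ n) a b"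
proof -
  let ?Q = "\<lambda>(q, i) a b. sreset {z} a b \<and> fst b = q \<and> cell (snd b (\<not> z)) = i"
  have "\<exists>n\<le>card (Qs \<times> {..<\<kappa>}). ((sreset {z}) ^^ n) a b"
  proof (rule relpowp_shorten[where Q = ?Q, OF _ _ _ assms])
    show "finite (Qs \<times> {..<\<kappa>})" using finite_Qs by simp
    show "\<exists>k\<in>Qs \<times> {..<\<kappa>}. ?Q k a b" if "sreset {z} a b" for a b
      using that sreset_states cell_less by auto
    show "sreset {z} a d" if Q: "?Q k a b" "?Q k c d" and bc: "(sreset {z})\<^sup>*\<^sup>* b c" for k a b c d
    proof -
      obtain q i where k: "k = (q, i)" by (metis prod.exhaust)
      from Q have b: "sreset {z} a b" "fst b = q" "cell (snd b (\<not> z)) = i"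
        and d: "sreset {z} c d" "fst d = q" "cell (snd d (\<not> z)) = i"
        by (simp_all add: k)
      have le: "snd b (\<not> z) \<le> snd d (\<not> z)"
        using sreset_elapse_star[OF rtranclp.rtrancl_into_rtrancl[OF bc d(1)], of "\<not> z"] by simp
      have z: "snd d z = 0" using d(1) sreset_zero by simp
      have "sreset {z} a (q, snd b)" using b by (metis prod.collapse)
      then have "sreset {z} a (q, snd d)"
      proof (rule sreset_delay)
        show "0 \<le> snd d (\<not> z) - snd b (\<not> z)" using le by simp
        show "snd d y = snd b y + (snd d (\<not> z) - snd b (\<not> z)) \<and> cell (snd d y) = cell (snd b y)"
          if "y \<notin> {z}" for y
        proof -
          have "y = (\<not> z)" using that by auto
          then show ?thesis using b d by simp
        qed
      qed (use z in auto)
      then show ?thesis using d(2) by (metis prod.collapse)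
    qed
  qed
  then show ?thesis by (simp add: card_cartesian_product \<nu>_def)
qed

definition "single_bound = (\<nu> * \<kappa>) * (nr_bound + 1)"

lemma sreset_single_reaches:
  assumes "(sreset {z})\<^sup>*\<^sup>* a b" "z \<in> R" shows "reaches (stp R) single_bound a b"
  unfolding single_bound_def
  by (rule reaches_shorten[OF sreset_single_short _ assms(1)]) (use assms(2) sreset_reaches in auto)

section \<open>Factorization of paths by their resets\<close>

definition "ab = (sreset {True})\<^sup>*\<^sup>* OO (sreset {False})\<^sup>*\<^sup>*"
definition "blk = ab OO sreset UNIV"
text \<open>Write \<open>a\<close>, \<open>b\<close>, \<open>c\<close> for resets of
  \<open>True\<close>, of \<open>False\<close> and of both. Then \<open>noswap\<close> is the
  regular expression \<open>(a* b* c)* a* b*\<close>, which describes the words in which no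
  \<open>b\<close> is directly followed by \<open>a\<close>. Cutting a word after each factor
  \<open>b a\<close> leaves a sequence of \<open>swap\<close>s and a rest of this form.\<close>

definition "noswap = blk\<^sup>*\<^sup>* OO ab"
definition "swap = noswap OO sreset {False} OO sreset {True}"

text \<open>After a double reset both clocks are 0, so the state is the whole configuration.\<close>

lemma blk_short: assumes "blk\<^sup>*\<^sup>* a b" shows "\<exists>n\<le>\<nu>. (blk ^^ n) a b"
  unfolding \<nu>_def
proof (rule relpowp_shorten[where Q = "\<lambda>q a b. blk a b \<and> fst b = q", OF finite_Qs _ _ assms])
  show "\<exists>k\<in>Qs. blk a b \<and> fst b = k" if "blk a b" for a b
    using that sreset_states unfolding blk_def by blast
  fix k a b c d
  assume a: "blk a b \<and> fst b = k" "blk c d \<and> fst d = k"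
  then have "snd b = (\<lambda>_. 0)" "snd d = (\<lambda>_. 0)"
    using sreset_zero[of UNIV] unfolding blk_def by blast+
  then have "b = d" using a by (metis prod.collapse)
  then show "blk a d" using a by simp
qed

definition "noswap_bound = \<nu> * (2 * single_bound + nr_bound + 1) + 2 * single_bound"

lemma ab_reaches: "ab a b \<Longrightarrow> reaches (stp UNIV) (2 * single_bound) a b"
  unfolding ab_def mult_2 by (blast intro: reaches_trans sreset_single_reaches)

lemma noswap_reaches: assumes "noswap a b" shows "reaches (stp UNIV) noswap_bound a b"
proof -
  have "reaches (stp UNIV) (2 * single_bound + nr_bound + 1) a b" if "blk a b" for a b
    using that unfolding blk_def add.assoc
    by (blast intro: reaches_trans ab_reaches sreset_reaches)
  moreover obtain m where "blk\<^sup>*\<^sup>* a m" "ab m b" using assms unfolding noswap_def by blast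
  ultimately show ?thesis unfolding noswap_bound_def
    using reaches_trans[OF reaches_shorten[OF blk_short] ab_reaches] by blast
qed

section \<open>Timings of the word between a reset of \<open>False\<close> and the next reset of
  \<open>True\<close>\<close>

text \<open>\<open>posn t e\<close>: the clock \<open>False\<close> was reset \<open>e\<close> time units ago, when \<open>True\<close> had value \<open>t\<close>.\<close>

definition posn :: "real \<Rightarrow> real \<Rightarrow> bool \<Rightarrow> real" where
  "posn t e z = (if z then t + e else e)"

text \<open>The trace \<open>ls\<close> fixes the transitions and the cells in which their guards
  are tested. Only the delays remain free, and since cells are convex, these are subject to
  difference constraints only.\<close>

fun nrpath :: "('q trans \<times> nat \<times> nat) list \<Rightarrow> 'q config \<Rightarrow> 'q config \<Rightarrow> bool" where
  "nrpath [] c c' \<longleftrightarrow> c = c'"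
| "nrpath ((\<tau>, i, j) # ls) c c' \<longleftrightarrow> (\<exists>q q1 g d v. \<tau> = (q, q1, g, {}) \<and> \<tau> \<in> T \<and> c = (q, v) \<and> d > 0 \<and>
     g (\<lambda>z. v z + d) \<and> cell (v True + d) = i \<and> cell (v False + d) = j \<and> nrpath ls (q1, \<lambda>z. v z + d) c')"

lemma nrpath_imp_nr: "nrpath ls c c' \<Longrightarrow> (st {})\<^sup>*\<^sup>* c c'"
proof (induction ls c c' rule: nrpath.induct)
  case (2 \<tau> i j ls c c')
  then obtain q q1 g d v where h: "\<tau> = (q, q1, g, {})" "\<tau> \<in> T" "c = (q, v)" "d > 0"
     "g (\<lambda>z. v z + d)" "nrpath ls (q1, \<lambda>z. v z + d) c'" by auto
  have "st {} c (q1, \<lambda>z. v z + d)" using h unfolding st_def by auto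
  then show ?case using 2 h by (meson converse_rtranclp_into_rtranclp)
qed simp

lemma nr_imp_nrpath: "((st {}) ^^ n) c c' \<Longrightarrow>
  \<exists>ls. length ls = n \<and> set ls \<subseteq> T \<times> {..<\<kappa>} \<times> {..<\<kappa>} \<and> nrpath ls c c'"
proof (induction n arbitrary: c)
  case (Suc n)
  from Suc.prems obtain m where m: "st {} c m" "((st {}) ^^ n) m c'" by (metis relpowp_Suc_D2)
  obtain ls where ls: "length ls = n" "set ls \<subseteq> T \<times> {..<\<kappa>} \<times> {..<\<kappa>}" "nrpath ls m c'"
    using Suc.IH[OF m(2)] by blast
  obtain q v q' g d where s: "c = (q, v)" "m = (q', \<lambda>z. v z + d)" "(q, q', g, {}) \<in> T" "d > 0" "g (\<lambda>z. v z +
      d)"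
    using m(1) unfolding st_def by auto
  show ?case
    by (rule exI[of _ "((q, q', g, {}), cell (v True + d), cell (v False + d)) # ls"])
      (use s ls cell_less in auto)
qed auto

text \<open>Systems of difference constraints are closed under pointwise minima; this is what
  allows two timings of the same word to be merged.\<close>

lemma nrpath_min:
  assumes "nrpath ls (q, posn t1 e1) (q', w1)" "nrpath ls (q, posn t2 e2) (q', w2)" "t2 \<le> t1"
  shows "\<exists>f1 f2. w1 = posn t1 f1 \<and> w2 = posn t2 f2 \<and>
    nrpath ls (q, posn t1 (min e1 e2)) (q', posn t1 (min f1 f2))"
  using assms
proof (induction ls arbitrary: q e1 e2)
  case Nil then show ?case by auto
next
  case (Cons a ls)
  obtain \<tau> i j where a: "a = (\<tau>, i, j)" by (metis prod_cases3)
  from Cons.prems(1) a obtain q1 g d1 where 1: "\<tau> = (q, q1, g, {})" "\<tau> \<in> T" "d1 > 0"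
    "g (\<lambda>z. posn t1 e1 z + d1)" "cell (t1 + e1 + d1) = i" "cell (e1 + d1) = j"
    "nrpath ls (q1, \<lambda>z. posn t1 e1 z + d1) (q', w1)" by (auto simp: posn_def)
  from Cons.prems(2) a 1(1) obtain d2 where 2: "d2 > 0"
    "g (\<lambda>z. posn t2 e2 z + d2)" "cell (t2 + e2 + d2) = i" "cell (e2 + d2) = j"
    "nrpath ls (q1, \<lambda>z. posn t2 e2 z + d2) (q', w2)" by (auto simp: posn_def)
  have p: "(\<lambda>z. posn t e z + d) = posn t (e + d)" for t e d by (auto simp: posn_def fun_eq_iff)
  obtain f1 f2 where IH: "w1 = posn t1 f1" "w2 = posn t2 f2"
    "nrpath ls (q1, posn t1 (min (e1 + d1) (e2 + d2))) (q', posn t1 (min f1 f2))"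
    using Cons.IH[OF 1(7)[unfolded p] 2(5)[unfolded p] Cons.prems(3)] by blast
  define m where "m = min (e1 + d1) (e2 + d2)"
  define d where "d = m - min e1 e2"
  have d: "d > 0" unfolding d_def m_def using 1(3) 2(1) by auto
  have cj: "cell m = j" unfolding m_def using 1(6) 2(4) by (auto simp: min_def)
  \<comment> \<open>If the second timing is the earlier one, \<open>True\<close> lies between its
    values in the two timings: it started at \<open>t1\<close>, which is at least \<open>t2\<close>,
    and less time has passed than in the first timing. Here convexity of cells and
    \<open>t2 \<le> t1\<close> come in.\<close>
  have ci: "cell (t1 + m) = i"
  proof (cases "e1 + d1 \<le> e2 + d2")
    case True then show ?thesis using 1(5) by (simp add: m_def add.assoc)
  next
    case False
    then have "t2 + e2 + d2 \<le> t1 + m" "t1 + m \<le> t1 + e1 + d1" using Cons.prems(3) by (auto simp: m_def)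
    then show ?thesis using cell_convex[of "t2 + e2 + d2" "t1 + e1 + d1" "t1 + m"] 1(5) 2(3) by simp
  qed
  have "g (posn t1 m) \<longleftrightarrow> g (\<lambda>z. posn t1 e1 z + d1)"
  proof (rule guard_cong[OF 1(2)[unfolded 1(1)]])
    fix z show "cell (posn t1 m z) = cell (posn t1 e1 z + d1)"
      using ci cj 1(5,6) by (cases z) (auto simp: posn_def)
  qed
  then have g: "g (posn t1 m)" using 1(4) by simp
  have pm: "(\<lambda>z. posn t1 (min e1 e2) z + d) = posn t1 m" unfolding p d_def by simp
  have "nrpath (a # ls) (q, posn t1 (min e1 e2)) (q', posn t1 (min f1 f2))"
    unfolding a nrpath.simps
    apply (rule exI[of _ q], rule exI[of _ q1], rule exI[of _ g], rule exI[of _ d])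
    apply (rule exI[of _ "posn t1 (min e1 e2)"])
    unfolding pm using 1(1,2) d g ci cj IH(3) by (auto simp: posn_def d_def m_def)
  then show ?case using IH by blast
qed

lemma nrpath_source: "nrpath ls (q1, v1) (q, w1) \<Longrightarrow> nrpath ls (q2, v2) (q, w2) \<Longrightarrow> q1 = q2"
  by (cases ls) auto

text \<open>Only the cell of \<open>False\<close> is recorded, since \<open>True\<close> is reset
  and thus not tested. The negative first argument of \<open>posn\<close> gives \<open>True\<close>
  the value 0.\<close>

definition laststep :: "'q trans \<Rightarrow> nat \<Rightarrow> 'q config \<Rightarrow> 'q config \<Rightarrow> bool" where
  "laststep \<tau> j c c' \<longleftrightarrow> (\<exists>q q' g d v. \<tau> = (q, q', g, {True}) \<and> \<tau> \<in> T \<and> c = (q, v) \<and> d > 0 \<and>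
     g (\<lambda>z. v z + d) \<and> cell (v False + d) = j \<and> c' = (q', posn (- (v False + d)) (v False + d)))"

lemma laststep_imp_st: "laststep \<tau> j c c' \<Longrightarrow> st {True} c c'"
  unfolding laststep_def st_def posn_def by (fastforce simp: fun_eq_iff)

text \<open>A label records the cell of the clock \<open>True\<close> at the reset of \<open>False\<close> and the word, with cells,
  that is read up to the next reset of \<open>True\<close>.\<close>

type_synonym 'r label = "nat \<times> ('r trans \<times> nat \<times> nat) list \<times> 'r trans \<times> nat"

definition labels :: "'q label set" where
  "labels = {..<\<kappa>} \<times> {ls. set ls \<subseteq> T \<times> {..<\<kappa>} \<times> {..<\<kappa>} \<and> length ls \<le> nr_bound} \<times> T \<times> {..<\<kappa>}"

definition lab :: "'q label \<Rightarrow> 'q config \<Rightarrow> 'q config \<Rightarrow> bool" where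
  "lab = (\<lambda>(i, ls, \<tau>, j) c h. \<exists>w. snd c False = 0 \<and> cell (snd c True) = i \<and> nrpath ls c w \<and> laststep \<tau> j w h)"

lemma finite_labels: "finite labels"
  unfolding labels_def using finite_T by (intro finite_cartesian_product finite_lists_length_le) auto

text \<open>To make finitely many labels suffice, the segment before the reset of
  \<open>True\<close> is first replaced by one of length at most \<open>nr_bound\<close>.\<close>

lemma ex_lab:
  assumes "snd c False = 0" "sreset {True} c h" shows "\<exists>k\<in>labels. lab k c h"
proof -
  from assms(2) obtain w where w: "(st {})\<^sup>*\<^sup>* c w" "st {True} w h" unfolding sreset_def by blast
  obtain ls where ls: "length ls \<le> nr_bound" "set ls \<subseteq> T \<times> {..<\<kappa>} \<times> {..<\<kappa>}" "nrpath ls c w"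
    using nr_short[OF w(1)] nr_imp_nrpath by metis
  obtain q v q' g d where s: "w = (q, v)" "h = (q', \<lambda>z. if z \<in> {True} then 0 else v z + d)"
    "(q, q', g, {True}) \<in> T" "d > 0" "g (\<lambda>z. v z + d)" using w(2) unfolding st_def by auto
  have "h = (q', posn (- (v False + d)) (v False + d))" using s(2) by (auto simp: posn_def fun_eq_iff)
  then have "laststep (q, q', g, {True}) (cell (v False + d)) w h"
    unfolding laststep_def using s by auto
  then show ?thesis
    using ls assms(1) cell_less s(3) unfolding lab_def labels_def
    by (intro bexI[of _ "(cell (snd c True), ls, (q, q', g, {True}), cell (v False + d))"])
      (simp_all del: split_paired_Ex, blast)
qed

text \<open>The two occurrences of the label differ in the value of \<open>True\<close> when
  \<open>False\<close> is reset, \<open>t1\<close> and \<open>t2\<close>. If \<open>t1\<close> is at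
  most \<open>t2\<close>, the reset of \<open>False\<close> is delayed. Otherwise the minimum of
  both timings is followed from \<open>c1\<close>, and the reset of \<open>True\<close> is delayed.
  Either way the target \<open>h2\<close> becomes reachable after a different past, so the label
  contains all that matters about the past.\<close>

lemma splice:
  assumes m: "sreset {False} m c1" and l1: "lab k c1 h1" and l2: "lab k c2 h2"
  shows "\<exists>c. sreset {False} m c \<and> sreset {True} c h2"
proof -
  obtain i ls \<tau> j where k: "k = (i, ls, \<tau>, j)" by (metis prod_cases4)
  have posn: "\<exists>q t. c = (q, posn t 0) \<and> cell t = i" if "lab k c h" for c h
  proof -
    have c: "snd c = posn (snd c True) 0" "cell (snd c True) = i"
      using that unfolding k lab_def posn_def by (auto simp: fun_eq_iff)
    show ?thesis by (intro exI[of _ "fst c"] exI[of _ "snd c True"]) (use c in \<open>auto simp: prod_eq_iff\<close>)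
  qed
  obtain q t1 where c1: "c1 = (q, posn t1 0)" "cell t1 = i" using posn[OF l1] by blast
  obtain q2 t2 where c2: "c2 = (q2, posn t2 0)" "cell t2 = i" using posn[OF l2] by blast
  obtain w1 w2 where w: "nrpath ls c1 w1" "laststep \<tau> j w1 h1" "nrpath ls c2 w2" "laststep \<tau> j w2 h2"
    using l1 l2 unfolding k lab_def by auto
  obtain p p' g d1 v1 where 1: "\<tau> = (p, p', g, {True})" "\<tau> \<in> T" "w1 = (p, v1)" "d1 > 0"
    "g (\<lambda>z. v1 z + d1)" "cell (v1 False + d1) = j" "h1 = (p', posn (- (v1 False + d1)) (v1 False + d1))"
    using w(2) unfolding laststep_def by auto
  obtain d2 v2 where 2: "w2 = (p, v2)" "d2 > 0"
    "g (\<lambda>z. v2 z + d2)" "cell (v2 False + d2) = j" "h2 = (p', posn (- (v2 False + d2)) (v2 False + d2))"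
    using w(4) 1(1) unfolding laststep_def by auto
  have q2: "q2 = q" using nrpath_source w(1,3) 1(3) 2(1) c1 c2 by metis
  show ?thesis
  proof (cases "t1 \<le> t2")
    case True
    \<comment> \<open>The delayed reset of \<open>False\<close> lets \<open>True\<close> grow within
      its cell from \<open>t1\<close> to \<open>t2\<close>; this is exactly the configuration
      \<open>c2\<close>.\<close>
    have "sreset {False} m (q, posn t2 0)"
      using m[unfolded c1] by (rule sreset_delay[where \<delta> = "t2 - t1"]) (use True c1 c2 in \<open>auto simp:
          posn_def\<close>)
    moreover have "sreset {True} (q, posn t2 0) h2"
      unfolding sreset_def using nrpath_imp_nr[OF w(3)] laststep_imp_st[OF w(4)] c2 q2 by blast
    ultimately show ?thesis by blast
  next
    case False
    obtain f1 f2 where f: "v1 = posn t1 f1" "v2 = posn t2 f2" "nrpath ls (q, posn t1 0) (p, posn t1 (min f1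
        f2))"
      using nrpath_min[of ls q t1 0 p v1 t2 0 v2] w(1,3) c1 c2 q2 1(3) 2(1) False by auto
    define u where "u = min (f1 + d1) (f2 + d2)"
    define d where "d = u - min f1 f2"
    have d: "d > 0" unfolding d_def u_def using 1(4) 2(2) by auto
    have cu: "cell u = j" unfolding u_def using 1(6) 2(4) f by (auto simp: min_def posn_def)
    have "g (\<lambda>z. posn t1 (min f1 f2) z + d) \<longleftrightarrow> g (\<lambda>z. v1 z + d1)"
      by (rule guard_cong[OF 1(2)[unfolded 1(1)]]) (use cu 1(6) f in \<open>auto simp: posn_def d_def\<close>)
    then have "laststep \<tau> j (p, posn t1 (min f1 f2)) (p', posn (- u) u)"
      unfolding laststep_def using 1 d cu
      by (intro exI[of _ p] exI[of _ p'] exI[of _ g] exI[of _ d] exI[of _ "posn t1 (min f1 f2)"]) (auto simp: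
          posn_def d_def)
    then have s: "sreset {True} c1 (p', posn (- u) u)"
      unfolding sreset_def c1 using nrpath_imp_nr[OF f(3)] laststep_imp_st by blast
    \<comment> \<open>This reset forgets \<open>True\<close>, and \<open>False\<close> may advance
      from \<open>u\<close> to its value in \<open>h2\<close>, both of which lie in cell
      \<open>j\<close>.\<close>
    have "sreset {True} c1 h2"
      unfolding 2(5) using s by (rule sreset_delay[where \<delta> = "f2 + d2 - u"])
        (use cu 2(4) f in \<open>auto simp: posn_def u_def\<close>)
    then show ?thesis using m by blast
  qed
qed

text \<open>By \<open>splice\<close>, the first of two swaps with equal labels can be made to end
  where the second one ends.\<close>

lemma swap_short: assumes "swap\<^sup>*\<^sup>* a b" shows "\<exists>n\<le>card labels. (swap ^^ n) a b"
proof (rule relpowp_shorten[where Q = "\<lambda>k a b. \<exists>m c. noswap a m \<and> sreset {False} m c \<and> lab k c b",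
    OF finite_labels _ _ assms])
  show "\<exists>k\<in>labels. \<exists>m c. noswap a m \<and> sreset {False} m c \<and> lab k c b" if "swap a b" for a b
    using that ex_lab sreset_zero[of "{False}"] unfolding swap_def by blast
  fix k a b c d
  assume "\<exists>m c. noswap a m \<and> sreset {False} m c \<and> lab k c b"
    and "\<exists>m c'. noswap c m \<and> sreset {False} m c' \<and> lab k c' d"
  then obtain m c1 c2 where "noswap a m" "sreset {False} m c1" "lab k c1 b" "lab k c2 d" by blast
  with splice[OF this(2-4)] show "swap a d" unfolding swap_def by blast
qed

definition "swap_bound = noswap_bound + 2 * (nr_bound + 1)"

lemma swap_reaches: "swap a b \<Longrightarrow> reaches (stp UNIV) swap_bound a b"
proof -
  assume "swap a b"
  then obtain m n where "noswap a m" "sreset {False} m n" "sreset {True} n b" unfolding swap_def by blast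
  then show ?thesis unfolding swap_bound_def mult_2
    by (intro reaches_trans[OF noswap_reaches] reaches_trans[OF sreset_reaches sreset_reaches]) auto
qed

section \<open>Decomposition of arbitrary paths and the bound on their length\<close>

lemma noswap_iff: "noswap a b \<longleftrightarrow>
  (\<exists>m n. blk\<^sup>*\<^sup>* a m \<and> (sreset {True})\<^sup>*\<^sup>* m n \<and> (sreset {False})\<^sup>*\<^sup>* n b)"
  unfolding noswap_def ab_def by (simp only: relcompp_apply) blast

lemma noswap_refl: "noswap c c"
  unfolding noswap_iff by (intro exI[of _ c]) simp

lemma bool_set_cases: "R = {} \<or> R = {True} \<or> R = {False} \<or> R = UNIV"
proof -
  have "R = (if True \<in> R then {True} else {}) \<union> (if False \<in> R then {False} else {})"
  proof (rule set_eqI)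
    fix x show "x \<in> R \<longleftrightarrow> x \<in> (if True \<in> R then {True} else {}) \<union> (if False \<in> R then {False} else {})"
      by (cases x) simp_all
  qed
  then show ?thesis unfolding UNIV_bool by (auto split: if_splits)
qed

lemma noswapI: "blk\<^sup>*\<^sup>* a m \<Longrightarrow> (sreset {True})\<^sup>*\<^sup>* m n \<Longrightarrow> (sreset {False})\<^sup>*\<^sup>* n b \<Longrightarrow> noswap a b"
  unfolding noswap_def ab_def by (intro relcomppI)

text \<open>A further reset can complete a swap only at the very end, namely when
  \<open>True\<close> is reset after a nonempty series of resets of \<open>False\<close>; the last
  member of that series is then split off.\<close>

lemma noswap_append:
  assumes "noswap a b" "sreset R b c" "R \<noteq> {}"
  shows "noswap a c \<or> swap a c"
proof -
  obtain m n where m: "blk\<^sup>*\<^sup>* a m" "(sreset {True})\<^sup>*\<^sup>* m n" "(sreset {False})\<^sup>*\<^sup>* n b"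
    using assms(1) unfolding noswap_iff by (elim exE conjE)
  consider "R = UNIV" | "R = {False}" | "R = {True}"
  proof -
    have "R = {} \<or> R = {True} \<or> R = {False} \<or> R = UNIV"
      by (rule bool_set_cases)
    then show thesis using assms(3) that by argo
  qed
  then show ?thesis
  proof cases
    case 1
    have "ab m b" unfolding ab_def using m(2,3) by (rule relcomppI)
    then have "blk m c" unfolding blk_def using assms(2)[unfolded 1] by (rule relcomppI)
    with m(1) have "blk\<^sup>*\<^sup>* a c" by (rule rtranclp.rtrancl_into_rtrancl)
    then have "noswap a c" by (rule noswapI) (rule rtranclp.rtrancl_refl)+
    then show ?thesis ..
  next
    case 2
    with m(3) assms(2) have "(sreset {False})\<^sup>*\<^sup>* n c" by (simp add: rtranclp.rtrancl_into_rtrancl)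
    with m(1,2) have "noswap a c" by (rule noswapI)
    then show ?thesis ..
  next
    case 3
    show ?thesis using m(3)
    proof (cases rule: rtranclp.cases)
      case rtrancl_refl
      with m(2) assms(2) 3 have "(sreset {True})\<^sup>*\<^sup>* m c" by (simp add: rtranclp.rtrancl_into_rtrancl)
      with m(1) have "noswap a c" by (rule noswapI) (rule rtranclp.rtrancl_refl)
      then show ?thesis ..
    next
      case (rtrancl_into_rtrancl k)
      have "noswap a k" using m(1,2) rtrancl_into_rtrancl(1) by (rule noswapI)
      moreover have "(sreset {False} OO sreset {True}) k c"
        using rtrancl_into_rtrancl(2) assms(2)[unfolded 3] by (rule relcomppI)
      ultimately have "swap a c" unfolding swap_def by (rule relcomppI)
      then show ?thesis ..
    qed
  qed
qed

lemma decompose: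
  assumes "(stp UNIV)\<^sup>*\<^sup>* a b"
  shows "\<exists>m n. swap\<^sup>*\<^sup>* a m \<and> noswap m n \<and> (st {})\<^sup>*\<^sup>* n b"
  using assms
proof (induction rule: rtranclp_induct)
  case base then show ?case by (intro exI[of _ a]) (simp add: noswap_refl)
next
  case (step y z)
  from step.IH obtain m n where m: "swap\<^sup>*\<^sup>* a m" "noswap m n" "(st {})\<^sup>*\<^sup>* n y" by (elim exE conjE)
  obtain R where R: "st R y z" using step(2) unfolding stp_def by (elim exE conjE)
  show ?case
  proof (cases "R = {}")
    case True
    then have "(st {})\<^sup>*\<^sup>* n z" using m R by simp
    then show ?thesis using m by - (rule exI[of _ m], rule exI[of _ n], simp)
  next
    case False
    have "sreset R n z" unfolding sreset_def using m(3) R by (rule relcomppI)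
    from noswap_append[OF m(2) this False] show ?thesis
    proof
      assume "noswap m z"
      then show ?thesis using m(1) by - (rule exI[of _ m], rule exI[of _ z], simp)
    next
      assume "swap m z"
      then have "swap\<^sup>*\<^sup>* a z" using m(1) by simp
      then show ?thesis using noswap_refl by (intro exI[of _ z]) simp
    qed
  qed
qed

definition "path_bound = card labels * swap_bound + (noswap_bound + nr_bound)"

theorem path_short: assumes "(stp UNIV)\<^sup>*\<^sup>* a b" shows "reaches (stp UNIV) path_bound a b"
proof -
  obtain m n where "swap\<^sup>*\<^sup>* a m" "noswap m n" "(st {})\<^sup>*\<^sup>* n b" using decompose[OF assms] by (elim exE conjE)
  then show ?thesis unfolding path_bound_def
    by (intro reaches_trans[OF reaches_shorten[OF swap_short swap_reaches]]
        reaches_trans[OF noswap_reaches nr_reaches])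
qed

text \<open>Made for loops in which the clock other than \<open>z\<close> measures time: shortening
  must not introduce resets of it.\<close>

lemma path_short_single:
  assumes "(stp {z})\<^sup>*\<^sup>* a b" shows "reaches (stp {z}) (single_bound + nr_bound) a b"
proof -
  have "((sreset {z})\<^sup>*\<^sup>* OO (st {})\<^sup>*\<^sup>*) a b" using assms
  proof (induction rule: rtranclp_induct)
    case (step y x)
    then obtain m where m: "(sreset {z})\<^sup>*\<^sup>* a m" "(st {})\<^sup>*\<^sup>* m y" by blast
    obtain R where R: "st R y x" "R \<subseteq> {z}" using step(2) unfolding stp_def by auto
    show ?case
    proof (cases "R = {}")
      case True
      then have "(st {})\<^sup>*\<^sup>* m x" using m R by auto
      then show ?thesis using m by blast
    next
      case False
      then have "R = {z}" using R by auto
      then have "sreset {z} m x" using m R unfolding sreset_def by blast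
      then have "(sreset {z})\<^sup>*\<^sup>* a x" using m by auto
      then show ?thesis by blast
    qed
  qed blast
  then obtain m where "(sreset {z})\<^sup>*\<^sup>* a m" "(st {})\<^sup>*\<^sup>* m b" by blast
  then show ?thesis by (intro reaches_trans[OF sreset_single_reaches nr_reaches]) auto
qed

end

section \<open>Lassos from infinite runs\<close>

lemma infinite_ge: "infinite (J :: nat set) \<Longrightarrow> \<exists>j\<in>J. n \<le> j"
  using infinite_nat_iff_unbounded_le by blast

lemma infinite_same:
  assumes "infinite (I :: nat set)" "finite K" "\<And>i. i \<in> I \<Longrightarrow> f i \<in> K"
  shows "\<exists>k. infinite {i \<in> I. f i = k}"
proof -
  have "finite (f ` I)" using assms(2,3) by (meson finite_subset image_subsetI)
  then show ?thesis using pigeonhole_infinite[OF assms(1)] by blast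
qed

context two_clocks begin

definition "loop_bound = path_bound + single_bound + nr_bound"

text \<open>The loop leads from \<open>a\<close> through the accepting \<open>p\<close> to
  \<open>b\<close>; the separate step to \<open>a'\<close> makes it nonempty. It closes exactly, up
  to values beyond \<open>tp\<close>, or else only up to cells. In the latter case at most one clock
  is reset in the loop, with value 0 at both ends, and then the other clock, which is not reset,
  shows that the loop takes less than \<open>\<delta>\<close>.\<close>

definition lasso :: "real \<Rightarrow> real \<Rightarrow> 'q set \<Rightarrow> nat \<Rightarrow> 'q config \<Rightarrow> bool" where
  "lasso tp \<delta> B n c \<longleftrightarrow> (\<exists>Z a a' p b. reaches (stp UNIV) n c a \<and> stp Z a a' \<and> reaches (stp Z) n a' p \<and>
     reaches (stp Z) n p b \<and> fst p \<in> B \<and> fst a = fst b \<and>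
     ((\<forall>z. snd a z = snd b z \<or> tp < snd a z \<and> tp < snd b z) \<or>
      (\<forall>z. if z \<in> Z then snd a z = 0 \<and> snd b z = 0 \<and> (\<not> z) \<notin> Z \<and> snd b (\<not> z) < snd a (\<not> z) + \<delta>
           else cell (snd a z) = cell (snd b z))))"

context
  fixes c R B and tp \<delta> :: real
  assumes run: "\<And>i. st (R i) (c i) (c (Suc i))"
    and acc: "\<And>i. \<exists>p\<ge>i. fst (c p) \<in> B" and \<delta>: "\<delta> > 0"
begin

lemma run_path: "i \<le> j \<Longrightarrow> (\<And>k. i \<le> k \<Longrightarrow> k < j \<Longrightarrow> R k \<subseteq> Z) \<Longrightarrow> (stp Z)\<^sup>*\<^sup>* (c i) (c j)"
proof (induction rule: dec_induct)
  case (step n)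
  then have "(stp Z)\<^sup>*\<^sup>* (c i) (c n)" by auto
  moreover have "stp Z (c n) (c (Suc n))" using run[of n] step unfolding stp_def by blast
  ultimately show ?case by (rule rtranclp.rtrancl_into_rtrancl)
qed simp

lemma run_nr: "i \<le> j \<Longrightarrow> (\<And>k. i \<le> k \<Longrightarrow> k < j \<Longrightarrow> R k = {}) \<Longrightarrow> (st {})\<^sup>*\<^sup>* (c i) (c j)"
proof (induction rule: dec_induct)
  case (step n)
  then have "(st {})\<^sup>*\<^sup>* (c i) (c n)" by auto
  moreover have "st {} (c n) (c (Suc n))" using run[of n] step by simp
  ultimately show ?case by (rule rtranclp.rtrancl_into_rtrancl)
qed simp

lemma reaches_loop: "(stp UNIV)\<^sup>*\<^sup>* a b \<Longrightarrow> reaches (stp UNIV) loop_bound a b"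
  using path_short by (rule reaches_mono) (simp_all add: loop_bound_def)

lemma lasso_exact:
  assumes i: "i < p" "fst (c p) \<in> B" "(stp UNIV)\<^sup>*\<^sup>* (c p) b" "fst (c i) = fst b"
    and "\<And>z. snd (c i) z = snd b z \<or> tp < snd (c i) z \<and> tp < snd b z"
  shows "lasso tp \<delta> B loop_bound (c 0)"
  unfolding lasso_def
proof (intro exI conjI)
  show "reaches (stp UNIV) loop_bound (c 0) (c i)" "reaches (stp UNIV) loop_bound (c (Suc i)) (c p)"
    using i(1) by (intro reaches_loop run_path; simp)+
  show "stp UNIV (c i) (c (Suc i))" using run unfolding stp_def by blast
  show "reaches (stp UNIV) loop_bound (c p) b" using i by (intro reaches_loop)
qed (use assms in simp_all)

text \<open>Shortening within \<open>stp Z\<close> preserves the endpoints, hence their cells and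
  the duration of the loop as read off the clock that is not reset.\<close>

lemma lasso_small:
  assumes i: "i < p" "p \<le> j" "fst (c p) \<in> B" "fst (c i) = fst (c j)"
    and R: "\<And>k. i \<le> k \<Longrightarrow> k < j \<Longrightarrow> R k \<subseteq> Z" and Z: "Z = {} \<or> Z = {z}"
    and closing: "\<And>z. if z \<in> Z then snd (c i) z = 0 \<and> snd (c j) z = 0 \<and> snd (c j) (\<not> z) < snd (c i) (\<not> z) + \<delta>
           else cell (snd (c i) z) = cell (snd (c j) z)"
  shows "lasso tp \<delta> B loop_bound (c 0)"
proof -
  have short: "reaches (stp Z) loop_bound a b" if path: "(stp Z)\<^sup>*\<^sup>* a b" for a b
    using Z
  proof
    assume Z: "Z = {}"
    have "stp {} = st {}" unfolding stp_def by (intro ext) simp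
    then have "(st {})\<^sup>*\<^sup>* a b" using path Z by simp
    then have "reaches (stp Z) nr_bound a b" by (rule nr_reaches)
    then show ?thesis by (rule reaches_mono) (simp add: loop_bound_def)
  next
    assume Z: "Z = {z}"
    have "reaches (stp {z}) (single_bound + nr_bound) a b"
      using path unfolding Z by (rule path_short_single)
    then show ?thesis unfolding Z by (rule reaches_mono) (simp add: loop_bound_def)
  qed
  have nz: "(\<not> x) \<notin> Z" if "x \<in> Z" for x
    using that Z by fastforce
  have "(stp Z)\<^sup>*\<^sup>* (c (Suc i)) (c p)" by (rule run_path) (use i R[OF Suc_leD] in simp_all)
  moreover have "(stp Z)\<^sup>*\<^sup>* (c p) (c j)"
  proof (rule run_path[OF i(2)])
    fix k assume "p \<le> k" "k < j" then show "R k \<subseteq> Z" using R[of k] i(1) by linarith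
  qed
  moreover have "(stp UNIV)\<^sup>*\<^sup>* (c 0) (c i)" by (rule run_path) simp_all
  moreover have "stp Z (c i) (c (Suc i))"
    using run[of i] R[of i] i unfolding stp_def by (intro exI[of _ "R i"] conjI) simp_all
  moreover have "\<forall>z. if z \<in> Z then snd (c i) z = 0 \<and> snd (c j) z = 0 \<and> (\<not> z) \<notin> Z \<and> snd (c j) (\<not> z) < snd (c i)
      (\<not> z) + \<delta>
           else cell (snd (c i) z) = cell (snd (c j) z)"
  proof
    fix x show "if x \<in> Z then snd (c i) x = 0 \<and> snd (c j) x = 0 \<and> (\<not> x) \<notin> Z \<and> snd (c j) (\<not> x) < snd (c i) (\<not>
        x) + \<delta>
           else cell (snd (c i) x) = cell (snd (c j) x)"
      using closing[of x] nz[of x] by argo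
  qed
  ultimately show ?thesis unfolding lasso_def using i(3,4)
    by (intro exI[of _ Z] exI[of _ "c i"] exI[of _ "c (Suc i)"] exI[of _ "c p"] exI[of _ "c j"] conjI
        short reaches_loop disjI2)
qed

lemma run_states: "fst (c (Suc i)) \<in> Qs"
  using run st_states by blast

text \<open>Two double resets that lead into the same state lead into the same
  configuration.\<close>

lemma lasso_double_reset:
  assumes "infinite {i. R i = UNIV}"
  shows "lasso tp \<delta> B loop_bound (c 0)"
proof -
  obtain q where q: "infinite {i \<in> {i. R i = UNIV}. fst (c (Suc i)) = q}" (is "infinite ?J")
    using infinite_same[OF assms finite_Qs, of "\<lambda>i. fst (c (Suc i))"] run_states by blast
  obtain i where i: "i \<in> ?J" using infinite_ge[OF q] by blast
  obtain p where p: "p \<ge> Suc (Suc i)" "fst (c p) \<in> B" using acc by blast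
  obtain j where j: "j \<in> ?J" "j \<ge> p" using infinite_ge[OF q] by blast
  have "snd (c (Suc i)) z = 0" "snd (c (Suc j)) z = 0" for z
    using st_reset[OF run] i j by auto
  then show ?thesis using i j p by (intro lasso_exact[of "Suc i" p "c (Suc j)"] run_path) auto
qed

text \<open>One label occurs at infinitely many swaps. From a late occurrence \<open>splice\<close>
  leads to the exact configuration that ended an early one. So the loop closes exactly, although the
  run itself need not visit any configuration twice.\<close>

lemma lasso_swaps:
  assumes inf: "infinite I"
    and I: "\<And>i. i \<in> I \<Longrightarrow> R i = {False} \<and> (\<exists>j>i. R j = {True} \<and> (\<forall>k. i < k \<and> k < j \<longrightarrow> R k = {}))"
  shows "lasso tp \<delta> B loop_bound (c 0)"
proof -
  have "\<exists>j. j > i \<and> (\<exists>k\<in>labels. lab k (c (Suc i)) (c (Suc j)))" if i: "i \<in> I" for i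
  proof -
    obtain j where j: "j > i" "R j = {True}" "\<forall>k. i < k \<and> k < j \<longrightarrow> R k = {}" using I[OF i] by (elim conjE exE)
    have "(st {})\<^sup>*\<^sup>* (c (Suc i)) (c j)" using j by (intro run_nr) auto
    moreover have "st {True} (c j) (c (Suc j))" using run[of j] j(2) by simp
    ultimately have s: "sreset {True} (c (Suc i)) (c (Suc j))" unfolding sreset_def by (rule relcomppI)
    have "R i = {False}" using I[OF i] ..
    then have "snd (c (Suc i)) False = 0" using st_reset[OF run[of i], of False] by simp
    from ex_lab[OF this s] show ?thesis using j(1) by (intro exI[of _ j] conjI)
  qed
  then have "\<forall>i\<in>I. \<exists>j. j > i \<and> (\<exists>k\<in>labels. lab k (c (Suc i)) (c (Suc j)))" by (intro ballI)
  from bchoice[OF this] obtain j where j: "\<forall>i\<in>I. j i > i \<and> (\<exists>k\<in>labels. lab k (c (Suc i)) (c (Suc (j i))))"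
    by (elim exE)
  then have "\<forall>i\<in>I. \<exists>k. k \<in> labels \<and> lab k (c (Suc i)) (c (Suc (j i)))" unfolding Bex_def by fast
  from bchoice[OF this] obtain k where "\<forall>i\<in>I. k i \<in> labels \<and> lab (k i) (c (Suc i)) (c (Suc (j i)))"
    by (elim exE)
  then have k: "i \<in> I \<Longrightarrow> k i \<in> labels" "i \<in> I \<Longrightarrow> lab (k i) (c (Suc i)) (c (Suc (j i)))" for i
    by (simp_all only: Ball_def)
  obtain l where l: "infinite {i \<in> I. k i = l}" using infinite_same[OF inf finite_labels, of k] k(1) by blast
  obtain i where i: "i \<in> I" "k i = l" using infinite_ge[OF l] by blast
  obtain p where p: "p \<ge> Suc (Suc (j i))" "fst (c p) \<in> B" using acc by blast
  obtain i' where i': "i' \<in> I" "k i' = l" "i' \<ge> p" using infinite_ge[OF l] by blast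
  have "R i' = {False}" using I[OF i'(1)] ..
  then have st: "st {False} (c i') (c (Suc i'))" using run[of i'] by simp
  have s: "sreset {False} (c i') (c (Suc i'))" unfolding sreset_def using rtranclp.rtrancl_refl st by (rule
      relcomppI)
  obtain x where x: "sreset {False} (c i') x" "sreset {True} x (c (Suc (j i)))"
    using splice[OF s k(2)[OF i'(1), unfolded i'(2)] k(2)[OF i(1), unfolded i(2)]] by (elim exE conjE)
  have path: "(stp UNIV)\<^sup>*\<^sup>* (c p) (c i')" using i' by (intro run_path) auto
  have "(stp UNIV)\<^sup>*\<^sup>* (c i') x" "(stp UNIV)\<^sup>*\<^sup>* x (c (Suc (j i)))"
    using x[THEN sreset_reaches, OF subset_UNIV] by (auto intro: reaches_imp_rtranclp)
  with path have "(stp UNIV)\<^sup>*\<^sup>* (c p) (c (Suc (j i)))" by (rule rtranclp_trans[OF rtranclp_trans])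
  with _ p(2) show ?thesis by (rule lasso_exact[of "Suc (j i)" p]) (use p in auto)
qed

text \<open>With \<open>Z\<close> empty the loop has to close up to state and cells only, and these
  recur by the pigeonhole principle; its duration is not limited.\<close>

lemma lasso_no_resets:
  assumes "\<And>i. i \<ge> M \<Longrightarrow> R i = {}"
  shows "lasso tp \<delta> B loop_bound (c 0)"
proof -
  let ?f = "\<lambda>i. (fst (c (Suc i)), cell (snd (c (Suc i)) True), cell (snd (c (Suc i)) False))"
  have "infinite {M..}" by (simp add: infinite_Ici)
  then obtain k where k: "infinite {i \<in> {M..}. ?f i = k}" (is "infinite ?J")
    using infinite_same[of "{M..}" "Qs \<times> {..<\<kappa>} \<times> {..<\<kappa>}" ?f] finite_Qs run_states cell_less by auto
  obtain i where i: "i \<in> ?J" using infinite_ge[OF k] by blast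
  obtain p where p: "p \<ge> Suc (Suc i)" "fst (c p) \<in> B" using acc by blast
  obtain j where j: "j \<in> ?J" "j \<ge> p" using infinite_ge[OF k] by blast
  have f: "?f i = ?f j" using i j by auto
  show ?thesis
  proof (rule lasso_small[where Z = "{}" and i = "Suc i" and p = p and j = "Suc j"])
    fix z show "if z \<in> {} then snd (c (Suc i)) z = 0 \<and> snd (c (Suc j)) z = 0 \<and> snd (c (Suc j)) (\<not> z) < snd (c
        (Suc i)) (\<not> z) + \<delta>
      else cell (snd (c (Suc i)) z) = cell (snd (c (Suc j)) z)"
      using f by (cases z) simp_all
  qed (use i j p f assms in auto)
qed

text \<open>The clock that is no longer reset increases from \<open>M\<close> on. Either it
  eventually exceeds \<open>tp\<close>, and the loop closes exactly up to such values; or it is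
  bounded and converges, and then every late loop takes less than \<open>\<delta>\<close>.\<close>

lemma lasso_single_resets:
  assumes sub: "\<And>i. i \<ge> M \<Longrightarrow> R i \<subseteq> {z}" and inf: "infinite {i. R i = {z}}"
  shows "lasso tp \<delta> B loop_bound (c 0)"
proof -
  define y where "y i = snd (c i) (\<not> z)" for i
  have step: "y i < y (Suc i)" if "i \<ge> M" for i
  proof -
    have "(\<not> z) \<notin> R i" using sub[OF that] by (cases z) auto
    then show ?thesis unfolding y_def by (rule st_elapse[OF run])
  qed
  have mono: "y i \<le> y j" if "M \<le> i" "i \<le> j" for i j
    using that(2)
  proof (induction rule: dec_induct)
    case (step n)
    then show ?case using \<open>M \<le> i\<close> \<open>\<And>i. M \<le> i \<Longrightarrow> y i < y (Suc i)\<close>[of n] by simp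
  qed simp
  obtain N where N: "N \<ge> M" "(\<forall>i\<ge>N. tp < y i) \<or> (\<forall>i\<ge>N. \<forall>j\<ge>i. y j < y i + \<delta>)"
  proof (cases "\<exists>i\<ge>M. tp < y i")
    case True
    then obtain i where "i \<ge> M" "tp < y i" by blast
    then have "\<forall>j\<ge>i. tp < y j" using mono less_le_trans by blast
    then show ?thesis using that \<open>i \<ge> M\<close> by blast
  next
    case False
    let ?A = "y ` {M..}"
    have bdd: "bdd_above ?A" using False by (intro bdd_aboveI[of _ tp]) (auto simp: not_less)
    have "Sup ?A - \<delta> < Sup ?A" using \<delta> by simp
    then obtain i where i: "i \<ge> M" "Sup ?A - \<delta> < y i"
      using less_cSup_iff[OF _ bdd, of "Sup ?A - \<delta>"] by auto
    have "y j' < y j + \<delta>" if "j \<ge> i" "j' \<ge> j" for j j'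
    proof -
      have "y j' \<le> Sup ?A" using that i by (intro cSup_upper[OF _ bdd]) auto
      moreover have "y i \<le> y j" using mono i that by auto
      ultimately show ?thesis using i by linarith
    qed
    then show ?thesis using that i by blast
  qed
  let ?I = "{i. R i = {z}} - {..<N}"
  have I: "infinite ?I" using inf by (simp add: Diff_infinite_finite)
  let ?f = "\<lambda>i. (fst (c (Suc i)), cell (y (Suc i)))"
  obtain k where k: "infinite {i \<in> ?I. ?f i = k}" (is "infinite ?J")
    using infinite_same[OF I, of "Qs \<times> {..<\<kappa>}" ?f] finite_Qs run_states cell_less by auto
  obtain i where i: "i \<in> ?J" using infinite_ge[OF k] by blast
  obtain p where p: "p \<ge> Suc (Suc i)" "fst (c p) \<in> B" using acc by blast
  obtain j where j: "j \<in> ?J" "j \<ge> p" using infinite_ge[OF k] by blast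
  have f: "?f i = ?f j" using i j by auto
  have ge: "N \<le> i" "i \<le> j" "p \<le> j" "Suc i < p" using i j p by auto
  have "R i = {z}" "R j = {z}" using i j by auto
  then have 0: "snd (c (Suc i)) z = 0" "snd (c (Suc j)) z = 0"
    using st_reset[OF run[of i], of z] st_reset[OF run[of j], of z] by simp_all
  from N(2) show ?thesis
  proof
    assume tp: "\<forall>i\<ge>N. tp < y i"
    show ?thesis
    proof (rule lasso_exact[of "Suc i" p "c (Suc j)"])
      fix x show "snd (c (Suc i)) x = snd (c (Suc j)) x \<or> tp < snd (c (Suc i)) x \<and> tp < snd (c (Suc j)) x"
      proof (cases "x = z")
        case True then show ?thesis using 0 by simp
      next
        case False
        then have "x = (\<not> z)" by (cases x) auto
        then show ?thesis using tp[rule_format, of "Suc i"] tp[rule_format, of "Suc j"] ge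
          unfolding y_def by simp
      qed
      show "(stp UNIV)\<^sup>*\<^sup>* (c p) (c (Suc j))" using ge by (intro run_path) simp_all
    qed (use ge p f in simp_all)
  next
    assume small: "\<forall>i\<ge>N. \<forall>j\<ge>i. y j < y i + \<delta>"
    have c: "snd (c (Suc j)) (\<not> z) < snd (c (Suc i)) (\<not> z) + \<delta>"
      using small[rule_format, of "Suc i" "Suc j"] ge unfolding y_def by simp
    show ?thesis
    proof (rule lasso_small[where Z = "{z}" and i = "Suc i" and p = p and j = "Suc j"])
      fix x show "if x \<in> {z} then snd (c (Suc i)) x = 0 \<and> snd (c (Suc j)) x = 0 \<and> snd (c (Suc j)) (\<not> x) < snd
          (c (Suc i)) (\<not> x) + \<delta>
        else cell (snd (c (Suc i)) x) = cell (snd (c (Suc j)) x)"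
      proof (cases "x = z")
        case True then show ?thesis using 0 c by simp
      next
        case False
        then have "x = (\<not> z)" by (cases x) auto
        then show ?thesis using f False unfolding y_def by simp
      qed
      show "R k \<subseteq> {z}" if "Suc i \<le> k" for k using that ge N(1) by (intro sub) simp
    qed (use ge p f in simp_all)
  qed
qed

text \<open>If swaps and double resets cease, then eventually at most one clock is reset, because a
  reset of \<open>False\<close> followed by some reset of \<open>True\<close> has a swap or a double
  reset in between.\<close>

theorem lasso_exists: "lasso tp \<delta> B loop_bound (c 0)"
proof (rule ccontr)
  assume neg: "\<not> lasso tp \<delta> B loop_bound (c 0)"
  let ?sw = "{i. R i = {False} \<and> (\<exists>j>i. R j = {True} \<and> (\<forall>k. i < k \<and> k < j \<longrightarrow> R k = {}))}"
  have "lasso tp \<delta> B loop_bound (c 0)" if "infinite ?sw"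
    using that by (rule lasso_swaps) (erule CollectD)
  then have "finite ?sw" using neg by argo
  moreover have "finite {i. R i = UNIV}" using neg lasso_double_reset by blast
  ultimately have "finite (?sw \<union> {i. R i = UNIV})" by (rule finite_UnI)
  then obtain N where N: "\<forall>i\<in>?sw \<union> {i. R i = UNIV}. i < N" unfolding finite_nat_set_iff_bounded by (elim exE)
  have nUNIV: "R i \<noteq> UNIV" if "i \<ge> N" for i
  proof
    assume "R i = UNIV"
    then have "i \<in> ?sw \<union> {i. R i = UNIV}" by (intro UnI2 CollectI)
    with N have "i < N" by (rule bspec)
    then show False using that by simp
  qed
  have "\<exists>z. \<exists>M. \<forall>i\<ge>M. R i \<subseteq> {z}"
  proof (cases "finite {i. R i = {True}}")
    case True
    then obtain M where M: "\<forall>i\<in>{i. R i = {True}}. i < M" unfolding finite_nat_set_iff_bounded by (elim exE)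
    have "R i \<subseteq> {False}" if "i \<ge> max M N" for i
    proof -
      have "R i \<noteq> {True}"
      proof
        assume "R i = {True}"
        then have "i < M" by (intro bspec[OF M] CollectI)
        then show False using that by simp
      qed
      moreover have "R i \<noteq> UNIV" using nUNIV that by simp
      ultimately show ?thesis using bool_set_cases[of "R i"] by (elim disjE) simp_all
    qed
    then show ?thesis by (intro exI allI impI)
  next
    case False
    have nF: "R i \<noteq> {False}" if "i \<ge> N" for i
    proof
      assume F: "R i = {False}"
      \<comment> \<open>\<open>j\<close> is the next reset of \<open>True\<close> and
        \<open>l\<close> below the last reset of \<open>False\<close> before \<open>j\<close>.
        Nothing is reset strictly between them, so \<open>l\<close> begins a swap, although it is
        not before \<open>N\<close>.\<close>
      define j where "j = (LEAST j. j > i \<and> R j = {True})"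
      obtain m where "R m = {True}" "Suc i \<le> m" using infinite_ge[OF False, of "Suc i"] by (elim bexE
          CollectE)
      then have "m > i \<and> R m = {True}" by simp
      from LeastI[of "\<lambda>j. j > i \<and> R j = {True}", OF this]
      have j: "j > i" "R j = {True}" unfolding j_def by (rule conjunct1, rule conjunct2)
      have least: "R k \<noteq> {True}" if "i < k" "k < j" for k using not_less_Least[of k "\<lambda>j. j > i \<and> R j =
          {True}"] that
        unfolding j_def by argo
      define l where "l = Max {l. l < j \<and> R l = {False}}"
      have fin: "finite {l. l < j \<and> R l = {False}}" by (rule finite_subset[of _ "{..<j}"]) (rule subsetI,
          simp, rule finite_lessThan)
      have l: "l < j" "R l = {False}" 
      proof -
        have "i \<in> {l. l < j \<and> R l = {False}}" using F j(1) by (intro CollectI conjI)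
        then have "{l. l < j \<and> R l = {False}} \<noteq> {}" by (metis empty_iff)
        then have "l \<in> {l. l < j \<and> R l = {False}}" unfolding l_def by (rule Max_in[OF fin])
        then show "l < j" "R l = {False}" by simp_all
      qed
      have "i \<le> l" unfolding l_def using F j(1) by (intro Max_ge[OF fin] CollectI conjI)
      have between: "\<forall>k. l < k \<and> k < j \<longrightarrow> R k = {}"
      proof (intro allI impI, elim conjE)
        fix k assume k: "l < k" "k < j"
        have "R k \<noteq> {False}"
        proof
          assume "R k = {False}"
          then have "k \<le> l" unfolding l_def using k by (intro Max_ge[OF fin] CollectI conjI)
          then show False using k by simp
        qed
        moreover have "R k \<noteq> {True}" using least[of k] k \<open>i \<le> l\<close> by linarith
        moreover have "R k \<noteq> UNIV" using nUNIV[of k] k \<open>i \<le> l\<close> \<open>i \<ge> N\<close> by linarith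
        ultimately show "R k = {}" using bool_set_cases[of "R k"] by (elim disjE) simp_all
      qed
      have "\<exists>j>l. R j = {True} \<and> (\<forall>k. l < k \<and> k < j \<longrightarrow> R k = {})"
        using l(1) j(2) between by (intro exI[of _ j] conjI)
      with l(2) have "l \<in> ?sw" by (intro CollectI conjI)
      then have "l \<in> ?sw \<union> {i. R i = UNIV}" by (rule UnI1)
      with N have "l < N" by (rule bspec)
      then show False using \<open>i \<le> l\<close> \<open>i \<ge> N\<close> by simp
    qed
    have "R i \<subseteq> {True}" if "i \<ge> N" for i 
      using bool_set_cases[of "R i"]
    proof (elim disjE)
      assume "R i = {False}" then show ?thesis using nF[OF that] by simp
    next
      assume "R i = UNIV" then show ?thesis using nUNIV[OF that] by simp
    qed simp_all
    then show ?thesis by (intro exI allI impI)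
  qed
  then obtain z M where "\<forall>i\<ge>M. R i \<subseteq> {z}" by (elim exE)
  then have M: "\<And>i. i \<ge> M \<Longrightarrow> R i \<subseteq> {z}" by (elim allE impE)
  have "finite {i. R i = {z}}" using neg lasso_single_resets[of M z, OF M] by (metis (no_types))
  then obtain K where K: "\<forall>i\<in>{i. R i = {z}}. i < K" unfolding finite_nat_set_iff_bounded by (elim exE)
  have "R i = {}" if "i \<ge> max M K" for i
  proof -
    have "R i = {} \<or> R i = {z}" using M[of i] that by (intro subset_singletonD) simp
    moreover have "R i \<noteq> {z}"
    proof
      assume "R i = {z}"
      then have "i < K" by (intro bspec[OF K] CollectI)
      then show False using that by simp
    qed
    ultimately show ?thesis by blast
  qed
  from neg lasso_no_resets[of "max M K", OF this] show False by (rule notE)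
qed

end

end

section \<open>Infinite runs from lassos\<close>

text \<open>Instead of concatenating infinitely many finite paths, a successor is chosen for each
  single configuration, such that the distance to the next visit of \<open>P\<close> from which the
  recurrence can go on decreases. As distances are natural numbers, such a visit always
  comes.\<close>

lemma infinite_run_of_recurrence:
  fixes S :: "'c \<Rightarrow> 'c \<Rightarrow> bool"
  assumes start: "S\<^sup>*\<^sup>* c0 a" "Inv a"
    and recur: "\<And>a. Inv a \<Longrightarrow> \<exists>p b. S\<^sup>+\<^sup>+ a p \<and> P p \<and> S\<^sup>*\<^sup>* p b \<and> Inv b"
  shows "\<exists>c. c 0 = c0 \<and> (\<forall>i. S (c i) (c (Suc i))) \<and> (\<forall>i. \<exists>j\<ge>i. P (c j))"
proof -
  define good where "good x \<longleftrightarrow> (\<exists>p b. S\<^sup>+\<^sup>+ x p \<and> P p \<and> S\<^sup>*\<^sup>* p b \<and> Inv b)" for x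
  have good_back: "good x" if xb: "S\<^sup>*\<^sup>* x b" and b: "Inv b" for x b
  proof -
    obtain p b' where "S\<^sup>+\<^sup>+ b p" "P p" "S\<^sup>*\<^sup>* p b'" "Inv b'" using recur[OF b] by (elim exE conjE)
    moreover have "S\<^sup>+\<^sup>+ x p" using xb \<open>S\<^sup>+\<^sup>+ b p\<close> by (rule rtranclp_tranclp_tranclp)
    ultimately show ?thesis unfolding good_def by (intro exI conjI)
  qed
  \<comment> \<open>\<open>Suc n\<close> excludes the present configuration; rank 0 means that one
    step leads to \<open>P\<close>.\<close>
  define Q where "Q n x \<longleftrightarrow> (\<exists>p. (S ^^ Suc n) x p \<and> P p \<and> good p)" for n x
  define rk where "rk x = (LEAST n. Q n x)" for x
  have ex: "\<exists>n. Q n x" if x: "good x" for x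
  proof -
    obtain p b where p: "S\<^sup>+\<^sup>+ x p" "P p" "S\<^sup>*\<^sup>* p b" "Inv b" using x unfolding good_def by (elim exE conjE)
    obtain n where n: "n > 0" "(S ^^ n) x p" using p(1) unfolding tranclp_power by (elim exE conjE)
    then obtain m where "n = Suc m" by (cases n) simp_all
    then show ?thesis unfolding Q_def using n(2) p(2) good_back[OF p(3,4)]
      by (intro exI[of _ m] exI[of _ p]) simp
  qed
  have Q_good: "good x" if Q: "Q n x" for n x
  proof -
    obtain p where p: "(S ^^ Suc n) x p" "good p" using Q unfolding Q_def by (elim exE conjE)
    obtain p' b where b: "S\<^sup>*\<^sup>* p' b" "Inv b" "S\<^sup>+\<^sup>+ p p'" using p(2) unfolding good_def by (elim exE conjE)
    have "S\<^sup>*\<^sup>* x p" using p(1) by (rule relpowp_imp_rtranclp)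
    then have "S\<^sup>*\<^sup>* x b" using tranclp_into_rtranclp[OF b(3)] b(1) by (rule rtranclp_trans[OF
        rtranclp_trans])
    then show ?thesis using b(2) by (rule good_back)
  qed
  have step: "\<exists>y. S x y \<and> good y \<and> (P y \<or> rk y < rk x)" if "good x" for x
  proof -
    have "Q (rk x) x" unfolding rk_def using ex[OF that] by (rule LeastI_ex)
    then obtain p where p: "(S ^^ Suc (rk x)) x p" "P p" "good p" unfolding Q_def by (elim exE conjE)
    obtain y where y: "S x y" "(S ^^ rk x) y p" using relpowp_Suc_D2[OF p(1)] by (elim exE conjE)
    show ?thesis
    proof (cases "rk x")
      case 0
      then have "y = p" using y(2) by simp
      then show ?thesis using y(1) p(2,3) by (intro exI[of _ y]) simp
    next
      case (Suc m)
      then have "Q m y" unfolding Q_def using y(2) p(2,3) by (intro exI[of _ p]) simp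
      moreover from this have "rk y \<le> m" unfolding rk_def by (rule Least_le)
      ultimately show ?thesis using y(1) Q_good[of m y] Suc by (intro exI[of _ y]) simp
    qed
  qed
  define nxt where "nxt x = (SOME y. S x y \<and> good y \<and> (P y \<or> rk y < rk x))" for x
  have nxt: "S x (nxt x) \<and> good (nxt x) \<and> (P (nxt x) \<or> rk (nxt x) < rk x)" if "good x" for x
    unfolding nxt_def using step[OF that] by (rule someI_ex)
  define c where "c n = (nxt ^^ n) c0" for n
  have good_c: "good (c n)" for n
  proof (induction n)
    case 0 then show ?case unfolding c_def using good_back[OF start] by simp
  next
    case (Suc n) then show ?case using nxt[of "c n"] unfolding c_def by simp
  qed
  have c_Suc: "c (Suc n) = nxt (c n)" for n unfolding c_def by simp
  have "\<exists>j\<ge>i. P (c j)" for i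
  proof (induction "rk (c i)" arbitrary: i rule: less_induct)
    case less
    show ?case
    proof (cases "P (c (Suc i))")
      case True then show ?thesis by (intro exI[of _ "Suc i"]) simp
    next
      case False
      then have "rk (c (Suc i)) < rk (c i)" using nxt[OF good_c[of i]] unfolding c_Suc by simp
      from less[OF this] obtain j where "j \<ge> Suc i" "P (c j)" by (elim exE conjE)
      then show ?thesis by (intro exI[of _ j]) simp
    qed
  qed
  moreover have "S (c i) (c (Suc i))" for i using nxt[OF good_c[of i]] unfolding c_Suc by simp
  moreover have "c 0 = c0" unfolding c_def by simp
  ultimately show ?thesis by (intro exI[of _ c]) simp
qed

lemma relpowp_of_steps: "i \<le> j \<Longrightarrow> (\<And>l. i \<le> l \<Longrightarrow> l < j \<Longrightarrow> S (f l) (f (Suc l))) \<Longrightarrow> (S ^^ (j - i)) (f i) (f j)"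
  unfolding relpowp_fun_conv by (intro exI[of _ "\<lambda>l. f (i + l)"]) auto

lemma tranclp_of_steps:
  assumes "i < j" "\<And>l. i \<le> l \<Longrightarrow> l < j \<Longrightarrow> S (f l) (f (Suc l))" shows "S\<^sup>+\<^sup>+ (f i) (f j)"
  unfolding tranclp_power using relpowp_of_steps[of i j S f] assms by (intro exI[of _ "j - i"]) simp

lemma rtranclp_of_steps:
  assumes "i \<le> j" "\<And>l. i \<le> l \<Longrightarrow> l < j \<Longrightarrow> S (f l) (f (Suc l))" shows "S\<^sup>*\<^sup>* (f i) (f j)"
  using relpowp_imp_rtranclp relpowp_of_steps[of i j S f] assms by metis

context two_clocks begin

lemma stI:
  assumes "(q, q', g, R) \<in> T" "0 < d" "g (\<lambda>z. v z + d)" "w = (\<lambda>z. if z \<in> R then 0 else v z + d)"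
  shows "st R (q, v) (q', w)"
  unfolding st_def assms(4) using assms(1-3) by (intro exI conjI) (rule refl | assumption)+

definition sim :: "real \<Rightarrow> 'q config \<Rightarrow> 'q config \<Rightarrow> bool" where
  "sim tp c d \<longleftrightarrow> fst c = fst d \<and> (\<forall>z. snd c z = snd d z \<or> tp < snd c z \<and> tp < snd d z)"

text \<open>Values beyond \<open>tp\<close> share a cell and stay beyond \<open>tp\<close> under
  delays, so both sides can use the same transition with the same delay.\<close>

lemma sim_step:
  assumes top: "\<forall>v w. tp < v \<longrightarrow> tp < w \<longrightarrow> cell v = cell w"
    and "sim tp c d" "stp Z c c'"
  shows "\<exists>d'. stp Z d d' \<and> sim tp c' d'"
proof -
  obtain R where R: "R \<subseteq> Z" "st R c c'" using assms(3) unfolding stp_def by (elim exE conjE)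
  obtain q v q' g e where s: "c = (q, v)" "c' = (q', \<lambda>z. if z \<in> R then 0 else v z + e)" "(q, q', g, R) \<in> T" "e
      > 0" "g (\<lambda>z. v z + e)"
    using R(2) unfolding st_def by (elim exE conjE)
  obtain w where w: "d = (q, w)" using assms(2) s(1) unfolding sim_def by (cases d) simp
  have eq: "v z = w z \<or> tp < v z \<and> tp < w z" for z using assms(2) unfolding sim_def s(1) w by simp
  have "g (\<lambda>z. w z + e) \<longleftrightarrow> g (\<lambda>z. v z + e)"
  proof (rule guard_cong[OF s(3)])
    fix z
    show "cell (w z + e) = cell (v z + e)"
      using eq[of z] top[rule_format, of "w z + e" "v z + e"] s(4) by auto
  qed
  then have "st R d (q', \<lambda>z. if z \<in> R then 0 else w z + e)"
    unfolding st_def w using s(3-5) by (intro exI conjI) (rule refl | assumption | simp)+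
  moreover have "sim tp c' (q', \<lambda>z. if z \<in> R then 0 else w z + e)"
    unfolding sim_def s(2) fst_conv snd_conv
  proof (intro conjI allI refl)
    fix z show "(if z \<in> R then 0 else v z + e) = (if z \<in> R then 0 else w z + e) \<or>
        tp < (if z \<in> R then 0 else v z + e) \<and> tp < (if z \<in> R then 0 else w z + e)"
      using eq[of z] s(4) by auto
  qed
  ultimately show ?thesis using R(1) unfolding stp_def by (intro exI conjI)
qed

lemma sim_tranclp:
  assumes "\<forall>v w. tp < v \<longrightarrow> tp < w \<longrightarrow> cell v = cell w" "(stp Z)\<^sup>+\<^sup>+ c c'" "sim tp c d"
  shows "\<exists>d'. (stp Z)\<^sup>+\<^sup>+ d d' \<and> sim tp c' d'"
  using assms(2)
proof (induction rule: tranclp_induct)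
  case (base y) then show ?case using sim_step[OF assms(1) assms(3)] by (metis tranclp.r_into_trancl)
next
  case (step y z)
  then obtain d' where d': "(stp Z)\<^sup>+\<^sup>+ d d'" "sim tp y d'" by (elim exE conjE)
  obtain d'' where "stp Z d' d''" "sim tp z d''" using sim_step[OF assms(1) d'(2) step(2)] by (elim exE conjE)
  then show ?case using d'(1) by (intro exI[of _ d'']) (simp add: tranclp.trancl_into_trancl)
qed

lemma sim_rtranclp:
  assumes "\<forall>v w. tp < v \<longrightarrow> tp < w \<longrightarrow> cell v = cell w" "(stp Z)\<^sup>*\<^sup>* c c'" "sim tp c d"
  shows "\<exists>d'. (stp Z)\<^sup>*\<^sup>* d d' \<and> sim tp c' d'"
  using assms(2)
proof (induction rule: rtranclp_induct)
  case base then show ?case using assms(3) by (intro exI[of _ d]) simp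
next
  case (step y z)
  then obtain d' where d': "(stp Z)\<^sup>*\<^sup>* d d'" "sim tp y d'" by (elim exE conjE)
  obtain d'' where "stp Z d' d''" "sim tp z d''" using sim_step[OF assms(1) d'(2) step(2)] by (elim exE conjE)
  then show ?case using d'(1) by (intro exI[of _ d'']) (simp add: rtranclp.rtrancl_into_rtrancl)
qed

theorem run_of_exact_lasso:
  assumes top: "\<forall>v w. tp < v \<longrightarrow> tp < w \<longrightarrow> cell v = cell w"
    and stem: "(stp UNIV)\<^sup>*\<^sup>* c0 a" and loop: "(stp UNIV)\<^sup>+\<^sup>+ a p" "fst p \<in> B" "(stp UNIV)\<^sup>*\<^sup>* p b"
    and closing: "sim tp a b"
  shows "\<exists>c. c 0 = c0 \<and> (\<forall>i. stp UNIV (c i) (c (Suc i))) \<and> (\<forall>i. \<exists>j\<ge>i. fst (c j) \<in> B)"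
proof (rule infinite_run_of_recurrence[OF stem, where Inv = "sim tp a"])
  show "sim tp a a" unfolding sim_def by simp
  fix d assume d: "sim tp a d"
  obtain p' where p': "(stp UNIV)\<^sup>+\<^sup>+ d p'" "sim tp p p'" using sim_tranclp[OF top loop(1) d] by (elim exE
      conjE)
  obtain b' where b': "(stp UNIV)\<^sup>*\<^sup>* p' b'" "sim tp b b'" using sim_rtranclp[OF top loop(3) p'(2)] by (elim
      exE conjE)
  have "sim tp a b'" unfolding sim_def
  proof (intro conjI allI)
    show "fst a = fst b'" using closing b'(2) unfolding sim_def by simp
    fix z show "snd a z = snd b' z \<or> tp < snd a z \<and> tp < snd b' z"
      using closing[unfolded sim_def, THEN conjunct2, rule_format, of z]
        b'(2)[unfolded sim_def, THEN conjunct2, rule_format, of z] by auto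
  qed
  moreover have "fst p' \<in> B" using p'(2) loop(2) unfolding sim_def by simp
  ultimately show "\<exists>p b. (stp UNIV)\<^sup>+\<^sup>+ d p \<and> fst p \<in> B \<and> (stp UNIV)\<^sup>*\<^sup>* p b \<and> sim tp a b"
    using p'(1) b'(1) by (intro exI conjI)
qed

text \<open>A loop that moves some clocks within a cell need not be repeatable as it is, but it can be
  repeated in ever shorter time.\<close>

theorem run_of_shrinking_lasso:
  assumes kn: "k < p" "p \<le> n" and stem: "(stp UNIV)\<^sup>*\<^sup>* c0 (q k, X k)" and B: "q p \<in> B" and qn: "q n = q k"
    and steps: "\<And>i. k \<le> i \<Longrightarrow> i < n \<Longrightarrow> (q i, q (Suc i), g i, R i) \<in> T \<and> d i > 0 \<and> g i (\<lambda>z. X i z + d i) \<and>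
        X (Suc i) = (\<lambda>z. if z \<in> R i then 0 else X i z + d i)"
    and closing: "\<And>z. X k z = 0 \<and> X n z = 0 \<and> (\<forall>i. k \<le> i \<and> i < n \<longrightarrow> (\<forall>v w. 0 < v \<and> v \<le> w \<and> w \<le> X i z + d i \<longrightarrow>
        cell v = cell w)) \<or>
        (\<forall>i. k \<le> i \<and> i < n \<longrightarrow> z \<notin> R i) \<and> cell (X k z) = cell (X n z)"
  shows "\<exists>c. c 0 = c0 \<and> (\<forall>i. stp UNIV (c i) (c (Suc i))) \<and> (\<forall>i. \<exists>j\<ge>i. fst (c j) \<in> B)"
proof -
  \<comment> \<open>All positive values up to those that the clock reaches in the loop lie in one
    cell, so scaling them down by a positive factor changes no guard.\<close>
  define small where "small z \<longleftrightarrow> (\<forall>i. k \<le> i \<and> i < n \<longrightarrow> (\<forall>v w. 0 < v \<and> v \<le> w \<and> w \<le> X i z + d i \<longrightarrow> cell v = cell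
      w))" for z
  define Z where "Z = {z. X k z = 0 \<and> X n z = 0 \<and> small z}"
  have inZ: "X k z = 0" "X n z = 0" "small z" if "z \<in> Z" for z using that unfolding Z_def by simp_all
  have small: "cell v = cell w" if "small z" "k \<le> i" "i < n" "0 < v" "v \<le> w" "w \<le> X i z + d i" for z i v w
    using that unfolding small_def by simp
  have outZ: "(\<forall>i. k \<le> i \<and> i < n \<longrightarrow> z \<notin> R i) \<and> cell (X k z) = cell (X n z)" if "z \<notin> Z" for z
    using closing[of z]
  proof
    assume "X k z = 0 \<and> X n z = 0 \<and> (\<forall>i. k \<le> i \<and> i < n \<longrightarrow> (\<forall>v w. 0 < v \<and> v \<le> w \<and> w \<le> X i z + d i \<longrightarrow> cell v =
        cell w))"
    then have "z \<in> Z" unfolding Z_def small_def by (rule CollectI)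
    then show ?thesis using that by simp
  qed
  have outR: "z \<notin> R i" if "z \<notin> Z" "k \<le> i" "i < n" for z i using outZ[OF that(1)] that(2,3) by simp
  have nonneg: "0 \<le> X i z" if "z \<in> Z" "k \<le> i" "i \<le> n" for z i
    using that(2,3)
  proof (induction rule: dec_induct)
    case base then show ?case using inZ(1)[OF that(1)] by simp
  next
    case (step i)
    then show ?case using steps[of i] by simp
  qed
  have inc: "X i z < X (Suc i) z" "X (Suc i) z = X i z + d i" if "z \<notin> Z" "k \<le> i" "i < n" for z i
    using steps[OF that(2,3)] outR[OF that] by simp_all
  have mono: "X i z \<le> X j z" if "z \<notin> Z" "k \<le> i" "i \<le> j" "j \<le> n" for z i j
    using that(3,4)
  proof (induction rule: dec_induct)
    case (step j)
    then show ?case using inc(1)[of z j] that by simp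
  qed simp
  have lt: "X k z < X n z" if "z \<notin> Z" for z
    using inc(1)[OF that, of k] mono[OF that, of "Suc k" n] kn by simp
  \<comment> \<open>Clocks outside \<open>Z\<close> may start a round anywhere between their two
    values at the ends of the loop, hence in the common cell. The strict upper bound leaves room for
    one more round.\<close>
  define Inv where "Inv = (\<lambda>(q', w). q' = q k \<and> (\<forall>z. if z \<in> Z then w z = 0 else X k z \<le> w z \<and> w z < X n z))"
  show ?thesis
  proof (rule infinite_run_of_recurrence[OF stem, where Inv = Inv])
    show "Inv (q k, X k)" unfolding Inv_def using inZ(1) lt by simp
    fix c assume "Inv c"
    define w where "w = snd c"
    have c: "c = (q k, w)" and cw: "\<forall>z. if z \<in> Z then w z = 0 else X k z \<le> w z \<and> w z < X n z"
      using \<open>Inv c\<close> unfolding Inv_def w_def by (simp_all add: case_prod_beta prod_eq_iff)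
    have wZ: "w z = 0" if "z \<in> Z" for z using cw[rule_format, of z] that by simp
    have w: "X k z \<le> w z \<and> w z < X n z" if "z \<notin> Z" for z using cw[rule_format, of z] that by simp
    \<comment> \<open>The time scale of the next round is \<open>l\<close>, chosen such that each
      clock outside \<open>Z\<close> uses at most half of the room left below
      \<open>X n z\<close>.\<close>
    define \<mu> where "\<mu> z = (if z \<in> Z then 1 else min 1 ((X n z - w z) / (2 * (X n z - X k z))))" for z
    define l where "l = min (\<mu> True) (\<mu> False)"
    have \<mu>: "0 < \<mu> z" for z unfolding \<mu>_def using w[of z] lt[of z] by simp
    have l: "0 < l" "l \<le> 1" unfolding l_def using \<mu> by (auto simp: \<mu>_def)
    have slack: "w z + l * (X n z - X k z) < X n z" if "z \<notin> Z" for z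
    proof -
      have "l \<le> \<mu> z" unfolding l_def by (cases z) simp_all
      also have "\<dots> \<le> (X n z - w z) / (2 * (X n z - X k z))" unfolding \<mu>_def using that by simp
      finally have "l * (X n z - X k z) \<le> (X n z - w z) / 2"
        using lt[OF that] by (simp add: field_simps)
      then show ?thesis using w[OF that] by (simp add: field_simps)
    qed
    \<comment> \<open>The round at scale \<open>l\<close>: clocks in \<open>Z\<close>, which start
      at 0, are scaled as a whole; the others keep their present value and add scaled
      increments.\<close>
    define Y where "Y i z = (if z \<in> Z then l * X i z else w z + l * (X i z - X k z))" for i z
    have Y: "X k z \<le> Y i z" "Y i z \<le> X n z" if "z \<notin> Z" "k \<le> i" "i \<le> n" for i z
    proof -
      have "0 \<le> l * (X i z - X k z)" using l(1) mono[OF that(1), of k i] that by simp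
      then show "X k z \<le> Y i z" unfolding Y_def using that(1) w[OF that(1)] by simp
      have "l * (X i z - X k z) \<le> l * (X n z - X k z)"
        using l(1) mono[OF that(1,2,3)] by (simp add: mult_left_mono)
      then show "Y i z \<le> X n z" unfolding Y_def using that(1) slack[OF that(1)] by simp
    qed
    have st: "stp UNIV (q i, Y i) (q (Suc i), Y (Suc i))" if i: "k \<le> i" "i < n" for i
    proof -
      note s = steps[OF i]
      have "g i (\<lambda>z. Y i z + l * d i) \<longleftrightarrow> g i (\<lambda>z. X i z + d i)"
      proof (rule guard_cong[OF s[THEN conjunct1]])
        fix z assume zR: "z \<notin> R i"
        show "cell (Y i z + l * d i) = cell (X i z + d i)"
        proof (cases "z \<in> Z")
          case True
          have "0 \<le> X i z" "0 < d i" using nonneg[OF True i(1)] i(2) s by simp_all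
          then have "0 < X i z + d i" by simp
          then have "0 < l * (X i z + d i)" "l * (X i z + d i) \<le> X i z + d i"
            using l by (simp_all add: mult_left_le_one_le)
          from small[OF inZ(3)[OF True] i this order_refl] show ?thesis
            unfolding Y_def using True by (simp add: distrib_left)
        next
          case False
          have e: "Y i z + l * d i = Y (Suc i) z"
            unfolding Y_def using False inc(2)[OF False i] by (simp add: algebra_simps)
          have n: "k \<le> Suc i" "Suc i \<le> n" using i by simp_all
          have "cell (Y (Suc i) z) = cell (X k z)"
            by (rule cell_convex[OF outZ[OF False, THEN conjunct2] Y(1)[OF False n] Y(2)[OF False n]])
          moreover have "cell (X (Suc i) z) = cell (X k z)"
            by (rule cell_convex[OF outZ[OF False, THEN conjunct2] mono[OF False order_refl n] mono[OF False n
                order_refl]])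
          ultimately show ?thesis unfolding e inc(2)[OF False i, symmetric] by simp
        qed
      qed
      then have gd: "g i (\<lambda>z. Y i z + l * d i)" using s by simp
      have "Y (Suc i) = (\<lambda>z. if z \<in> R i then 0 else Y i z + l * d i)"
      proof
        fix z show "Y (Suc i) z = (if z \<in> R i then 0 else Y i z + l * d i)"
          using s outR[of z i] i unfolding Y_def by (cases "z \<in> Z") (simp_all add: algebra_simps)
      qed
      moreover have "0 < l * d i" using l s by simp
      ultimately have "st (R i) (q i, Y i) (q (Suc i), Y (Suc i))"
        using stI[OF s[THEN conjunct1], of "l * d i" "Y i"] gd by simp
      then show ?thesis unfolding stp_def by (intro exI[of _ "R i"]) simp
    qed
    have Yk: "Y k = w"
    proof
      fix z show "Y k z = w z" unfolding Y_def using wZ inZ(1) by simp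
    qed
    have "(stp UNIV)\<^sup>+\<^sup>+ (q k, Y k) (q p, Y p)"
      by (rule tranclp_of_steps[of k p "stp UNIV" "\<lambda>i. (q i, Y i)"]) (use kn st in simp_all)
    moreover have "(stp UNIV)\<^sup>*\<^sup>* (q p, Y p) (q n, Y n)"
      by (rule rtranclp_of_steps[of p n "stp UNIV" "\<lambda>i. (q i, Y i)"]) (use kn st in simp_all)
    moreover have "Inv (q n, Y n)" unfolding Inv_def prod.case
    proof (intro conjI allI)
      fix z show "if z \<in> Z then Y n z = 0 else X k z \<le> Y n z \<and> Y n z < X n z"
        using Y(1)[of z n] slack[of z] inZ(2)[of z] kn unfolding Y_def by simp
    qed (use qn in simp)
    moreover have "fst (q p, Y p) \<in> B" using B by simp
    ultimately show "\<exists>p b. (stp UNIV)\<^sup>+\<^sup>+ c p \<and> fst p \<in> B \<and> (stp UNIV)\<^sup>*\<^sup>* p b \<and> Inv b"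
      unfolding c Yk by (intro exI conjI)
  qed
qed

end

section \<open>Guards, cells and lassos of parametric automata\<close>

fun cmpv :: "comparison \<Rightarrow> 'v::linorder \<Rightarrow> 'v \<Rightarrow> bool" where
  "cmpv Less v w \<longleftrightarrow> v < w"
| "cmpv Equal v w \<longleftrightarrow> v = w"

text \<open>Guards in which the unit of time is \<open>u\<close> and the parameter is \<open>a - b\<close>, without subtraction
  so that they make sense for natural numbers, too.\<close>

fun sat :: "'v::linordered_semidom \<Rightarrow> 'v \<Rightarrow> 'v \<Rightarrow> ('x \<Rightarrow> 'v) \<Rightarrow> ('x, 'p) constraint \<Rightarrow> bool" where
  "sat u a b w (Atom x r (Const c)) \<longleftrightarrow> cmpv r (w x) (of_nat c * u)"
| "sat u a b w (Atom x r (Param \<mu>)) \<longleftrightarrow> cmpv r (w x + b) a"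
| "sat u a b w (Neg \<gamma>) \<longleftrightarrow> \<not> sat u a b w \<gamma>"
| "sat u a b w (Conj \<gamma> \<gamma>') \<longleftrightarrow> sat u a b w \<gamma> \<and> sat u a b w \<gamma>'"

fun constraint_consts :: "('x, 'p) constraint \<Rightarrow> nat set" where
  "constraint_consts (Atom x r (Const c)) = {c}"
| "constraint_consts (Atom x r (Param \<mu>)) = {}"
| "constraint_consts (Neg \<gamma>) = constraint_consts \<gamma>"
| "constraint_consts (Conj \<gamma> \<gamma>') = constraint_consts \<gamma> \<union> constraint_consts \<gamma>'"

text \<open>Expressed through additions and comparisons, so that it can be read over the natural
  numbers and scales with the unit \<open>u\<close>.\<close>

definition samecell :: "'v::linordered_semidom \<Rightarrow> 'v \<Rightarrow> 'v \<Rightarrow> nat \<Rightarrow> 'v \<Rightarrow> 'v \<Rightarrow> bool" where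
  "samecell u a b C v w \<longleftrightarrow> (\<forall>c\<le>C. (v < of_nat c * u \<longleftrightarrow> w < of_nat c * u) \<and> (v = of_nat c * u \<longleftrightarrow> w = of_nat c *
      u)) \<and>
     (v + b < a \<longleftrightarrow> w + b < a) \<and> (v + b = a \<longleftrightarrow> w + b = a)"

definition above :: "'v::linordered_semidom \<Rightarrow> 'v \<Rightarrow> 'v \<Rightarrow> nat \<Rightarrow> 'v \<Rightarrow> bool" where
  "above u a b C v \<longleftrightarrow> of_nat C * u < v \<and> a < v + b"

text \<open>The first alternative is meant for a clock that is reset in the loop: staying below the
  unit, and below the parameter if that is positive, keeps its positive values in one cell. It
  replaces the bound on the duration by a condition on single steps. Note that \<open>b < a\<close>
  says that the parameter is positive.\<close>

definition loop_clock :: "'v::linordered_semidom \<Rightarrow> 'v \<Rightarrow> 'v \<Rightarrow> nat \<Rightarrow> nat \<Rightarrow> nat \<Rightarrow> (nat \<Rightarrow> 'v) \<Rightarrow> (nat \<Rightarrow> 'v) \<Rightarrow> bool"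
    where
  "loop_clock u a b C k n d X \<longleftrightarrow>
     X k = 0 \<and> X n = 0 \<and> (\<forall>i. k \<le> i \<and> i < n \<longrightarrow> X i + d i < u \<and> (b < a \<longrightarrow> X i + d i + b < a)) \<or>
     (\<forall>i. k \<le> i \<and> i < n \<longrightarrow> X (Suc i) = X i + d i) \<and> samecell u a b C (X k) (X n)"

definition exact_clock :: "'v::linordered_semidom \<Rightarrow> 'v \<Rightarrow> 'v \<Rightarrow> nat \<Rightarrow> nat \<Rightarrow> nat \<Rightarrow> (nat \<Rightarrow> 'v) \<Rightarrow> bool" where
  "exact_clock u a b C k n X \<longleftrightarrow> X k = X n \<or> above u a b C (X k) \<and> above u a b C (X n)"

type_synonym nat_pta = "(nat, nat, nat, nat) pta"

definition timed_step :: "nat_pta \<Rightarrow> nat \<Rightarrow> nat \<Rightarrow> 'v::linordered_semidom \<Rightarrow> 'v \<Rightarrow> 'v \<Rightarrow> (nat \<Rightarrow> nat) \<Rightarrow> (nat \<Rightarrow> 'v) \<Rightarrow>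
    (nat \<Rightarrow> 'v) \<Rightarrow> (nat \<Rightarrow> 'v) \<Rightarrow> nat \<Rightarrow> bool" where
  "timed_step A x y u a b q d X Y i \<longleftrightarrow> (\<exists>\<gamma> l S. (q i, q (Suc i), \<gamma>, l, S) \<in> transitions A \<and>
     sat u a b (\<lambda>z. if z = x then X i + d i else Y i + d i) \<gamma> \<and>
     X (Suc i) = (if x \<in> S then 0 else X i + d i) \<and> Y (Suc i) = (if y \<in> S then 0 else Y i + d i))"

text \<open>The loop starts at \<open>k\<close>, accepts at \<open>p\<close> and ends at
  \<open>n\<close>. Only the very first delay may be 0, and \<open>0 < k\<close> keeps that step out
  of the loop.\<close>

definition timed_lasso :: "nat_pta \<Rightarrow> nat \<Rightarrow> nat \<Rightarrow> nat \<Rightarrow> nat \<Rightarrow> nat \<Rightarrow> nat \<Rightarrow> (nat \<Rightarrow> nat) \<Rightarrow>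
    'v::linordered_semidom \<Rightarrow> 'v \<Rightarrow> 'v \<Rightarrow> (nat \<Rightarrow> 'v) \<Rightarrow> (nat \<Rightarrow> 'v) \<Rightarrow> (nat \<Rightarrow> 'v) \<Rightarrow> bool" where
  "timed_lasso A x y C n k p q u a b d X Y \<longleftrightarrow> 0 < u \<and> q 0 = initial A \<and> X 0 = 0 \<and> Y 0 = 0 \<and> 0 \<le> d 0 \<and>
     (\<forall>i. 0 < i \<and> i < n \<longrightarrow> 0 < d i) \<and> 0 < k \<and> k < p \<and> p \<le> n \<and> q p \<in> buechi A \<and> q n = q k \<and>
     (\<forall>i<n. timed_step A x y u a b q d X Y i) \<and>
     (exact_clock u a b C k n X \<and> exact_clock u a b C k n Y \<or>
      loop_clock u a b C k n d X \<and> loop_clock u a b C k n d Y)"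

section \<open>Cells of real clock values\<close>

definition cell_of :: "nat \<Rightarrow> real \<Rightarrow> real \<Rightarrow> nat" where
  "cell_of C \<mu> v = (card {c. c \<le> C \<and> real c < v} + card {c. c \<le> C \<and> real c \<le> v}) * 3 +
     (if v < \<mu> then 0 else if v = \<mu> then 1 else 2)"

lemma cell_of_less: "cell_of C \<mu> v < (2 * C + 3) * 3"
proof -
  have "card {c. c \<le> C \<and> P c} \<le> Suc C" for P
    using card_mono[of "{..C}" "{c. c \<le> C \<and> P c}"] by auto
  from this[of "\<lambda>c. real c < v"] this[of "\<lambda>c. real c \<le> v"]
  show ?thesis unfolding cell_of_def by auto
qed

text \<open>Both cardinalities are monotone in the clock value. So for \<open>v \<le> w\<close>
  equality of their sums forces equality of each, and then of the nested sets. One number below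
  \<open>2 * C + 3\<close> thus codes the comparisons with all constants, and the factor 3 in
  \<open>cell_of\<close> makes room for the comparison with \<open>\<mu>\<close>.\<close>

lemma cell_of_eq_le:
  assumes "cell_of C \<mu> v = cell_of C \<mu> w" "v \<le> w"
  shows "(\<forall>c\<le>C. (v < real c \<longleftrightarrow> w < real c) \<and> (v = real c \<longleftrightarrow> w = real c)) \<and> (v < \<mu> \<longleftrightarrow> w < \<mu>) \<and> (v = \<mu> \<longleftrightarrow> w = \<mu>)"
proof -
  define L where "L v = {c. c \<le> C \<and> real c < v}" for v
  define M where "M v = {c. c \<le> C \<and> real c \<le> v}" for v
  define s where "s v = (if v < \<mu> then 0 else if v = \<mu> then 1 else (2::nat))" for v
  have fin: "finite (L v)" "finite (M v)" for v
    unfolding L_def M_def by (rule finite_subset[of _ "{..C}"]; auto)+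
  have sub: "L v \<subseteq> L w" "M v \<subseteq> M w" unfolding L_def M_def using assms(2) by auto
  then have le: "card (L v) \<le> card (L w)" "card (M v) \<le> card (M w)" using fin by (simp_all add: card_mono)
  have s3: "s v < 3" "s w < 3" unfolding s_def by auto
  have "(card (L v) + card (M v)) * 3 + s v = (card (L w) + card (M w)) * 3 + s w"
    using assms(1) unfolding cell_of_def L_def M_def s_def .
  then have eq: "card (L v) + card (M v) = card (L w) + card (M w)" "s v = s w"
    using s3 by presburger+
  then have "card (L v) = card (L w)" "card (M v) = card (M w)" using le by linarith+
  then have LM: "L v = L w" "M v = M w" using card_subset_eq[OF fin(1) sub(1)] card_subset_eq[OF fin(2)
      sub(2)] by simp_all
  have "(v < real c \<longleftrightarrow> w < real c) \<and> (v = real c \<longleftrightarrow> w = real c)" if "c \<le> C" for c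
  proof -
    have "c \<in> L v \<longleftrightarrow> c \<in> L w" "c \<in> M v \<longleftrightarrow> c \<in> M w" using LM by simp_all
    then show ?thesis using that unfolding L_def M_def by (auto simp: not_le[symmetric])
  qed
  moreover have "(v < \<mu> \<longleftrightarrow> w < \<mu>) \<and> (v = \<mu> \<longleftrightarrow> w = \<mu>)" using eq(2) unfolding s_def by (auto split: if_splits)
  ultimately show ?thesis by simp
qed

lemma cell_of_eq_iff:
  "cell_of C \<mu> v = cell_of C \<mu> w \<longleftrightarrow>
   (\<forall>c\<le>C. (v < real c \<longleftrightarrow> w < real c) \<and> (v = real c \<longleftrightarrow> w = real c)) \<and> (v < \<mu> \<longleftrightarrow> w < \<mu>) \<and> (v = \<mu> \<longleftrightarrow> w = \<mu>)"
proof
  assume eq: "cell_of C \<mu> v = cell_of C \<mu> w"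
  show "(\<forall>c\<le>C. (v < real c \<longleftrightarrow> w < real c) \<and> (v = real c \<longleftrightarrow> w = real c)) \<and> (v < \<mu> \<longleftrightarrow> w < \<mu>) \<and> (v = \<mu> \<longleftrightarrow> w = \<mu>)"
  proof (cases "v \<le> w")
    case True then show ?thesis using cell_of_eq_le[OF eq] by simp
  next
    case False
    then have "w \<le> v" by simp
    from cell_of_eq_le[OF eq[symmetric] this] show ?thesis by metis
  qed
next
  assume r: "(\<forall>c\<le>C. (v < real c \<longleftrightarrow> w < real c) \<and> (v = real c \<longleftrightarrow> w = real c)) \<and> (v < \<mu> \<longleftrightarrow> w < \<mu>) \<and> (v = \<mu> \<longleftrightarrow> w =
      \<mu>)"
  have "real c < v \<longleftrightarrow> real c < w" "real c \<le> v \<longleftrightarrow> real c \<le> w" if "c \<le> C" for c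
  proof -
    have "(v < real c \<longleftrightarrow> w < real c) \<and> (v = real c \<longleftrightarrow> w = real c)" using r that by simp
    then show "real c < v \<longleftrightarrow> real c < w" "real c \<le> v \<longleftrightarrow> real c \<le> w" by linarith+
  qed
  then have "{c. c \<le> C \<and> real c < v} = {c. c \<le> C \<and> real c < w}" "{c. c \<le> C \<and> real c \<le> v} = {c. c \<le> C \<and> real c
      \<le> w}"
    by blast+
  then show "cell_of C \<mu> v = cell_of C \<mu> w" unfolding cell_of_def using r by simp
qed

lemma samecell_iff: "samecell 1 a b C v w \<longleftrightarrow> cell_of C (a - b) v = cell_of C (a - b) (w :: real)"
  unfolding samecell_def cell_of_eq_iff by (simp add: algebra_simps less_diff_eq eq_diff_eq)

lemma cell_of_convex:
  assumes "cell_of C \<mu> v = cell_of C \<mu> w" "v \<le> m" "m \<le> w"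
  shows "cell_of C \<mu> m = cell_of C \<mu> v"
proof -
  have c: "(m < r \<longleftrightarrow> v < r) \<and> (m = r \<longleftrightarrow> v = r)" if "(v < r \<longleftrightarrow> w < r) \<and> (v = r \<longleftrightarrow> w = r)" for r
    using that assms(2,3) by linarith
  show ?thesis using assms(1) unfolding cell_of_eq_iff using c by presburger
qed

lemma cell_of_top: "max (real C) \<mu> < v \<Longrightarrow> max (real C) \<mu> < w \<Longrightarrow> cell_of C \<mu> v = cell_of C \<mu> w"
proof -
  assume a: "max (real C) \<mu> < v" "max (real C) \<mu> < w"
  have "(v < r \<longleftrightarrow> w < r) \<and> (v = r \<longleftrightarrow> w = r)" if "r \<le> max (real C) \<mu>" for r using a that by linarith
  then show ?thesis unfolding cell_of_eq_iff by simp
qed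

lemma cell_of_small: "0 < v \<Longrightarrow> v \<le> w \<Longrightarrow> w < 1 \<Longrightarrow> (0 < \<mu> \<Longrightarrow> w < \<mu>) \<Longrightarrow> cell_of C \<mu> v = cell_of C \<mu> w"
proof -
  assume a: "0 < v" "v \<le> w" "w < 1" "0 < \<mu> \<Longrightarrow> w < \<mu>"
  have "(v < real c \<longleftrightarrow> w < real c) \<and> (v = real c \<longleftrightarrow> w = real c)" for c
    using a by (cases c) auto
  moreover have "(v < \<mu> \<longleftrightarrow> w < \<mu>) \<and> (v = \<mu> \<longleftrightarrow> w = \<mu>)" using a by (cases "0 < \<mu>") auto
  ultimately show ?thesis unfolding cell_of_eq_iff by simp
qed

section \<open>The two-clock system of an automaton\<close>

definition guard :: "nat \<Rightarrow> real \<Rightarrow> (nat, nat) constraint \<Rightarrow> (bool \<Rightarrow> real) \<Rightarrow> bool" where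
  "guard x \<mu> \<gamma> v \<longleftrightarrow> satisfies (\<lambda>z. v (z = x)) (\<lambda>_. \<mu>) \<gamma>"

lemma guard_cell_cong:
  assumes "constraint_consts \<gamma> \<subseteq> {..C}" "\<And>z. z \<in> constraint_clocks \<gamma> \<Longrightarrow> cell_of C \<mu> (v (z = x)) = cell_of C \<mu>
      (w (z = x))"
  shows "guard x \<mu> \<gamma> v \<longleftrightarrow> guard x \<mu> \<gamma> w"
  using assms
proof (induction \<gamma>)
  case (Atom z r \<beta>)
  have e: "cell_of C \<mu> (v (z = x)) = cell_of C \<mu> (w (z = x))" using Atom.prems(2) by simp
  show ?case
  proof (cases \<beta>)
    case (Const c)
    then show ?thesis using e[unfolded cell_of_eq_iff] Atom.prems(1) by (cases r) (simp_all add: guard_def)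
  next
    case (Param m)
    then show ?thesis using e[unfolded cell_of_eq_iff] by (cases r) (simp_all add: guard_def)
  qed
qed (simp_all add: guard_def)

lemma sat_guard: "sat 1 a b (\<lambda>z. if z = x then v else w) \<gamma> \<longleftrightarrow> guard x (a - b) \<gamma> (\<lambda>t. if t then v else (w ::
    real))"
proof (induction \<gamma>)
  case (Atom z r \<beta>) then show ?case
    by (cases \<beta>; cases r) (auto simp: guard_def)
qed (simp_all add: guard_def)

lemma satisfies_param_cong:
  assumes "constraint_params \<gamma> \<subseteq> {m}" "\<And>z. z \<in> constraint_clocks \<gamma> \<Longrightarrow> v z = w z"
  shows "satisfies v I \<gamma> \<longleftrightarrow> satisfies w (\<lambda>_. I m) \<gamma>"
  using assms
proof (induction \<gamma>)
  case (Atom z r \<beta>) then show ?case by (cases \<beta>; cases r) auto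
qed simp_all

text \<open>\<open>x\<close> and \<open>y\<close> name the two abstract clocks; an automaton with
  fewer clocks is padded with names that it does not contain. \<open>C\<close> is any bound on its
  constants, and \<open>m\<close> likewise need not be the name of an actual parameter.\<close>

locale nrt_automaton =
  fixes A :: nat_pta and x y m C :: nat
  assumes nrt: "parametric_nrtTA A" and xy: "x \<noteq> y" "clocks A \<subseteq> {x, y}" and params: "params A \<subseteq> {m}"
    and const_le: "(q, q', \<gamma>, l, S) \<in> transitions A \<Longrightarrow> constraint_consts \<gamma> \<subseteq> {..C}"
begin

definition nm :: "bool \<Rightarrow> nat" where "nm t = (if t then x else y)"

definition T :: "real \<Rightarrow> nat trans set" where
  "T \<mu> = (\<lambda>(q, q', \<gamma>, l, S). (q, q', guard x \<mu> \<gamma>, {t. nm t \<in> S})) ` transitions A"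

lemma transition_facts:
  assumes "(q, q', \<gamma>, l, S) \<in> transitions A"
  shows "q \<in> states A" "q' \<in> states A" "l \<in> alphabet A" "S \<subseteq> clocks A" "constraint_clocks \<gamma> \<subseteq> {x, y}"
    "constraint_params \<gamma> \<subseteq> {m}" "constraint_clocks \<gamma> \<inter> S = {}" "constraint_clocks \<gamma> \<subseteq> clocks A"
proof -
  have "transitions A \<subseteq> states A \<times> states A \<times> constraints_over (clocks A) (params A) \<times> alphabet A \<times> Pow
      (clocks A)"
    using nrt unfolding parametric_nrtTA_def parametric_TA_def by simp
  from subsetD[OF this assms] have f: "q \<in> states A" "q' \<in> states A" "l \<in> alphabet A" "S \<subseteq> clocks A"
      "constraint_clocks \<gamma> \<subseteq> clocks A" "constraint_params \<gamma> \<subseteq> params A"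
    unfolding constraints_over_def by simp_all
  then show "q \<in> states A" "q' \<in> states A" "l \<in> alphabet A" "S \<subseteq> clocks A" "constraint_clocks \<gamma> \<subseteq> clocks A" by
      simp_all
  show "constraint_clocks \<gamma> \<subseteq> {x, y}" "constraint_params \<gamma> \<subseteq> {m}" using f xy params by auto
  have "\<forall>(q, q', \<gamma>, a, S)\<in>transitions A. constraint_clocks \<gamma> \<inter> S = {}"
    using nrt unfolding parametric_nrtTA_def by simp
  from bspec[OF this assms] show "constraint_clocks \<gamma> \<inter> S = {}" by simp
qed

lemma T_E:
  assumes "(q, q', g, R) \<in> T \<mu>"
  obtains \<gamma> l S where "(q, q', \<gamma>, l, S) \<in> transitions A" "g = guard x \<mu> \<gamma>" "R = {t. nm t \<in> S}"
  using assms unfolding T_def by auto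

lemma T_I: "(q, q', \<gamma>, l, S) \<in> transitions A \<Longrightarrow> (q, q', guard x \<mu> \<gamma>, {t. nm t \<in> S}) \<in> T \<mu>"
  unfolding T_def by (rule image_eqI[of _ _ "(q, q', \<gamma>, l, S)"]) simp_all

lemma two_clocks_T: "two_clocks (states A) (T \<mu>) (cell_of C \<mu>) ((2 * C + 3) * 3)"
proof
  show "finite (states A)" using nrt unfolding parametric_nrtTA_def parametric_TA_def by simp
  show "finite (T \<mu>)" using nrt unfolding T_def parametric_nrtTA_def parametric_TA_def by simp
  show "q \<in> states A \<and> q' \<in> states A" if "(q, q', g, R) \<in> T \<mu>" for q q' g R
    using that transition_facts(1,2) by (elim T_E) simp
  show "cell_of C \<mu> r < (2 * C + 3) * 3" for r by (rule cell_of_less)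
  show "cell_of C \<mu> v = cell_of C \<mu> w \<Longrightarrow> v \<le> m \<Longrightarrow> m \<le> w \<Longrightarrow> cell_of C \<mu> m = cell_of C \<mu> v" for v w m
    by (rule cell_of_convex)
  fix q q' g R v w
  assume t: "(q, q', g, R) \<in> T \<mu>" and c: "\<And>z. z \<notin> R \<Longrightarrow> cell_of C \<mu> (v z) = cell_of C \<mu> (w z)"
  obtain \<gamma> l S where s: "(q, q', \<gamma>, l, S) \<in> transitions A" "g = guard x \<mu> \<gamma>" "R = {t. nm t \<in> S}"
    using t by (rule T_E)
  show "g v \<longleftrightarrow> g w" unfolding s(2)
  proof (rule guard_cell_cong[OF const_le[OF s(1)]])
    fix z assume z: "z \<in> constraint_clocks \<gamma>"
    then have "nm (z = x) = z" using transition_facts(5)[OF s(1)] unfolding nm_def by auto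
    \<comment> \<open>Here the condition on non-resetting tests enters: a clock of the guard is not
      in \<open>S\<close>.\<close>
    then have "nm (z = x) \<notin> S" using z transition_facts(7)[OF s(1)] by auto
    then show "cell_of C \<mu> (v (z = x)) = cell_of C \<mu> (w (z = x))" by (intro c) (simp add: s(3))
  qed
qed

end

section \<open>From an accepting run to a timed lasso\<close>

lemma joined_path:
  assumes "f m = g 0" "\<forall>i<m. P (f i) (f (Suc i))" "\<forall>i<n. Q (g i) (g (Suc i))"
  shows "\<exists>h. (\<forall>i\<le>m. h i = f i) \<and> (\<forall>i\<le>n. h (m + i) = g i) \<and> (\<forall>i<m. P (h i) (h (Suc i))) \<and>
    (\<forall>i. m \<le> i \<and> i < m + n \<longrightarrow> Q (h i) (h (Suc i)))"
proof -
  define h where "h i = (if i \<le> m then f i else g (i - m))" for i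
  have hm: "h (m + i) = g i" for i using assms(1) unfolding h_def by (cases i) simp_all
  have "Q (h i) (h (Suc i))" if mi: "m \<le> i" "i < m + n" for i
  proof -
    obtain j where "i = m + j" using le_Suc_ex[OF mi(1)] by (elim exE)
    have e: "h (Suc (m + j)) = g (Suc j)" using hm[of "Suc j"] unfolding add_Suc_right .
    have "j < n" using \<open>i = m + j\<close> mi(2) by simp
    then show ?thesis unfolding \<open>i = m + j\<close> hm e using assms(3) by blast
  qed
  moreover have "\<forall>i\<le>m. h i = f i" unfolding h_def by simp
  moreover have "\<forall>i<m. P (h i) (h (Suc i))" unfolding h_def using assms(2) by simp
  ultimately show ?thesis using hm by (intro exI[of _ h]) simp
qed

context nrt_automaton begin

lemma stp_data:
  assumes "two_clocks.stp (T \<mu>) Z c c'"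
  shows "\<exists>d \<gamma> l S. 0 < d \<and> (fst c, fst c', \<gamma>, l, S) \<in> transitions A \<and> {t. nm t \<in> S} \<subseteq> Z \<and>
    guard x \<mu> \<gamma> (\<lambda>t. snd c t + d) \<and> snd c' = (\<lambda>t. if nm t \<in> S then 0 else snd c t + d)"
proof -
  interpret two_clocks "states A" "T \<mu>" "cell_of C \<mu>" "(2 * C + 3) * 3" by (rule two_clocks_T)
  obtain R where R: "R \<subseteq> Z" "st R c c'" using assms unfolding stp_def by (elim exE conjE)
  obtain q v q' g d where s: "c = (q, v)" "c' = (q', \<lambda>z. if z \<in> R then 0 else v z + d)"
    "(q, q', g, R) \<in> T \<mu>" "0 < d" "g (\<lambda>z. v z + d)" using R(2) unfolding st_def by (elim exE conjE)
  obtain \<gamma> l S where t: "(q, q', \<gamma>, l, S) \<in> transitions A" "g = guard x \<mu> \<gamma>" "R = {t. nm t \<in> S}"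
    using s(3) by (rule T_E)
  have "0 < d \<and> (fst c, fst c', \<gamma>, l, S) \<in> transitions A \<and> {t. nm t \<in> S} \<subseteq> Z \<and>
    guard x \<mu> \<gamma> (\<lambda>t. snd c t + d) \<and> snd c' = (\<lambda>t. if nm t \<in> S then 0 else snd c t + d)"
    unfolding s(1,2) fst_conv snd_conv
  proof (intro conjI)
    show "0 < d" by (rule s(4))
    show "(q, q', \<gamma>, l, S) \<in> transitions A" by (rule t(1))
    show "{t. nm t \<in> S} \<subseteq> Z" using R(1) unfolding t(3) .
    show "guard x \<mu> \<gamma> (\<lambda>t. v t + d)" using s(5) unfolding t(2) .
    show "(\<lambda>z. if z \<in> R then 0 else v z + d) = (\<lambda>t. if nm t \<in> S then 0 else v t + d)"
      unfolding t(3) by simp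
  qed
  then show ?thesis by (intro exI)
qed

lemma nm_eq: "z \<in> {x, y} \<Longrightarrow> nm (z = x) = z" "nm True = x" "nm False = y"
  unfolding nm_def by (cases "z = x"; simp) simp_all

lemma nonempty_imp_timed_lasso:
  assumes "nonempty_language A"
  shows "\<exists>\<mu> n k p q d X Y. n \<le> 3 * two_clocks.loop_bound (states A) (T \<mu>) ((2 * C + 3) * 3) + 2 \<and>
    timed_lasso A x y C n k p q (1::real) (max \<mu> 0) (max (- \<mu>) 0) d X Y"
proof -
  obtain I w where w: "w \<in> parametric_language A I" using assms unfolding nonempty_language_def by blast
  obtain \<pi> \<tau> where "w = (\<pi>, \<tau>)" by (rule prod.exhaust)
  then have "timed_word (alphabet A) \<pi> \<tau> \<and> (\<exists>\<rho>. parametric_run A I \<pi> \<tau> \<rho> \<and> accepting_run A \<rho>)"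
    using w unfolding parametric_language_def by simp
  then obtain \<rho> where tw: "timed_word (alphabet A) \<pi> \<tau>" and run: "parametric_run A I \<pi> \<tau> \<rho>" and ac:
      "accepting_run A \<rho>"
    by (elim exE conjE)
  define \<mu> where "\<mu> = I m"
  define q where "q i = fst (\<rho> i)" for i
  interpret two_clocks "states A" "T \<mu>" "cell_of C \<mu>" "(2 * C + 3) * 3" by (rule two_clocks_T)
  note r = run[unfolded parametric_run_def Let_def]
  have q0: "q 0 = initial A" unfolding q_def using r[THEN conjunct2, THEN conjunct1] .
  have v0: "\<forall>z\<in>clocks A. snd (\<rho> 0) z = 0" using r[THEN conjunct2, THEN conjunct2, THEN conjunct1] .
  note ex = r[THEN conjunct2, THEN conjunct2, THEN conjunct2]
  obtain \<gamma> where ex': "\<exists>S. \<forall>i>0. (fst (\<rho> (i - 1)), fst (\<rho> i), \<gamma> i, \<pi> i, S i) \<in> transitions A \<and>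
          satisfies (\<lambda>x. snd (\<rho> (i - 1)) x + (\<tau> i - \<tau> (i - 1))) I (\<gamma> i) \<and>
          (\<forall>x\<in>clocks A. snd (\<rho> i) x = (if x \<in> S i then 0 else snd (\<rho> (i - 1)) x + (\<tau> i - \<tau> (i - 1))))"
    using ex by (rule exE)
  obtain S where "\<forall>i>0. (fst (\<rho> (i - 1)), fst (\<rho> i), \<gamma> i, \<pi> i, S i) \<in> transitions A \<and>
          satisfies (\<lambda>x. snd (\<rho> (i - 1)) x + (\<tau> i - \<tau> (i - 1))) I (\<gamma> i) \<and>
          (\<forall>x\<in>clocks A. snd (\<rho> i) x = (if x \<in> S i then 0 else snd (\<rho> (i - 1)) x + (\<tau> i - \<tau> (i - 1))))"
    using ex' by (rule exE)
  note rs = this[folded q_def]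
  define D where "D i = \<tau> (Suc i) - \<tau> i" for i
  have D0: "0 \<le> D 0" and Dpos: "0 < i \<Longrightarrow> 0 < D i" for i
  proof -
    note tw' = tw[unfolded timed_word_def, THEN conjunct2]
    show "0 \<le> D 0" unfolding D_def using tw'[THEN conjunct1] tw'[THEN conjunct2, THEN conjunct1, rule_format,
        of 1] by simp
    show "0 < i \<Longrightarrow> 0 < D i" unfolding D_def using tw'[THEN conjunct2, THEN conjunct2, rule_format, of i] by
        simp
  qed
  \<comment> \<open>The valuations are recomputed from delays and resets, because those of the run
    are arbitrary outside \<open>clocks A\<close>, which may lack \<open>x\<close> or
    \<open>y\<close>.\<close>
  define V where "V = rec_nat (\<lambda>_. 0) (\<lambda>i v t. if nm t \<in> S (Suc i) then 0 else v t + D i)"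
  have V0: "V 0 = (\<lambda>_. 0)" and VS: "V (Suc i) = (\<lambda>t. if nm t \<in> S (Suc i) then 0 else V i t + D i)" for i
    unfolding V_def by simp_all
  have tr: "(q i, q (Suc i), \<gamma> (Suc i), \<pi> (Suc i), S (Suc i)) \<in> transitions A" for i
    using rs[rule_format, of "Suc i"] by simp
  have val: "snd (\<rho> i) z = V i (z = x)" if z: "z \<in> clocks A" for i z
  proof (induction i)
    case 0 then show ?case using v0 z V0 by simp
  next
    case (Suc i)
    have "snd (\<rho> (Suc i)) z = (if z \<in> S (Suc i) then 0 else snd (\<rho> i) z + D i)"
      using rs[rule_format, of "Suc i"] z unfolding D_def by simp
    moreover have "nm (z = x) = z" using nm_eq(1) xy(2) z by blast
    ultimately show ?case using Suc unfolding VS by simp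
  qed
  have gd: "guard x \<mu> (\<gamma> (Suc i)) (\<lambda>t. V i t + D i)" for i
  proof -
    note f = transition_facts[OF tr[of i]]
    have "satisfies (\<lambda>z. snd (\<rho> i) z + D i) I (\<gamma> (Suc i))"
      using rs[rule_format, of "Suc i"] unfolding D_def by simp
    moreover have "satisfies (\<lambda>z. snd (\<rho> i) z + D i) I (\<gamma> (Suc i)) \<longleftrightarrow> satisfies (\<lambda>z. V i (z = x) + D i) (\<lambda>_. I
        m) (\<gamma> (Suc i))"
      using f(8) val by (intro satisfies_param_cong[OF f(6)]) (metis subsetD)
    ultimately show ?thesis unfolding guard_def \<mu>_def by simp
  qed
  \<comment> \<open>The abstract run begins after the first transition, whose delay may be 0;
    \<open>F\<close> below puts that transition back in front.\<close>
  define c where "c i = (q (Suc i), V (Suc i))" for i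
  define R where "R i = {t. nm t \<in> S (Suc (Suc i))}" for i
  have st: "st (R i) (c i) (c (Suc i))" for i
    unfolding c_def R_def by (rule stI[OF T_I[OF tr] Dpos gd]) (simp_all add: VS)
  have acc: "\<exists>p\<ge>i. fst (c p) \<in> buechi A" for i
  proof -
    from ac[unfolded accepting_run_def] obtain b where b: "b \<in> buechi A" "\<exists>\<^sub>\<infinity>i. fst (\<rho> i) = b" by (rule bexE)
    from b(2)[unfolded INFM_nat, rule_format, of "Suc i"]
    obtain n where n: "n > Suc i" "fst (\<rho> n) = b" by (elim exE conjE)
    then obtain j where "n = Suc j" by (cases n) simp_all
    then have "i \<le> j" "fst (c j) \<in> buechi A" using n b(1) unfolding c_def q_def by simp_all
    then show ?thesis by (intro exI[of _ j] conjI)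
  qed
  \<comment> \<open>In a loop shorter than this, a clock that starts at 0 stays below 1, and below
    \<open>\<mu>\<close> if \<open>\<mu>\<close> is positive, as \<open>loop_clock\<close>
    demands.\<close>
  define \<delta> where "\<delta> = (if 0 < \<mu> then min 1 \<mu> else 1)"
  have \<delta>: "\<delta> > 0" unfolding \<delta>_def by simp
  have "lasso (max (real C) \<mu>) \<delta> (buechi A) loop_bound (c 0)" using lasso_exists[OF st acc \<delta>] .
  then obtain Z a a' p b where stem: "reaches (stp UNIV) loop_bound (c 0) a" and aa': "stp Z a a'"
    and l1: "reaches (stp Z) loop_bound a' p" and l2: "reaches (stp Z) loop_bound p b" and pB: "fst p \<in> buechi
        A"
    and ab: "fst a = fst b" and closing: "(\<forall>z. snd a z = snd b z \<or> max (real C) \<mu> < snd a z \<and> max (real C) \<mu> <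
        snd b z) \<or>
      (\<forall>z. if z \<in> Z then snd a z = 0 \<and> snd b z = 0 \<and> (\<not> z) \<notin> Z \<and> snd b (\<not> z) < snd a (\<not> z) + \<delta>
           else cell_of C \<mu> (snd a z) = cell_of C \<mu> (snd b z))" unfolding lasso_def by (elim exE conjE)
  obtain n1 where n1: "n1 \<le> loop_bound" "(stp UNIV ^^ n1) (c 0) a" using stem unfolding reaches_def by (elim
      exE conjE)
  obtain n2 where n2: "n2 \<le> loop_bound" "(stp Z ^^ n2) a' p" using l1 unfolding reaches_def by (elim exE
      conjE)
  obtain n3 where n3: "n3 \<le> loop_bound" "(stp Z ^^ n3) p b" using l2 unfolding reaches_def by (elim exE conjE)
  have "(stp Z ^^ Suc n2) a p" using aa' n2(2) by (rule relpowp_Suc_I2)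
  then obtain f2 where f2: "f2 0 = a" "f2 (Suc n2) = p" "\<forall>i<Suc n2. stp Z (f2 i) (f2 (Suc i))"
    unfolding relpowp_fun_conv by blast
  obtain f3 where f3: "f3 0 = p" "f3 n3 = b" "\<forall>i<n3. stp Z (f3 i) (f3 (Suc i))"
    using n3(2) unfolding relpowp_fun_conv by blast
  obtain f1 where f1: "f1 0 = c 0" "f1 n1 = a" "\<forall>i<n1. stp UNIV (f1 i) (f1 (Suc i))"
    using n1(2) unfolding relpowp_fun_conv by blast
  have "f2 (Suc n2) = f3 0" using f2 f3 by simp
  from joined_path[of f2 "Suc n2" f3 "stp Z" n3 "stp Z", OF this f2(3) f3(3)] obtain g where g: "\<forall>i\<le>Suc n2. g
      i = f2 i" "\<forall>i\<le>n3. g (Suc n2 + i) = f3 i"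
    "\<forall>i<Suc n2. stp Z (g i) (g (Suc i))" "\<forall>i. Suc n2 \<le> i \<and> i < Suc n2 + n3 \<longrightarrow> stp Z (g i) (g (Suc i))" by (elim
        exE conjE)
  have g': "\<forall>i<Suc n2 + n3. stp Z (g i) (g (Suc i))"
  proof (intro allI impI)
    fix i assume "i < Suc n2 + n3"
    then show "stp Z (g i) (g (Suc i))" using g(3,4) by (cases "i < Suc n2") simp_all
  qed
  have "f1 n1 = g 0" using f1 f2 g by simp
  from joined_path[of f1 n1 g "stp UNIV" "Suc n2 + n3" "stp Z", OF this f1(3) g'] obtain h where h: "\<forall>i\<le>n1. h
      i = f1 i" "\<forall>i\<le>Suc n2 + n3. h (n1 + i) = g i"
    "\<forall>i<n1. stp UNIV (h i) (h (Suc i))" "\<forall>i. n1 \<le> i \<and> i < n1 + (Suc n2 + n3) \<longrightarrow> stp Z (h i) (h (Suc i))" by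
        (elim exE conjE)
  \<comment> \<open>The initial transition, \<open>n1\<close> steps of the stem, the step from
    \<open>a\<close> to \<open>a'\<close>, and \<open>n2 + n3\<close> further steps of the loop. The
    two single steps account for the summand 2 in the bound.\<close>
  define n where "n = Suc (n1 + (Suc n2 + n3))"
  define k where "k = Suc n1"
  define p' where "p' = Suc (n1 + Suc n2)"
  have kn: "0 < k" "k < p'" "p' \<le> n" unfolding k_def p'_def n_def by simp_all
  have nb: "n \<le> 3 * loop_bound + 2" unfolding n_def using n1 n2 n3 by simp
  define F where "F i = (case i of 0 \<Rightarrow> (q 0, V 0) | Suc j \<Rightarrow> h j)" for i
  have FS: "F (Suc j) = h j" and F0: "F 0 = (q 0, V 0)" for j unfolding F_def by simp_all
  have Fk: "F k = a" unfolding k_def FS using h(2)[rule_format, of 0] g(1) f2(1) by simp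
  have Fp: "F p' = p" unfolding p'_def FS using h(2)[rule_format, of "Suc n2"] g(1) f2(2) by simp
  have Fn: "F n = b" unfolding n_def FS using h(2)[rule_format, of "Suc n2 + n3"] g(2)[rule_format, of n3]
      f3(2) by simp
  have F1: "F 1 = c 0" using FS[of 0] h(1) f1(1) by simp
  define data where "data i d \<gamma> l S \<longleftrightarrow> 0 \<le> d \<and> (0 < i \<longrightarrow> 0 < d) \<and> (fst (F i), fst (F (Suc i)), \<gamma>, l, S) \<in>
      transitions A \<and>
    (k \<le> i \<longrightarrow> {t. nm t \<in> S} \<subseteq> Z) \<and> guard x \<mu> \<gamma> (\<lambda>t. snd (F i) t + d) \<and>
    snd (F (Suc i)) = (\<lambda>t. if nm t \<in> S then 0 else snd (F i) t + d)" for i d \<gamma> l S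
  have "\<exists>d \<gamma> l S. data i d \<gamma> l S" if "i < n" for i
  proof (cases i)
    case 0
    have "data 0 (D 0) (\<gamma> (Suc 0)) (\<pi> (Suc 0)) (S (Suc 0))"
      unfolding data_def
    proof (intro conjI impI)
      have F1': "F (Suc 0) = (q (Suc 0), V (Suc 0))" using F1 unfolding c_def by simp
      show "(fst (F 0), fst (F (Suc 0)), \<gamma> (Suc 0), \<pi> (Suc 0), S (Suc 0)) \<in> transitions A"
        unfolding F0 F1' fst_conv by (rule tr)
      show "guard x \<mu> (\<gamma> (Suc 0)) (\<lambda>t. snd (F 0) t + D 0)" unfolding F0 snd_conv by (rule gd)
      show "snd (F (Suc 0)) = (\<lambda>t. if nm t \<in> S (Suc 0) then 0 else snd (F 0) t + D 0)"
        unfolding F0 F1' snd_conv by (rule VS)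
    qed (use D0 kn in simp_all)
    then show ?thesis unfolding 0 by blast
  next
    case (Suc j)
    have "stp (if n1 \<le> j then Z else UNIV) (h j) (h (Suc j))"
      using h(3,4) that unfolding Suc n_def by simp
    from stp_data[OF this] obtain d \<gamma> l S where s: "0 < d" "(fst (h j), fst (h (Suc j)), \<gamma>, l, S) \<in>
        transitions A"
      "{t. nm t \<in> S} \<subseteq> (if n1 \<le> j then Z else UNIV)"
      "guard x \<mu> \<gamma> (\<lambda>t. snd (h j) t + d)" "snd (h (Suc j)) = (\<lambda>t. if nm t \<in> S then 0 else snd (h j) t + d)"
      by (elim exE conjE)
    have "data i d \<gamma> l S" unfolding data_def Suc FS
    proof (intro conjI impI)
      assume "k \<le> Suc j"
      then show "{t. nm t \<in> S} \<subseteq> Z" using s(3) unfolding k_def by simp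
    qed (use s in simp_all)
    then show ?thesis by blast
  qed
  then have "\<forall>i. \<exists>d \<gamma> l S. i < n \<longrightarrow> data i d \<gamma> l S" by blast
  then obtain d \<gamma>' l S' where "\<forall>i. i < n \<longrightarrow> data i (d i) (\<gamma>' i) (l i) (S' i)" by metis
  then have data: "data i (d i) (\<gamma>' i) (l i) (S' i)" if "i < n" for i using that by simp
  define W where "W t i = snd (F i) t" for t i
  have WS: "W t (Suc i) = (if nm t \<in> S' i then 0 else W t i + d i)" if "i < n" for t i
    using data[OF that] unfolding data_def W_def by simp
  have d_nonneg: "0 \<le> d i" if "i < n" for i using data[OF that] unfolding data_def by simp
  have inZ: "t \<in> Z" if "k \<le> i" "i < n" "nm t \<in> S' i" for i t using data[OF that(2)] that unfolding data_def by
      auto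
  \<comment> \<open>The parameter is split into its positive and its negative part, so that both
    components are nonnegative.\<close>
  have mu: "max \<mu> 0 - max (- \<mu>) 0 = \<mu>" by simp
  have ps: "timed_step A x y 1 (max \<mu> 0) (max (- \<mu>) 0) (\<lambda>i. fst (F i)) d (W True) (W False) i" if "i < n" for
      i
    unfolding timed_step_def
  proof (rule exI[of _ "\<gamma>' i"], rule exI[of _ "l i"], rule exI[of _ "S' i"], intro conjI)
    show "(fst (F i), fst (F (Suc i)), \<gamma>' i, l i, S' i) \<in> transitions A" using data[OF that] unfolding
        data_def by simp
    have "(\<lambda>t. if t then W True i + d i else W False i + d i) = (\<lambda>t. snd (F i) t + d i)"
      unfolding W_def by (rule ext) simp
    then show "sat 1 (max \<mu> 0) (max (- \<mu>) 0) (\<lambda>z. if z = x then W True i + d i else W False i + d i) (\<gamma>' i)"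
      unfolding sat_guard mu using data[OF that] unfolding data_def by simp
    show "W True (Suc i) = (if x \<in> S' i then 0 else W True i + d i)" "W False (Suc i) = (if y \<in> S' i then 0
        else W False i + d i)"
      using WS[OF that, of True] WS[OF that, of False] by (simp_all add: nm_eq(2,3))
  qed
  have cl: "(exact_clock 1 (max \<mu> 0) (max (- \<mu>) 0) C k n (W True) \<and> exact_clock 1 (max \<mu> 0) (max (- \<mu>) 0) C k
      n (W False)) \<or>
    (loop_clock 1 (max \<mu> 0) (max (- \<mu>) 0) C k n d (W True) \<and> loop_clock 1 (max \<mu> 0) (max (- \<mu>) 0) C k n d (W
        False))"
    using closing
  proof
    assume e: "\<forall>z. snd a z = snd b z \<or> max (real C) \<mu> < snd a z \<and> max (real C) \<mu> < snd b z"
    have "above 1 (max \<mu> 0) (max (- \<mu>) 0) C v" if "max (real C) \<mu> < v" for v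
      using that mu unfolding above_def by (simp add: algebra_simps)
    then have "exact_clock 1 (max \<mu> 0) (max (- \<mu>) 0) C k n (W t)" for t
      using e[rule_format, of t] unfolding exact_clock_def W_def Fk Fn by auto
    then show ?thesis by simp
  next
    assume e: "\<forall>z. if z \<in> Z then snd a z = 0 \<and> snd b z = 0 \<and> (\<not> z) \<notin> Z \<and> snd b (\<not> z) < snd a (\<not> z) + \<delta>
           else cell_of C \<mu> (snd a z) = cell_of C \<mu> (snd b z)"
    have "loop_clock 1 (max \<mu> 0) (max (- \<mu>) 0) C k n d (W t)" for t
    proof (cases "t \<in> Z")
      case False
      have "W t (Suc i) = W t i + d i" if "k \<le> i" "i < n" for i
        using WS[OF that(2), of t] inZ[OF that, of t] False by auto
      moreover have "samecell 1 (max \<mu> 0) (max (- \<mu>) 0) C (W t k) (W t n)"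
        unfolding samecell_iff mu W_def Fk Fn using e[rule_format, of t] False by simp
      ultimately show ?thesis unfolding loop_clock_def by (intro disjI2) simp
    next
      case True
      then have t: "snd a t = 0" "snd b t = 0" "(\<not> t) \<notin> Z" "snd b (\<not> t) < snd a (\<not> t) + \<delta>"
        using e[rule_format, of t] by simp_all
      have inc: "W (\<not> t) (Suc i) = W (\<not> t) i + d i" if "k \<le> i" "i < n" for i
        using WS[OF that(2), of "\<not> t"] inZ[OF that, of "\<not> t"] t(3) by auto
      have up: "W (\<not> t) k \<le> W (\<not> t) i" if "k \<le> i" "i \<le> n" for i
        using that
      proof (induction rule: dec_induct)
        case (step i)
        then show ?case using inc[of i] d_nonneg[of i] by simp
      qed simp
      \<comment> \<open>The clock \<open>t\<close> starts at 0 and can only lose by resets, so it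
        never exceeds the time since position \<open>k\<close>, which the other clock
        measures.\<close>
      have le: "W t i \<le> W (\<not> t) i - W (\<not> t) k" if "k \<le> i" "i \<le> n" for i
        using that
      proof (induction rule: dec_induct)
        case base then show ?case using t(1) unfolding W_def Fk by simp
      next
        case (step i)
        then show ?case using up[of i] inc[of i] WS[of i t] d_nonneg[of i] by simp
      qed
      have ub: "W (\<not> t) i \<le> W (\<not> t) n" if "k \<le> i" "i \<le> n" for i
        using that(2,1)
      proof (induction rule: inc_induct)
        case (step i)
        then show ?case using inc[of i] d_nonneg[of i] by simp
      qed simp
      have "W t i + d i < \<delta>" if "k \<le> i" "i < n" for i
      proof -
        have "W t i + d i \<le> W (\<not> t) (Suc i) - W (\<not> t) k" using le[of i] inc[of i] that by simp
        also have "\<dots> \<le> W (\<not> t) n - W (\<not> t) k" using ub[of "Suc i"] that by simp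
        also have "\<dots> < \<delta>" using t(4) unfolding W_def Fk Fn by simp
        finally show ?thesis .
      qed
      then have "W t i + d i < 1 \<and> (max (- \<mu>) 0 < max \<mu> 0 \<longrightarrow> W t i + d i + max (- \<mu>) 0 < max \<mu> 0)" if "k \<le> i"
          "i < n" for i
        using that unfolding \<delta>_def by (fastforce split: if_splits)
      moreover have "W t k = 0" "W t n = 0" unfolding W_def Fk Fn using t by simp_all
      ultimately show ?thesis unfolding loop_clock_def by (intro disjI1) simp
    qed
    then show ?thesis by simp
  qed
  have "timed_lasso A x y C n k p' (\<lambda>i. fst (F i)) (1::real) (max \<mu> 0) (max (- \<mu>) 0) d (W True) (W False)"
    unfolding timed_lasso_def
  proof (intro conjI allI impI)
    show "fst (F 0) = initial A" using q0 F0 by simp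
    show "W True 0 = 0" "W False 0 = 0" unfolding W_def F0 V0 by simp_all
    show "0 \<le> d 0" using d_nonneg kn by simp
    show "0 < d i" if "0 < i \<and> i < n" for i using data[of i] that unfolding data_def by simp
    show "fst (F p') \<in> buechi A" "fst (F n) = fst (F k)" unfolding Fp Fn Fk using pB ab by simp_all
  qed (use kn ps cl in simp_all)
  then show ?thesis using nb by blast
qed

end

section \<open>Change of the time unit and passage to natural numbers\<close>

lemma sat_scale:
  assumes "0 < (u :: real)"
  shows "sat 1 (a / u) (b / u) (\<lambda>z. w z / u) \<gamma> \<longleftrightarrow> sat u a b w \<gamma>"
proof (induction \<gamma>)
  case (Atom z r \<beta>)
  have c: "w z / u < c \<longleftrightarrow> w z < c * u" "w z / u = c \<longleftrightarrow> w z = c * u" for c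
    using assms by (simp_all add: field_simps)
  have m: "w z / u + b / u < a / u \<longleftrightarrow> w z + b < a" "w z / u + b / u = a / u \<longleftrightarrow> w z + b = a"
    using assms by (simp_all add: add_divide_distrib[symmetric] divide_less_cancel)
  show ?case by (cases \<beta>; cases r) (simp_all add: c m)
qed simp_all

text \<open>All conditions are homogeneous in the unit, the parameter, the delays and the clock
  values, so the unit can be normalized.\<close>

lemma timed_lasso_scale:
  assumes "timed_lasso A x y C n k p q (u :: real) a b d X Y"
  shows "timed_lasso A x y C n k p q 1 (a / u) (b / u) (\<lambda>i. d i / u) (\<lambda>i. X i / u) (\<lambda>i. Y i / u)"
proof -
  have u: "0 < u" using assms unfolding timed_lasso_def by simp
  have c: "v / u < c \<longleftrightarrow> v < c * u" "v / u = c \<longleftrightarrow> v = c * u" "c < v / u \<longleftrightarrow> c * u < v" for c v :: real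
    using u by (simp_all add: field_simps)
  have m: "v / u + b / u < a / u \<longleftrightarrow> v + b < a" "v / u + b / u = a / u \<longleftrightarrow> v + b = a" "a / u < v / u + b / u \<longleftrightarrow> a <
      v + b" for v
    using u by (simp_all add: add_divide_distrib[symmetric] divide_less_cancel)
  have sc: "samecell 1 (a / u) (b / u) C (v / u) (w / u) \<longleftrightarrow> samecell u a b C v w" for v w
    unfolding samecell_def m by (simp add: c)
  have ab: "above 1 (a / u) (b / u) C (v / u) \<longleftrightarrow> above u a b C v" for v
    unfolding above_def m by (simp add: c)
  have e: "v / u = w / u \<longleftrightarrow> v = w" for v w using u by simp
  have ex: "exact_clock 1 (a / u) (b / u) C k n (\<lambda>i. X i / u) \<longleftrightarrow> exact_clock u a b C k n X" for X
    unfolding exact_clock_def ab e ..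
  have ad: "X i / u + d i / u = (X i + d i) / u" for X d :: "nat \<Rightarrow> real" and i by (simp add:
      add_divide_distrib)
  have ba: "b / u < a / u \<longleftrightarrow> b < a" using u by (simp add: divide_less_cancel)
  have lo: "loop_clock 1 (a / u) (b / u) C k n (\<lambda>i. d i / u) (\<lambda>i. X i / u) \<longleftrightarrow> loop_clock u a b C k n d X" for X
    unfolding loop_clock_def sc ad e ba m using u by (simp add: c)
  have ps: "timed_step A x y 1 (a / u) (b / u) q (\<lambda>i. d i / u) (\<lambda>i. X i / u) (\<lambda>i. Y i / u) i \<longleftrightarrow> timed_step A x
      y u a b q d X Y i" for i
  proof -
    have s: "sat 1 (a / u) (b / u) (\<lambda>z. if z = x then X i / u + d i / u else Y i / u + d i / u) \<gamma> \<longleftrightarrow>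
      sat u a b (\<lambda>z. if z = x then X i + d i else Y i + d i) \<gamma>" for \<gamma> :: "(nat, nat) constraint"
    proof -
      have "(\<lambda>z. if z = x then X i / u + d i / u else Y i / u + d i / u) = (\<lambda>z. (if z = x then X i + d i else
          Y i + d i) / u)"
        by (rule ext) (simp add: ad)
      then show ?thesis using sat_scale[OF u] by simp
    qed
    have r: "V' / u = (if P then 0 else v / u + w / u) \<longleftrightarrow> V' = (if P then 0 else v + w)" for V' P v w
      using u by (simp add: add_divide_distrib[symmetric])
    show ?thesis unfolding timed_step_def s r ..
  qed
  show ?thesis using assms unfolding timed_lasso_def ex lo ps by (simp add: u zero_le_divide_iff less_imp_le)
qed

lemma of_nat_cmp:
  "real v + real w + real t < real u \<longleftrightarrow> v + w + t < u" "real v + real w < real u \<longleftrightarrow> v + w < u"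
  "real u < real v + real w \<longleftrightarrow> u < v + w" "real v + real w = real u \<longleftrightarrow> v + w = u"
  "real u = real v + real w \<longleftrightarrow> u = v + w"
  by (simp_all only: of_nat_add[symmetric] of_nat_less_iff of_nat_eq_iff)

lemma sat_of_nat: "sat (real u) (real a) (real b) (\<lambda>z. real (w z)) \<gamma> \<longleftrightarrow> sat u a b w \<gamma>"
proof (induction \<gamma>)
  case (Atom z r \<beta>)
  have c: "real (w z) < real c * real u \<longleftrightarrow> w z < c * u" "real (w z) = real c * real u \<longleftrightarrow> w z = c * u" for c
    by (simp_all only: of_nat_mult[symmetric] of_nat_less_iff of_nat_eq_iff of_nat_id)
  have m: "real (w z) + real b < real a \<longleftrightarrow> w z + b < a" "real (w z) + real b = real a \<longleftrightarrow> w z + b = a"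
    by (rule of_nat_cmp)+
  show ?case by (cases \<beta>; cases r) (simp_all add: c m)
qed simp_all

lemma timed_lasso_of_nat:
  "timed_lasso A x y C n k p q (real u) (real a) (real b) (\<lambda>i. real (d i)) (\<lambda>i. real (X i)) (\<lambda>i. real (Y i)) \<longleftrightarrow>
   timed_lasso A x y C n k p q u a b d X Y"
proof -
  have c: "real v < real c * real u \<longleftrightarrow> v < of_nat c * u" "real v = real c * real u \<longleftrightarrow> v = of_nat c * u"
    "real c * real u < real v \<longleftrightarrow> of_nat c * u < v" for c v
    by (simp_all only: of_nat_mult[symmetric] of_nat_less_iff of_nat_eq_iff of_nat_id)
  have sc: "samecell (real u) (real a) (real b) C (real v) (real w) \<longleftrightarrow> samecell u a b C v w" for v w
    unfolding samecell_def c of_nat_cmp ..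
  have ab: "above (real u) (real a) (real b) C (real v) \<longleftrightarrow> above u a b C v" for v
    unfolding above_def c of_nat_cmp ..
  have ex: "exact_clock (real u) (real a) (real b) C k n (\<lambda>i. real (X i)) \<longleftrightarrow> exact_clock u a b C k n X" for X
    unfolding exact_clock_def ab by simp
  have lo: "loop_clock (real u) (real a) (real b) C k n (\<lambda>i. real (d i)) (\<lambda>i. real (X i)) \<longleftrightarrow> loop_clock u a b C
      k n d X" for X
    unfolding loop_clock_def sc of_nat_cmp by simp
  have ps: "timed_step A x y (real u) (real a) (real b) q (\<lambda>i. real (d i)) (\<lambda>i. real (X i)) (\<lambda>i. real (Y i)) i
      \<longleftrightarrow> timed_step A x y u a b q d X Y i" for i
  proof -
    have s: "sat (real u) (real a) (real b) (\<lambda>z. if z = x then real (X i) + real (d i) else real (Y i) + real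
        (d i)) \<gamma> \<longleftrightarrow>
      sat u a b (\<lambda>z. if z = x then X i + d i else Y i + d i) \<gamma>" for \<gamma> :: "(nat, nat) constraint"
    proof -
      have "(\<lambda>z. if z = x then real (X i) + real (d i) else real (Y i) + real (d i)) = (\<lambda>z. real (if z = x
          then X i + d i else Y i + d i))"
        by (rule ext) simp
      then show ?thesis using sat_of_nat by simp
    qed
    have r: "real V' = (if P then 0 else real v + real w) \<longleftrightarrow> V' = (if P then 0 else v + w)" for V' P v w
      by (cases P) (simp_all only: of_nat_cmp if_True if_False of_nat_eq_0_iff)
    show ?thesis unfolding timed_step_def s r ..
  qed
  show ?thesis unfolding timed_lasso_def ex lo ps by simp
qed

context nrt_automaton begin

lemma run_imp_nonempty:
  assumes F0: "F 0 = (initial A, \<lambda>_. 0)"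
    and e: "\<And>i. 0 \<le> e i" "\<And>i. 0 < i \<Longrightarrow> 0 < e i"
    and tr: "\<And>i. (fst (F i), fst (F (Suc i)), \<gamma> i, l i, S i) \<in> transitions A"
    and gd: "\<And>i. guard x \<mu> (\<gamma> i) (\<lambda>t. snd (F i) t + e i)"
    and upd: "\<And>i. snd (F (Suc i)) = (\<lambda>t. if nm t \<in> S i then 0 else snd (F i) t + e i)"
    and acc: "\<And>i. \<exists>j\<ge>i. fst (F j) \<in> buechi A"
  shows "nonempty_language A"
proof -
  define \<tau> where "\<tau> i = (\<Sum>j<i. e j)" for i
  define \<pi> where "\<pi> i = l (i - 1)" for i
  define \<rho> where "\<rho> i = (fst (F i), \<lambda>z. snd (F i) (z = x))" for i
  have ta: "parametric_TA A" using nrt unfolding parametric_nrtTA_def by simp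
  have nonneg: "0 \<le> snd (F i) t" for i t
  proof (induction i)
    case 0 then show ?case unfolding F0 by simp
  next
    case (Suc i) then show ?case unfolding upd using e(1)[of i] by simp
  qed
  have "timed_word (alphabet A) \<pi> \<tau>"
    unfolding timed_word_def
  proof (intro conjI allI impI)
    show "\<pi> i \<in> alphabet A" for i unfolding \<pi>_def using transition_facts(3)[OF tr] by simp
    show "\<tau> 0 = 0" unfolding \<tau>_def by simp
    show "0 \<le> \<tau> i" for i unfolding \<tau>_def using e(1) by (simp add: sum_nonneg)
    show "\<tau> i < \<tau> (i + 1)" if "0 < i" for i unfolding \<tau>_def using e(2)[OF that] by simp
  qed
  moreover have "parametric_run A (\<lambda>_. \<mu>) \<pi> \<tau> \<rho>"
    unfolding parametric_run_def Let_def
  proof (intro conjI allI ballI)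
    show "fst (\<rho> i) \<in> states A" for i unfolding \<rho>_def using transition_facts(1)[OF tr] by simp
    show "0 \<le> snd (\<rho> i) z" for i z unfolding \<rho>_def using nonneg by simp
    show "fst (\<rho> 0) = initial A" unfolding \<rho>_def F0 by simp
    show "snd (\<rho> 0) z = 0" for z unfolding \<rho>_def F0 by simp
    show "\<exists>\<gamma> S. \<forall>i>0. (fst (\<rho> (i - 1)), fst (\<rho> i), \<gamma> i, \<pi> i, S i) \<in> transitions A \<and>
          satisfies (\<lambda>x. snd (\<rho> (i - 1)) x + (\<tau> i - \<tau> (i - 1))) (\<lambda>_. \<mu>) (\<gamma> i) \<and>
          (\<forall>x\<in>clocks A. snd (\<rho> i) x = (if x \<in> S i then 0 else snd (\<rho> (i - 1)) x + (\<tau> i - \<tau> (i - 1))))"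
    proof (rule exI[of _ "\<lambda>i. \<gamma> (i - 1)"], rule exI[of _ "\<lambda>i. S (i - 1)"], intro allI impI)
      fix i :: nat assume "0 < i"
      then obtain j where j: "i = Suc j" by (cases i) simp_all
      have td: "\<tau> (Suc j) - \<tau> j = e j" unfolding \<tau>_def by simp
      have "satisfies (\<lambda>z. snd (F j) (z = x) + e j) (\<lambda>_. \<mu>) (\<gamma> j)" using gd[of j] unfolding guard_def .
      moreover have "snd (F (Suc j)) (z = x) = (if z \<in> S j then 0 else snd (F j) (z = x) + e j)" if "z \<in>
          clocks A" for z
      proof -
        have "nm (z = x) = z" using nm_eq(1) xy(2) that by blast
        then show ?thesis unfolding upd by simp
      qed
      ultimately show "(fst (\<rho> (i - 1)), fst (\<rho> i), \<gamma> (i - 1), \<pi> i, S (i - 1)) \<in> transitions A \<and>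
          satisfies (\<lambda>x. snd (\<rho> (i - 1)) x + (\<tau> i - \<tau> (i - 1))) (\<lambda>_. \<mu>) (\<gamma> (i - 1)) \<and>
          (\<forall>x\<in>clocks A. snd (\<rho> i) x = (if x \<in> S (i - 1) then 0 else snd (\<rho> (i - 1)) x + (\<tau> i - \<tau> (i - 1))))"
        unfolding j \<rho>_def \<pi>_def using tr[of j] td by simp
    qed
  qed
  moreover have "accepting_run A \<rho>"
  proof -
    let ?J = "{i. fst (F i) \<in> buechi A}"
    have "infinite ?J" unfolding infinite_nat_iff_unbounded_le using acc by simp
    moreover have "finite (states A)" using ta unfolding parametric_TA_def by simp
    moreover have "fst (F i) \<in> states A" for i using transition_facts(1)[OF tr] .
    \<comment> \<open>Acceptance requires one particular state to recur, so the infinitely many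
      accepting visits are sorted by their state.\<close>
    ultimately obtain q where q: "infinite {i \<in> ?J. fst (F i) = q}" using infinite_same[of ?J "states A" "\<lambda>i.
        fst (F i)"] by blast
    then have "{i \<in> ?J. fst (F i) = q} \<noteq> {}" by (metis finite.emptyI)
    then have "q \<in> buechi A" by blast
    moreover have "infinite {i. fst (\<rho> i) = q}" using q by (rule infinite_super[rotated]) (auto simp: \<rho>_def)
    ultimately show ?thesis unfolding accepting_run_def INFM_iff_infinite by (rule bexI[rotated])
  qed
  ultimately have "(\<pi>, \<tau>) \<in> parametric_language A (\<lambda>_. \<mu>)" unfolding parametric_language_def by blast
  then show ?thesis unfolding nonempty_language_def by blast
qed

lemma timed_lasso_imp_nonempty:
  assumes "timed_lasso A x y C n k p q (1 :: real) a b d X Y"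
  shows "nonempty_language A"
proof -
  define \<mu> where "\<mu> = a - b"
  interpret two_clocks "states A" "T \<mu>" "cell_of C \<mu>" "(2 * C + 3) * 3" by (rule two_clocks_T)
  note pl = assms[unfolded timed_lasso_def]
  have init: "q 0 = initial A" "X 0 = 0" "Y 0 = 0" "0 \<le> d 0" and dpos: "\<forall>i. 0 < i \<and> i < n \<longrightarrow> 0 < d i"
    and kn: "0 < k" "k < p" "p \<le> n" and qB: "q p \<in> buechi A" "q n = q k"
    and ps: "\<forall>i<n. timed_step A x y 1 a b q d X Y i"
    and cl: "exact_clock 1 a b C k n X \<and> exact_clock 1 a b C k n Y \<or> loop_clock 1 a b C k n d X \<and> loop_clock 1
        a b C k n d Y"
    using pl by simp_all
  define V where "V i t = (if t then X i else Y i)" for i t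
  define data where "data i \<gamma> l S \<longleftrightarrow> (q i, q (Suc i), \<gamma>, l, S) \<in> transitions A \<and> guard x \<mu> \<gamma> (\<lambda>t. V i t + d i)
      \<and>
    V (Suc i) = (\<lambda>t. if nm t \<in> S then 0 else V i t + d i)" for i \<gamma> l S
  have "\<exists>\<gamma> l S. data i \<gamma> l S" if i: "i < n" for i
  proof -
    obtain \<gamma> l S where s: "(q i, q (Suc i), \<gamma>, l, S) \<in> transitions A"
      "sat 1 a b (\<lambda>z. if z = x then X i + d i else Y i + d i) \<gamma>"
      "X (Suc i) = (if x \<in> S then 0 else X i + d i)" "Y (Suc i) = (if y \<in> S then 0 else Y i + d i)"
      using ps[rule_format, OF i, unfolded timed_step_def] by (elim exE conjE)
    have "(\<lambda>t. if t then X i + d i else Y i + d i) = (\<lambda>t. V i t + d i)" unfolding V_def by (rule ext) simp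
    then have "guard x \<mu> \<gamma> (\<lambda>t. V i t + d i)" using s(2) unfolding sat_guard \<mu>_def by simp
    moreover have "V (Suc i) = (\<lambda>t. if nm t \<in> S then 0 else V i t + d i)"
    proof
      fix t show "V (Suc i) t = (if nm t \<in> S then 0 else V i t + d i)"
        unfolding V_def using s(3,4) by (cases t) (simp_all add: nm_eq(2,3))
    qed
    ultimately have "data i \<gamma> l S" unfolding data_def using s(1) by simp
    then show ?thesis by blast
  qed
  then have "\<forall>i. \<exists>\<gamma> l S. i < n \<longrightarrow> data i \<gamma> l S" by blast
  then obtain \<gamma> l S where "\<forall>i. i < n \<longrightarrow> data i (\<gamma> i) (l i) (S i)" by metis
  then have data: "data i (\<gamma> i) (l i) (S i)" if "i < n" for i using that by simp
  have V0: "V 0 = (\<lambda>_. 0)" unfolding V_def init by simp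
  have d0: "0 \<le> d i" if "i < n" for i using dpos init(4) that by (cases i) (simp_all add: less_imp_le)
  have nonneg: "0 \<le> V i t" if "i \<le> n" for i t
    using that
  proof (induction i)
    case 0 then show ?case using V0 by simp
  next
    case (Suc i)
    then have "V (Suc i) t = (if nm t \<in> S i then 0 else V i t + d i)" using data[of i] unfolding data_def by
        simp
    then show ?case using Suc d0[of i] by simp
  qed
  have steps: "(q i, q (Suc i), guard x \<mu> (\<gamma> i), {t. nm t \<in> S i}) \<in> T \<mu> \<and> d i > 0 \<and> guard x \<mu> (\<gamma> i) (\<lambda>z. V i z
      + d i) \<and>
      V (Suc i) = (\<lambda>z. if z \<in> {t. nm t \<in> S i} then 0 else V i z + d i)" if "0 < i" "i < n" for i
  proof -
    note d = data[OF that(2), unfolded data_def]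
    from T_I[OF d[THEN conjunct1], of \<mu>] d dpos that show ?thesis by simp
  qed
  have st: "stp UNIV (q i, V i) (q (Suc i), V (Suc i))" if "0 < i" "i < n" for i
  proof -
    note s = steps[OF that]
    have "st {t. nm t \<in> S i} (q i, V i) (q (Suc i), V (Suc i))" using s by (intro stI[of _ _ "guard x \<mu> (\<gamma> i)"
        _ "d i"]) simp_all
    then show ?thesis unfolding stp_def by blast
  qed
  \<comment> \<open>The abstract path begins at position 1, where delays have become
    positive.\<close>
  have stem: "(stp UNIV)\<^sup>*\<^sup>* (q 1, V 1) (q k, V k)"
    by (rule rtranclp_of_steps[of 1 k "stp UNIV" "\<lambda>i. (q i, V i)"]) (use kn st in simp_all)
  have "\<exists>c. c 0 = (q 1, V 1) \<and> (\<forall>i. stp UNIV (c i) (c (Suc i))) \<and> (\<forall>i. \<exists>j\<ge>i. fst (c j) \<in> buechi A)"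
    using cl
  proof
    assume ex: "exact_clock 1 a b C k n X \<and> exact_clock 1 a b C k n Y"
    have top: "max (real C) \<mu> < v" if "above 1 a b C v" for v using that unfolding above_def \<mu>_def by (simp
        add: algebra_simps)
    show ?thesis
    proof (rule run_of_exact_lasso[OF _ stem])
      show "\<forall>v w. max (real C) \<mu> < v \<longrightarrow> max (real C) \<mu> < w \<longrightarrow> cell_of C \<mu> v = cell_of C \<mu> w" using cell_of_top
          by blast
      show "(stp UNIV)\<^sup>+\<^sup>+ (q k, V k) (q p, V p)"
        by (rule tranclp_of_steps[of k p "stp UNIV" "\<lambda>i. (q i, V i)"]) (use kn st in simp_all)
      show "(stp UNIV)\<^sup>*\<^sup>* (q p, V p) (q n, V n)"
        by (rule rtranclp_of_steps[of p n "stp UNIV" "\<lambda>i. (q i, V i)"]) (use kn st in simp_all)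
      show "fst (q p, V p) \<in> buechi A" using qB by simp
      show "sim (max (real C) \<mu>) (q k, V k) (q n, V n)" unfolding sim_def fst_conv snd_conv
      proof (intro conjI allI)
        fix t show "V k t = V n t \<or> max (real C) \<mu> < V k t \<and> max (real C) \<mu> < V n t"
          using ex top unfolding exact_clock_def V_def by (cases t) auto
      qed (use qB in simp)
    qed
  next
    assume lo: "loop_clock 1 a b C k n d X \<and> loop_clock 1 a b C k n d Y"
    show ?thesis
    proof (rule run_of_shrinking_lasso[where q = q and X = V and d = d and
          g = "\<lambda>i. guard x \<mu> (\<gamma> i)" and R = "\<lambda>i. {t. nm t \<in> S i}", OF kn(2,3) stem qB(1,2)])
      show "(q i, q (Suc i), guard x \<mu> (\<gamma> i), {t. nm t \<in> S i}) \<in> T \<mu> \<and> 0 < d i \<and> guard x \<mu> (\<gamma> i) (\<lambda>z. V i z +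
          d i) \<and>
        V (Suc i) = (\<lambda>z. if z \<in> {t. nm t \<in> S i} then 0 else V i z + d i)" if "k \<le> i" "i < n" for i
        using steps[of i] that kn by simp
      fix t
      have "loop_clock 1 a b C k n d (\<lambda>i. V i t)" using lo unfolding V_def by (cases t) simp_all
      then show "V k t = 0 \<and> V n t = 0 \<and> (\<forall>i. k \<le> i \<and> i < n \<longrightarrow> (\<forall>v w. 0 < v \<and> v \<le> w \<and> w \<le> V i t + d i \<longrightarrow> cell_of
          C \<mu> v = cell_of C \<mu> w)) \<or>
        (\<forall>i. k \<le> i \<and> i < n \<longrightarrow> t \<notin> {t. nm t \<in> S i}) \<and> cell_of C \<mu> (V k t) = cell_of C \<mu> (V n t)"
        unfolding loop_clock_def samecell_iff \<mu>_def[symmetric]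
      proof
        assume s: "V k t = 0 \<and> V n t = 0 \<and> (\<forall>i. k \<le> i \<and> i < n \<longrightarrow> V i t + d i < 1 \<and> (b < a \<longrightarrow> V i t + d i + b <
            a))"
        have "cell_of C \<mu> v = cell_of C \<mu> w" if "k \<le> i" "i < n" "0 < v" "v \<le> w" "w \<le> V i t + d i" for i v w
        proof (rule cell_of_small[OF that(3,4)])
          have i: "V i t + d i < 1 \<and> (b < a \<longrightarrow> V i t + d i + b < a)" using s that(1,2) by simp
          then show "w < 1" using that(5) by simp
          show "w < \<mu>" if "0 < \<mu>" using i that \<open>w \<le> V i t + d i\<close> unfolding \<mu>_def by simp
        qed
        then show ?thesis using s by (intro disjI1 conjI) auto
      next
        assume s: "(\<forall>i. k \<le> i \<and> i < n \<longrightarrow> V (Suc i) t = V i t + d i) \<and> cell_of C \<mu> (V k t) = cell_of C \<mu> (V n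
            t)"
        \<comment> \<open>The increment equation expresses absence of a reset: after a reset the
          value would be 0, but a nonnegative value plus a positive delay is not.\<close>
        have "t \<notin> {t. nm t \<in> S i}" if "k \<le> i" "i < n" for i
        proof
          assume "t \<in> {t. nm t \<in> S i}"
          then have "V (Suc i) t = 0" using steps[of i] that kn by simp
          moreover have "V (Suc i) t = V i t + d i" using s that by simp
          moreover have "0 \<le> V i t" "0 < d i" using nonneg[of i] steps[of i] that kn by simp_all
          ultimately show False by simp
        qed
        then show ?thesis using s by (intro disjI2 conjI) auto
      qed
    qed
  qed
  then obtain c where c: "c 0 = (q 1, V 1)" "\<forall>i. stp UNIV (c i) (c (Suc i))" "\<forall>i. \<exists>j\<ge>i. fst (c j) \<in> buechi A"
    by (elim exE conjE)
  define F where "F i = (case i of 0 \<Rightarrow> (q 0, V 0) | Suc j \<Rightarrow> c j)" for i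
  have FS: "F (Suc j) = c j" and F0: "F 0 = (q 0, V 0)" for j unfolding F_def by simp_all
  define D where "D i e \<gamma> l S \<longleftrightarrow> 0 \<le> e \<and> (0 < i \<longrightarrow> 0 < e) \<and> (fst (F i), fst (F (Suc i)), \<gamma>, l, S) \<in> transitions
      A \<and>
    guard x \<mu> \<gamma> (\<lambda>t. snd (F i) t + e) \<and> snd (F (Suc i)) = (\<lambda>t. if nm t \<in> S then 0 else snd (F i) t + e)" for i
        e \<gamma> l S
  have "\<exists>e \<gamma> l S. D i e \<gamma> l S" for i
  proof (cases i)
    case 0
    have n: "0 < n" using kn by simp
    have "D 0 (d 0) (\<gamma> 0) (l 0) (S 0)"
      using data[OF n] init(4) unfolding D_def data_def FS F0 c(1) fst_conv snd_conv by simp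
    then show ?thesis unfolding 0 by blast
  next
    case (Suc j)
    from stp_data[OF c(2)[rule_format, of j]] obtain e \<gamma> l S where s: "0 < e" "(fst (c j), fst (c (Suc j)), \<gamma>,
        l, S) \<in> transitions A"
      "guard x \<mu> \<gamma> (\<lambda>t. snd (c j) t + e)" "snd (c (Suc j)) = (\<lambda>t. if nm t \<in> S then 0 else snd (c j) t + e)"
      by (elim exE conjE)
    have "D i e \<gamma> l S" unfolding D_def Suc FS using s(2,3,4) less_imp_le[OF s(1)] s(1) by (intro conjI impI)
    then show ?thesis by blast
  qed
  then have "\<forall>i. \<exists>e \<gamma> l S. D i e \<gamma> l S" by blast
  then obtain e \<gamma>' l' S' where "\<forall>i. D i (e i) (\<gamma>' i) (l' i) (S' i)" by metis
  note D = this[rule_format, unfolded D_def]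
  show ?thesis
  proof (rule run_imp_nonempty[of F e \<gamma>' l' S' \<mu>])
    show "F 0 = (initial A, \<lambda>_. 0)" unfolding F0 V0 init ..
    show "\<exists>j\<ge>i. fst (F j) \<in> buechi A" for i
    proof -
      obtain j where j: "j \<ge> i" "fst (c j) \<in> buechi A" using c(3)[rule_format, of i] by (elim exE conjE)
      have "i \<le> Suc j" "fst (F (Suc j)) \<in> buechi A" unfolding FS using j by simp_all
      then show ?thesis by (intro exI[of _ "Suc j"] conjI)
    qed
  qed (use D in blast)+
qed

end

section \<open>Lassos with integer delays\<close>

lemma timed_lasso_cong:
  assumes pl: "timed_lasso A x y C n k p q u a b d X Y"
    and e: "\<And>i. i \<le> n \<Longrightarrow> q' i = q i" "\<And>i. i < n \<Longrightarrow> d' i = d i" "\<And>i. i \<le> n \<Longrightarrow> X' i = X i" "\<And>i. i \<le> n \<Longrightarrow> Y' i = Y i"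
  shows "timed_lasso A x y C n k p q' u a b d' X' Y'"
proof -
  have kn: "0 < k" "k < p" "p \<le> n" using pl unfolding timed_lasso_def by simp_all
  have s: "timed_step A x y u a b q' d' X' Y' i \<longleftrightarrow> timed_step A x y u a b q d X Y i" if "i < n" for i
  proof -
    have "q' i = q i" "q' (Suc i) = q (Suc i)" "d' i = d i" "X' i = X i" "X' (Suc i) = X (Suc i)" "Y' i = Y i"
        "Y' (Suc i) = Y (Suc i)"
      using e that by simp_all
    then show ?thesis unfolding timed_step_def by (simp only:)
  qed
  have l: "loop_clock u a b C k n d' W' \<longleftrightarrow> loop_clock u a b C k n d W" if W: "\<And>i. i \<le> n \<Longrightarrow> W' i = W i" for W W'
  proof -
    have i: "W' i = W i" "W' (Suc i) = W (Suc i)" "d' i = d i" if "k \<le> i \<and> i < n" for i using W e(2) that by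
        simp_all
    have kn': "W' k = W k" "W' n = W n" using W kn by simp_all
    show ?thesis unfolding loop_clock_def kn'
      by (intro arg_cong2[where f = "(\<or>)"] conj_cong all_cong1 imp_cong refl) (simp_all add: i)
  qed
  have x: "exact_clock u a b C k n W' \<longleftrightarrow> exact_clock u a b C k n W" if "\<And>i. i \<le> n \<Longrightarrow> W' i = W i" for W W'
    unfolding exact_clock_def using that kn by simp
  have lx: "loop_clock u a b C k n d' X' \<longleftrightarrow> loop_clock u a b C k n d X" "loop_clock u a b C k n d' Y' \<longleftrightarrow>
      loop_clock u a b C k n d Y"
    "exact_clock u a b C k n X' \<longleftrightarrow> exact_clock u a b C k n X" "exact_clock u a b C k n Y' \<longleftrightarrow> exact_clock u a b C
        k n Y"
    using e(3,4) by (intro l x; simp)+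
  show ?thesis using pl kn e unfolding timed_lasso_def lx by (simp add: s)
qed

context nrt_automaton begin

text \<open>Clock values as linear forms: variable 0 is the unit, variable 1 the parameter and
  variable \<open>i + 2\<close> the delay of step \<open>i\<close>. A clock is the sum of the delays
  since its last reset, the resetting steps being marked by \<open>r\<close>, so all coefficients
  are 0 or 1.\<close>

definition clock_coeff :: "(nat \<Rightarrow> bool) \<Rightarrow> nat \<Rightarrow> nat \<Rightarrow> int" where
  "clock_coeff r = rec_nat (\<lambda>_. 0) (\<lambda>i f. if r i then (\<lambda>_. 0) else (\<lambda>j. f j + (if j = i + 2 then 1 else 0)))"

lemma clock_coeff_0: "clock_coeff r 0 = (\<lambda>_. 0)"
  and clock_coeff_Suc: "clock_coeff r (Suc i) = (if r i then (\<lambda>_. 0) else (\<lambda>j. clock_coeff r i j + (if j = i +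
      2 then 1 else 0)))"
  unfolding clock_coeff_def by simp_all

lemma clock_coeff_bounds: "0 \<le> clock_coeff r i j \<and> clock_coeff r i j \<le> 1 \<and> (i + 2 \<le> j \<longrightarrow> clock_coeff r i j =
    0)"
  by (induction i) (auto simp: clock_coeff_0 clock_coeff_Suc)

lemma clock_coeff_step_bounds: "0 \<le> clock_coeff r i j + (if j = i + 2 then 1 else 0)" "clock_coeff r i j + (if
    j = i + 2 then 1 else 0) \<le> 1"
  using clock_coeff_bounds[of r i j] by auto

lemma lin_zero: "lin n (\<lambda>_. 0) v = 0"
  unfolding lin_def by simp

lemma lin_unit: "j < n \<Longrightarrow> lin n (\<lambda>i. c * (if i = j then 1 else 0)) v = of_int c * v j"
proof -
  assume j: "j < n"
  have "lin n (\<lambda>i. c * (if i = j then 1 else 0)) v = (\<Sum>i<n. if i = j then of_int c * v i else 0)"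
    unfolding lin_def by (intro sum.cong) auto
  then show ?thesis using j by simp
qed

lemma lin_add_unit: "j < n \<Longrightarrow> lin n (\<lambda>i. k i + (if i = j then 1 else 0)) v = lin n k v + v j"
proof -
  assume j: "j < n"
  have "lin n (\<lambda>i. k i + (if i = j then 1 else 0)) v = (\<Sum>i<n. of_int (k i) * v i + (if i = j then v i else
      0))"
    unfolding lin_def by (intro sum.cong) (auto simp: algebra_simps)
  then show ?thesis using j unfolding lin_def by (simp add: sum.distrib)
qed

lemma lin_clock_coeff_Suc: "i < n \<Longrightarrow> lin (n + 2) (clock_coeff r (Suc i)) v = (if r i then 0 else lin (n + 2)
    (clock_coeff r i) v + v (i + 2))"
  unfolding clock_coeff_Suc using lin_add_unit[of "i + 2" "n + 2" "clock_coeff r i" v] by (simp add: lin_zero)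

text \<open>The analogue of \<open>samecell\<close> across two timings, each with its own unit and
  parameter.\<close>

definition xcell :: "real \<Rightarrow> real \<Rightarrow> real \<Rightarrow> real \<Rightarrow> real \<Rightarrow> real \<Rightarrow> real \<Rightarrow> real \<Rightarrow> bool" where
  "xcell u a b v u' a' b' v' \<longleftrightarrow> (\<forall>c\<le>C. (v < real c * u \<longleftrightarrow> v' < real c * u') \<and> (v = real c * u \<longleftrightarrow> v' = real c *
      u')) \<and>
     (v + b < a \<longleftrightarrow> v' + b' < a') \<and> (v + b = a \<longleftrightarrow> v' + b' = a')"

lemma xcell_sat:
  assumes "constraint_consts \<gamma> \<subseteq> {..C}" "\<And>z. xcell u a b (w z) u' a' b' (w' z)"
  shows "sat u a b w \<gamma> \<longleftrightarrow> sat u' a' b' w' \<gamma>"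
  using assms(1)
proof (induction \<gamma>)
  case (Atom z r \<beta>)
  show ?case using Atom assms(2)[of z] unfolding xcell_def by (cases \<beta>; cases r) simp_all
qed simp_all

text \<open>A lasso depends only on the cells of the clocks before and after each delay, on which
  delays are positive, and on whether the values at the two ends of the loop agree.
  \<open>1 \<le> C\<close> lets cells see the comparison with the unit, and the cell of 0 tells
  whether the parameter is positive.\<close>

lemma timed_lasso_transfer:
  assumes pl: "timed_lasso A x y C n k p q u a b d X Y"
    and C: "1 \<le> C" and u': "0 < u'" and d': "0 \<le> d' 0" "\<And>i. i < n \<Longrightarrow> 0 < d i \<longleftrightarrow> 0 < d' i"
    and x0: "X' 0 = 0" "Y' 0 = 0" and xc0: "xcell u a b 0 u' a' b' 0"
    and xc: "\<And>i. i < n \<Longrightarrow> xcell u a b (X i + d i) u' a' b' (X' i + d' i)" "\<And>i. i < n \<Longrightarrow> xcell u a b (Y i + d i)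
        u' a' b' (Y' i + d' i)"
      "\<And>i. i \<le> n \<Longrightarrow> xcell u a b (X i) u' a' b' (X' i)" "\<And>i. i \<le> n \<Longrightarrow> xcell u a b (Y i) u' a' b' (Y' i)"
    and eq: "X k = X n \<longleftrightarrow> X' k = X' n" "Y k = Y n \<longleftrightarrow> Y' k = Y' n"
    and trans: "\<And>i. i < n \<Longrightarrow> (q i, q (Suc i), \<gamma> i, l i, S i) \<in> transitions A \<and>
        sat u a b (\<lambda>z. if z = x then X i + d i else Y i + d i) (\<gamma> i) \<and>
        X (Suc i) = (if x \<in> S i then 0 else X i + d i) \<and> Y (Suc i) = (if y \<in> S i then 0 else Y i + d i)"
    and upd: "\<And>i. i < n \<Longrightarrow> X' (Suc i) = (if x \<in> S i then 0 else X' i + d' i)" "\<And>i. i < n \<Longrightarrow> Y' (Suc i) = (if y \<in>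
        S i then 0 else Y' i + d' i)"
  shows "timed_lasso A x y C n k p q u' a' b' d' X' (Y' :: nat \<Rightarrow> real)"
proof -
  note pl = pl[unfolded timed_lasso_def]
  have kn: "0 < k" "k < p" "p \<le> n" using pl by simp_all
  have zero: "v = 0 \<longleftrightarrow> v' = 0" if "xcell u a b v u' a' b' v'" for v v'
    using that[unfolded xcell_def, THEN conjunct1, rule_format, of 0] by simp
  have one: "v < u \<longleftrightarrow> v' < u'" if "xcell u a b v u' a' b' v'" for v v'
    using that[unfolded xcell_def, THEN conjunct1, rule_format, of 1] C by simp
  have par: "(v + b < a \<longleftrightarrow> v' + b' < a') \<and> (v + b = a \<longleftrightarrow> v' + b' = a')" if "xcell u a b v u' a' b' v'" for v v'
    using that[unfolded xcell_def, THEN conjunct2] .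
  have ba: "b < a \<longleftrightarrow> b' < a'" using par[OF xc0] by simp
  have ab: "above u a b C v \<longleftrightarrow> above u' a' b' C v'" if "xcell u a b v u' a' b' v'" for v v'
  proof -
    have "(v < real C * u \<longleftrightarrow> v' < real C * u') \<and> (v = real C * u \<longleftrightarrow> v' = real C * u')"
      using that[unfolded xcell_def, THEN conjunct1, rule_format, of C] by simp
    then show ?thesis unfolding above_def using par[OF that] by linarith
  qed
  have sc: "samecell u a b C v w \<longleftrightarrow> samecell u' a' b' C v' w'" if "xcell u a b v u' a' b' v'" "xcell u a b w u'
      a' b' w'" for v w v' w'
    unfolding samecell_def using that[unfolded xcell_def] by (intro conj_cong all_cong1 imp_cong) simp_all
  have ps: "timed_step A x y u' a' b' q d' X' Y' i" if "i < n" for i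
    unfolding timed_step_def
  proof (rule exI[of _ "\<gamma> i"], rule exI[of _ "l i"], rule exI[of _ "S i"], intro conjI)
    note t = trans[OF that]
    show "(q i, q (Suc i), \<gamma> i, l i, S i) \<in> transitions A" using t by simp
    have "sat u a b (\<lambda>z. if z = x then X i + d i else Y i + d i) (\<gamma> i) \<longleftrightarrow> sat u' a' b' (\<lambda>z. if z = x then X' i
        + d' i else Y' i + d' i) (\<gamma> i)"
      using xc(1,2)[OF that] by (intro xcell_sat const_le[OF t[THEN conjunct1]]) simp
    then show "sat u' a' b' (\<lambda>z. if z = x then X' i + d' i else Y' i + d' i) (\<gamma> i)" using t by simp
  qed (rule upd[OF that])+
  have lo: "loop_clock u' a' b' C k n d' W'"
    if l: "loop_clock u a b C k n d W" and x1: "\<And>i. i < n \<Longrightarrow> xcell u a b (W i + d i) u' a' b' (W' i + d' i)"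
      and x2: "\<And>i. i \<le> n \<Longrightarrow> xcell u a b (W i) u' a' b' (W' i)"
      and up: "\<And>i. i < n \<Longrightarrow> W (Suc i) = (if P i then 0 else W i + d i) \<and> W' (Suc i) = (if P i then 0 else W' i
          + d' i)" for W W' P
    using l unfolding loop_clock_def
  proof
    assume s: "W k = 0 \<and> W n = 0 \<and> (\<forall>i. k \<le> i \<and> i < n \<longrightarrow> W i + d i < u \<and> (b < a \<longrightarrow> W i + d i + b < a))"
    have "W' k = 0" "W' n = 0" using s zero[OF x2[of k]] zero[OF x2[of n]] kn by simp_all
    moreover have "W' i + d' i < u' \<and> (b' < a' \<longrightarrow> W' i + d' i + b' < a')" if "k \<le> i" "i < n" for i
    proof -
      have "W i + d i < u \<and> (b < a \<longrightarrow> W i + d i + b < a)" using s that by blast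
      then show ?thesis using one[OF x1[OF that(2)]] par[OF x1[OF that(2)]] ba by blast
    qed
    ultimately show "W' k = 0 \<and> W' n = 0 \<and> (\<forall>i. k \<le> i \<and> i < n \<longrightarrow> W' i + d' i < u' \<and> (b' < a' \<longrightarrow> W' i + d' i + b'
        < a')) \<or>
      (\<forall>i. k \<le> i \<and> i < n \<longrightarrow> W' (Suc i) = W' i + d' i) \<and> samecell u' a' b' C (W' k) (W' n)" by (intro disjI1)
          simp
  next
    assume s: "(\<forall>i. k \<le> i \<and> i < n \<longrightarrow> W (Suc i) = W i + d i) \<and> samecell u a b C (W k) (W n)"
    have "W' (Suc i) = W' i + d' i" if "k \<le> i" "i < n" for i
    proof (cases "P i")
      case True
      \<comment> \<open>A reset that is consistent with the increment equation means that the value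
        was 0, which cells recognize.\<close>
      then have "W i + d i = 0" using s that up[OF that(2)] by simp
      then show ?thesis using zero[OF x1[OF that(2)]] up[OF that(2)] True by simp
    next
      case False then show ?thesis using up[OF that(2)] by simp
    qed
    moreover have "samecell u' a' b' C (W' k) (W' n)" using s sc[OF x2[of k] x2[of n]] kn by simp
    ultimately show "W' k = 0 \<and> W' n = 0 \<and> (\<forall>i. k \<le> i \<and> i < n \<longrightarrow> W' i + d' i < u' \<and> (b' < a' \<longrightarrow> W' i + d' i + b'
        < a')) \<or>
      (\<forall>i. k \<le> i \<and> i < n \<longrightarrow> W' (Suc i) = W' i + d' i) \<and> samecell u' a' b' C (W' k) (W' n)" by (intro disjI2)
          simp
  qed
  have ex: "exact_clock u a b C k n X \<longleftrightarrow> exact_clock u' a' b' C k n X'" "exact_clock u a b C k n Y \<longleftrightarrow>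
      exact_clock u' a' b' C k n Y'"
    unfolding exact_clock_def using eq ab[OF xc(3)[of k]] ab[OF xc(3)[of n]] ab[OF xc(4)[of k]] ab[OF xc(4)[of
        n]] kn by simp_all
  have cl: "exact_clock u' a' b' C k n X' \<and> exact_clock u' a' b' C k n Y' \<or> loop_clock u' a' b' C k n d' X' \<and>
      loop_clock u' a' b' C k n d' Y'"
  proof -
    have "loop_clock u' a' b' C k n d' X'" if "loop_clock u a b C k n d X"
      by (rule lo[OF that xc(1,3), where P = "\<lambda>i. x \<in> S i"]) (use trans upd in simp_all)
    moreover have "loop_clock u' a' b' C k n d' Y'" if "loop_clock u a b C k n d Y"
      by (rule lo[OF that xc(2,4), where P = "\<lambda>i. y \<in> S i"]) (use trans upd in simp_all)
    ultimately show ?thesis using pl ex by argo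
  qed
  show ?thesis unfolding timed_lasso_def
  proof (intro conjI allI impI)
    show "0 < d' i" if "0 < i \<and> i < n" for i using pl d'(2)[of i] that by simp
  qed (use pl u' d'(1) x0 ps cl in simp_all)
qed

lemma timed_lasso_integers:
  assumes pl: "timed_lasso A x y C n k p q (1 :: real) (max \<mu> 0) (max (- \<mu>) 0) d X Y" and C: "1 \<le> C"
    and bound: "(n + 2) * sign_bound (n + 2) (C + 2) \<le> B"
  shows "\<exists>u a b d' X' Y'. timed_lasso A x y C n k p q (real u) (real a) (real b) (\<lambda>i. real (d' i)) (\<lambda>i. real
      (X' i)) (\<lambda>i. real (Y' i)) \<and>
    u \<le> B \<and> a \<le> B \<and> b \<le> B \<and> (\<forall>i\<le>n. d' i \<le> B \<and> X' i \<le> B \<and> Y' i \<le> B)"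
proof -
  note pl' = pl[unfolded timed_lasso_def]
  have kn: "0 < k" "k < p" "p \<le> n" using pl' by simp_all
  have "\<forall>i. \<exists>\<gamma> l S. i < n \<longrightarrow> (q i, q (Suc i), \<gamma>, l, S) \<in> transitions A \<and>
      sat 1 (max \<mu> 0) (max (- \<mu>) 0) (\<lambda>z. if z = x then X i + d i else Y i + d i) \<gamma> \<and>
      X (Suc i) = (if x \<in> S then 0 else X i + d i) \<and> Y (Suc i) = (if y \<in> S then 0 else Y i + d i)"
    using pl' unfolding timed_step_def by blast
  then obtain \<gamma> l S where "\<forall>i. i < n \<longrightarrow> (q i, q (Suc i), \<gamma> i, l i, S i) \<in> transitions A \<and>
      sat 1 (max \<mu> 0) (max (- \<mu>) 0) (\<lambda>z. if z = x then X i + d i else Y i + d i) (\<gamma> i) \<and>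
      X (Suc i) = (if x \<in> S i then 0 else X i + d i) \<and> Y (Suc i) = (if y \<in> S i then 0 else Y i + d i)" by
          metis
  note tr = this[rule_format]
  define v where "v j = (if j = 0 then 1 else if j = 1 then \<mu> else d (j - 2))" for j
  define N where "N = n + 2"
  \<comment> \<open>Forms with coefficients 0 and 1, i.e. clock values, are compared with each
    other, with \<open>c\<close> units for \<open>c \<le> C\<close>, or with the parameter. The
    coefficients of all these differences are bounded by \<open>C + 2\<close>.\<close>
  obtain a :: "nat \<Rightarrow> int" where a: "\<And>i. i < N \<Longrightarrow> \<bar>a i\<bar> \<le> int (sign_bound N (C + 2))"
    and sgn: "\<And>k. (\<And>i. i < N \<Longrightarrow> \<bar>k i\<bar> \<le> int (C + 2)) \<Longrightarrow> 0 < lin N k (\<lambda>i. of_int (a i)) \<longleftrightarrow> 0 < lin N k v"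
    using sign_preserving_integers[of "C + 2" N v] by fastforce
  define w where "w i = real_of_int (a i)" for i
  have less: "lin N k v < lin N l v \<longleftrightarrow> lin N k w < lin N l w" if "\<And>i. \<bar>l i - k i\<bar> \<le> int (C + 2)" for k l
    using sgn[of "\<lambda>i. 1 * l i - 1 * k i"] that unfolding lin_comb w_def by simp
  have eq: "lin N k v = lin N l v \<longleftrightarrow> lin N k w = lin N l w" if "\<And>i. \<bar>l i - k i\<bar> \<le> int (C + 2)" for k l
  proof -
    have kl: "\<bar>k i - l i\<bar> \<le> int (C + 2)" for i using that[of i] by (simp add: abs_minus_commute)
    show ?thesis using less[of k l, OF kl] less[of l k, OF that] by linarith
  qed
  define un where "un c j = (\<lambda>i. c * (if i = j then 1 else 0) :: int)" for c :: int and j :: nat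
  have lu: "lin N (un c j) s = of_int c * s j" if "j < N" for c j s unfolding un_def using that by (rule
      lin_unit)
  have unb: "\<bar>un c j i\<bar> \<le> \<bar>c\<bar>" for c j i unfolding un_def by simp
  define r where "r X i \<longleftrightarrow> (if X then x else y) \<in> S i" for X i
  define W where "W X i = lin N (clock_coeff (r X) i) w" for X i
  have cfv: "lin N (clock_coeff (r True) i) v = X i" "lin N (clock_coeff (r False) i) v = Y i" if "i \<le> n" for
      i
    using that
  proof (induction i)
    case 0
    { case 1 show ?case unfolding clock_coeff_0 lin_zero using pl' by simp }
    { case 2 show ?case unfolding clock_coeff_0 lin_zero using pl' by simp }
  next
    case (Suc i)
    have vi: "v (i + 2) = d i" unfolding v_def by simp
    { case 1 then show ?case using lin_clock_coeff_Suc[of i n "r True" v] Suc.IH(1) tr[of i] unfolding N_def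
        vi r_def by simp }
    { case 2 then show ?case using lin_clock_coeff_Suc[of i n "r False" v] Suc.IH(2) tr[of i] unfolding N_def
        vi r_def by simp }
  qed
  define V where "V t i = (if t then X i else Y i)" for t i
  have V: "lin N (clock_coeff (r t) i) v = V t i" if "i \<le> n" for t i using cfv[OF that] unfolding V_def by
      (cases t) simp_all
  have W0: "W t 0 = 0" for t unfolding W_def clock_coeff_0 by (rule lin_zero)
  have WS: "W t (Suc i) = (if r t i then 0 else W t i + w (i + 2))" if "i < n" for t i
    unfolding W_def N_def using that by (rule lin_clock_coeff_Suc)
  define u' where "u' = w 0"
  define a' where "a' = max (w 1) 0"
  define b' where "b' = max (- w 1) 0"
  define d' where "d' i = (if i < n then w (i + 2) else 0)" for i
  have val: "v 0 = 1" "v 1 = \<mu>" "v (i + 2) = d i" for i unfolding v_def by simp_all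
  have N: "0 < N" "1 < N" "i < n \<Longrightarrow> i + 2 < N" for i unfolding N_def by simp_all
  have xcI: "xcell 1 (max \<mu> 0) (max (- \<mu>) 0) s u' a' b' s'"
    if k: "\<And>i. 0 \<le> k i \<and> k i \<le> 1" and s: "lin N k v = s" "lin N k w = s'" for k s s'
  proof -
    have b1: "\<bar>un (int c) 0 i - k i\<bar> \<le> int (C + 2)" if "c \<le> C" for c i
      using unb[of "int c" 0 i] k[of i] that by linarith
    have b2: "\<bar>un 1 1 i - k i\<bar> \<le> int (C + 2)" for i
      using unb[of 1 1 i] k[of i] by linarith
    have "(s < real c * 1 \<longleftrightarrow> s' < real c * u') \<and> (s = real c * 1 \<longleftrightarrow> s' = real c * u')" if "c \<le> C" for c
      using less[of "un (int c) 0" k, OF b1[OF that]] eq[of "un (int c) 0" k, OF b1[OF that]] s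
      unfolding lu[OF N(1)] val u'_def by simp
    moreover have "(s < \<mu> \<longleftrightarrow> s' < w 1) \<and> (s = \<mu> \<longleftrightarrow> s' = w 1)"
      using less[of "un 1 1" k, OF b2] eq[of "un 1 1" k, OF b2] s unfolding lu[OF N(2)] val by simp
    ultimately show ?thesis unfolding xcell_def a'_def b'_def by (auto simp: max_def)
  qed
  have cfb: "0 \<le> clock_coeff (r t) i j \<and> clock_coeff (r t) i j \<le> 1" for t i j using clock_coeff_bounds[of "r
      t" i j] by simp
  have xc2: "xcell 1 (max \<mu> 0) (max (- \<mu>) 0) (V t i) u' a' b' (W t i)" if "i \<le> n" for t i
    by (rule xcI[of "clock_coeff (r t) i"]) (use cfb V[OF that] in \<open>simp_all add: W_def\<close>)
  have xc1: "xcell 1 (max \<mu> 0) (max (- \<mu>) 0) (V t i + d i) u' a' b' (W t i + d' i)" if "i < n" for t i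
  proof (rule xcI[of "\<lambda>j. clock_coeff (r t) i j + (if j = i + 2 then 1 else 0)"])
    show "0 \<le> clock_coeff (r t) i j + (if j = i + 2 then 1 else 0) \<and> clock_coeff (r t) i j + (if j = i + 2
        then 1 else 0) \<le> 1" for j
      using clock_coeff_step_bounds[of "r t" i j] by simp
    show "lin N (\<lambda>j. clock_coeff (r t) i j + (if j = i + 2 then 1 else 0)) v = V t i + d i"
      unfolding lin_add_unit[OF N(3)[OF that]] val using V that by simp
    show "lin N (\<lambda>j. clock_coeff (r t) i j + (if j = i + 2 then 1 else 0)) w = W t i + d' i"
      unfolding lin_add_unit[OF N(3)[OF that]] W_def d'_def using that by simp
  qed
  have xc0: "xcell 1 (max \<mu> 0) (max (- \<mu>) 0) 0 u' a' b' 0"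
    by (rule xcI[of "\<lambda>_. 0"]) (simp_all add: lin_zero)
  have pos: "0 < v j \<longleftrightarrow> 0 < w j" if "j < N" for j
    using less[of "un 1 j" "\<lambda>_. 0"] unb[of 1 j] lu[OF that, of 1] by (simp add: lin_zero) (smt (verit)
        of_nat_0_le_iff)
  have neg: "v j < 0 \<longleftrightarrow> w j < 0" if "j < N" for j
    using less[of "\<lambda>_. 0" "un 1 j"] unb[of 1 j] lu[OF that, of 1] by (simp add: lin_zero) (smt (verit)
        of_nat_0_le_iff)
  have u'0: "0 < u'" using pos[OF N(1)] val unfolding u'_def by simp
  have d'0: "0 \<le> d' i" for i
  proof (cases "i < n")
    case True
    have "0 \<le> d i" using pl' True by (cases i) (simp_all add: less_imp_le)
    then show ?thesis using neg[OF N(3)[OF True]] val(3)[of i] True unfolding d'_def by simp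
  qed (simp add: d'_def)
  have dpos: "0 < d i \<longleftrightarrow> 0 < d' i" if "i < n" for i
    using pos[OF N(3)[OF that]] val(3)[of i] that unfolding d'_def by simp
  have Weq: "V t k = V t n \<longleftrightarrow> W t k = W t n" for t
  proof -
    have "\<bar>clock_coeff (r t) n i - clock_coeff (r t) k i\<bar> \<le> int (C + 2)" for i using cfb[of t n i] cfb[of t k
        i] by linarith
    from eq[of "clock_coeff (r t) n" "clock_coeff (r t) k", OF this] show ?thesis using V kn unfolding W_def
        by simp
  qed
  have VX: "V True = X" "V False = Y" unfolding V_def by (simp_all add: fun_eq_iff)
  have plW: "timed_lasso A x y C n k p q u' a' b' d' (W True) (W False)"
  proof (rule timed_lasso_transfer[where d' = d' and X' = "W True" and Y' = "W False" and \<gamma> = \<gamma> and l = l and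
      S = S, OF pl C u'0 d'0 dpos W0 W0 xc0 _ _ _ _ _ _ tr])
    show "xcell 1 (max \<mu> 0) (max (- \<mu>) 0) (X i + d i) u' a' b' (W True i + d' i)" if "i < n" for i
      using xc1[OF that, of True] unfolding VX .
    show "xcell 1 (max \<mu> 0) (max (- \<mu>) 0) (Y i + d i) u' a' b' (W False i + d' i)" if "i < n" for i
      using xc1[OF that, of False] unfolding VX .
    show "xcell 1 (max \<mu> 0) (max (- \<mu>) 0) (X i) u' a' b' (W True i)" if "i \<le> n" for i
      using xc2[OF that, of True] unfolding VX .
    show "xcell 1 (max \<mu> 0) (max (- \<mu>) 0) (Y i) u' a' b' (W False i)" if "i \<le> n" for i
      using xc2[OF that, of False] unfolding VX .
    show "X k = X n \<longleftrightarrow> W True k = W True n" "Y k = Y n \<longleftrightarrow> W False k = W False n"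
      using Weq[of True] Weq[of False] unfolding VX by simp_all
    show "W True (Suc i) = (if x \<in> S i then 0 else W True i + d' i)" "W False (Suc i) = (if y \<in> S i then 0
        else W False i + d' i)"
      if "i < n" for i using WS[OF that] that unfolding r_def d'_def by simp_all
  qed
  have int: "\<exists>z. w i = of_int z" for i unfolding w_def by blast
  have wb: "\<bar>w i\<bar> \<le> real B" if "i < N" for i
  proof -
    have "\<bar>w i\<bar> \<le> real (sign_bound N (C + 2))" unfolding w_def using a[OF that] by (rule of_int_le_nat)
    moreover have "1 * sign_bound N (C + 2) \<le> B"
      using bound unfolding N_def by (rule order_trans[rotated]) (intro mult_right_mono; simp)
    ultimately show ?thesis by linarith
  qed
  \<comment> \<open>A clock value is a form in \<open>N\<close> variables with coefficients 0 and 1;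
    this is the reason for the factor \<open>n + 2\<close> in the assumption on
    \<open>B\<close>.\<close>
  have Wb: "\<bar>W t i\<bar> \<le> real B" for t i
  proof -
    have "\<bar>W t i\<bar> \<le> real N * (real 1 * real (sign_bound N (C + 2)))"
      unfolding W_def
    proof (rule lin_bound)
      show "\<bar>clock_coeff (r t) i j\<bar> \<le> int 1" for j using cfb[of t i j] by simp
      show "\<bar>w j\<bar> \<le> real (sign_bound N (C + 2))" if "j < N" for j unfolding w_def using a[OF that] by (rule
          of_int_le_nat)
    qed
    also have "\<dots> = real (N * sign_bound N (C + 2))" by simp
    also have "\<dots> \<le> real B" using bound unfolding N_def by (rule of_nat_mono)
    finally show ?thesis .
  qed
  have Wpos: "0 \<le> W t i" if "i \<le> n" for t i
    using that
  proof (induction i)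
    case 0 then show ?case using W0 by simp
  next
    case (Suc i) then show ?case using WS[of i t] d'0[of i] unfolding d'_def by simp
  qed
  have Wint: "\<exists>z. W t i = of_int z" for t i unfolding W_def lin_def w_def by (rule exI[of _ "\<Sum>j<N. clock_coeff
      (r t) i j * a j"]) simp
  have nat: "real (nat \<lfloor>s\<rfloor>) = s" if "0 \<le> s" "\<exists>z. s = of_int z" for s :: real
    using that by auto
  have natb: "nat \<lfloor>s\<rfloor> \<le> B" if "s \<le> real B" for s :: real
    using that by (simp add: nat_le_iff floor_le_iff)
  \<comment> \<open>Set to 0 beyond position \<open>n\<close>, because nonnegativity, needed for
    rounding to natural numbers, has been shown up to \<open>n\<close>.\<close>
  define Wn where "Wn t i = (if i \<le> n then W t i else 0)" for t i
  have Wn: "real (nat \<lfloor>Wn t i\<rfloor>) = Wn t i" for t i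
    using Wpos[of i t] Wint[of t i] unfolding Wn_def by (cases "i \<le> n") (simp_all add: nat)
  have dn: "real (nat \<lfloor>d' i\<rfloor>) = d' i" for i
    using d'0[of i] int[of "i + 2"] nat[of "d' i"] unfolding d'_def by (cases "i < n") simp_all
  have un: "real (nat \<lfloor>u'\<rfloor>) = u'" using u'0 int[of 0] by (intro nat) (simp_all add: u'_def)
  have an: "real (nat \<lfloor>a'\<rfloor>) = a'" "real (nat \<lfloor>b'\<rfloor>) = b'"
    unfolding a'_def b'_def w_def max_def by simp_all
  have "timed_lasso A x y C n k p q u' a' b' d' (Wn True) (Wn False)"
    by (rule timed_lasso_cong[OF plW]) (simp_all add: Wn_def)
  then have "timed_lasso A x y C n k p q (real (nat \<lfloor>u'\<rfloor>)) (real (nat \<lfloor>a'\<rfloor>)) (real (nat \<lfloor>b'\<rfloor>))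
     (\<lambda>i. real (nat \<lfloor>d' i\<rfloor>)) (\<lambda>i. real (nat \<lfloor>Wn True i\<rfloor>)) (\<lambda>i. real (nat \<lfloor>Wn False i\<rfloor>))"
    unfolding un an dn Wn by simp
  moreover have "nat \<lfloor>u'\<rfloor> \<le> B" using wb[OF N(1)] unfolding u'_def by (intro natb) linarith
  moreover have "nat \<lfloor>a'\<rfloor> \<le> B" "nat \<lfloor>b'\<rfloor> \<le> B" using wb[OF N(2)] unfolding a'_def b'_def by (intro natb;
      linarith)+
  moreover have "nat \<lfloor>d' i\<rfloor> \<le> B" for i
  proof (rule natb, cases "i < n")
    case True then show "d' i \<le> real B" using wb[OF N(3)[OF True]] unfolding d'_def by simp
  qed (simp add: d'_def)
  moreover have "nat \<lfloor>Wn t i\<rfloor> \<le> B" for t i using Wb[of t i] unfolding Wn_def by (intro natb) (simp add: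
      abs_le_iff)
  ultimately show ?thesis
    by - (rule exI[of _ "nat \<lfloor>u'\<rfloor>"], rule exI[of _ "nat \<lfloor>a'\<rfloor>"], rule exI[of _ "nat \<lfloor>b'\<rfloor>"],
      rule exI[of _ "\<lambda>i. nat \<lfloor>d' i\<rfloor>"], rule exI[of _ "\<lambda>i. nat \<lfloor>Wn True i\<rfloor>"],
      rule exI[of _ "\<lambda>i. nat \<lfloor>Wn False i\<rfloor>"], simp)
qed

end

section \<open>Arithmetization\<close>

definition digit :: "nat \<Rightarrow> nat \<Rightarrow> nat \<Rightarrow> nat" where
  "digit F s i = s div (F + 1) ^ i mod (F + 1)"

text \<open>Induction that adds a leading digit in base \<open>F + 1\<close>. The explicit bound on
  the code turns quantification over finite sequences into a bounded quantifier.\<close>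

lemma digit_exists:
  assumes "\<And>i. i \<le> n \<Longrightarrow> f i \<le> F"
  shows "\<exists>s < (F + 1) ^ (n + 1). \<forall>i\<le>n. digit F s i = f i"
  using assms
proof (induction n)
  case 0
  then show ?case by (intro exI[of _ "f 0"]) (simp add: digit_def less_Suc_eq_le)
next
  case (Suc n)
  then obtain s where s: "s < (F + 1) ^ (n + 1)" "\<forall>i\<le>n. digit F s i = f i" by (metis le_SucI)
  let ?B = "F + 1"
  define t where "t = s + f (Suc n) * ?B ^ (n + 1)"
  have "t < ?B ^ (n + 1) + f (Suc n) * ?B ^ (n + 1)" unfolding t_def using s(1) by simp
  also have "\<dots> = (f (Suc n) + 1) * ?B ^ (n + 1)" by simp
  also have "\<dots> \<le> ?B * ?B ^ (n + 1)" using Suc.prems[of "Suc n"] by (intro mult_right_mono) simp_all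
  finally have "t < ?B ^ (Suc n + 1)" by simp
  moreover have "digit F t i = f i" if "i \<le> Suc n" for i
  proof (cases "i = Suc n")
    case True
    have "t div ?B ^ (n + 1) = f (Suc n)" unfolding t_def using s(1) by simp
    then show ?thesis using Suc.prems[of "Suc n"] unfolding digit_def True by (simp add: less_Suc_eq_le)
  next
    case False
    then have i: "i \<le> n" using that by simp
    have e: "?B ^ (n + 1) = ?B ^ (n - i) * ?B * ?B ^ i"
    proof -
      have "n + 1 = (n - i) + 1 + i" using i by simp
      then show ?thesis by (metis power_add power_one_right)
    qed
    have td: "t div ?B ^ i = s div ?B ^ i + f (Suc n) * ?B ^ (n - i) * ?B"
      unfolding t_def e by (simp add: mult.assoc[symmetric] del: mult_Suc_right)
    have "digit F t i = digit F s i" unfolding digit_def td by (rule mod_mult_self1)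
    then show ?thesis using s(2) i by simp
  qed
  ultimately show ?case by blast
qed

text \<open>This and the next lemmas supply bounds for the quantifiers over components of a code and
  over codes of sets.\<close>

lemma mem_le_list_encode: "z \<in> set xs \<Longrightarrow> z \<le> list_encode xs"
proof (induction xs)
  case (Cons w xs)
  then show ?case using le_prod_encode_1[of w "list_encode xs"] le_prod_encode_2[of "list_encode xs" w]
    by (auto intro: le_SucI order_trans)
qed simp

lemma mem_le_set_encode: "finite S \<Longrightarrow> z \<in> S \<Longrightarrow> z \<le> set_encode S"
proof -
  assume "finite S" "z \<in> S"
  then have "2 ^ z \<le> set_encode S" unfolding set_encode_def by (intro member_le_sum) simp_all
  then show ?thesis using less_exp[of z] by linarith
qed

lemma set_encode_le: "S \<subseteq> {..N} \<Longrightarrow> set_encode S \<le> 2 ^ (N + 1)"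
proof -
  assume S: "S \<subseteq> {..N}"
  have "set_encode S \<le> (\<Sum>i\<le>N. 2 ^ i)" unfolding set_encode_def using S by (intro sum_mono2) simp_all
  also have "\<dots> \<le> 2 ^ (N + 1)" by (induction N) simp_all
  finally show ?thesis .
qed

text \<open>Local correctness of one entry: an atom is evaluated outright, a compound guard refers
  to the entries of its immediate subformulas. The code \<open>h\<close> bounds all these parts. In
  the code of a bound, the first component 0 announces a constant and 1 the parameter.\<close>

definition true_justified :: "nat \<Rightarrow> nat \<Rightarrow> nat \<Rightarrow> nat \<Rightarrow> nat \<Rightarrow> nat \<Rightarrow> nat \<Rightarrow> nat \<Rightarrow> nat \<Rightarrow> bool" where
  "true_justified u a b x X Y t1 t0 h \<longleftrightarrow>
     (\<exists>z\<le>h. \<exists>c\<le>h. h = list_encode [0, z, 0, prod_encode (0, c)] \<and> (if z = x then X else Y) < c * u \<or>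
        h = list_encode [0, z, 1, prod_encode (0, c)] \<and> (if z = x then X else Y) = c * u \<or>
        h = list_encode [0, z, 0, prod_encode (1, c)] \<and> (if z = x then X else Y) + b < a \<or>
        h = list_encode [0, z, 1, prod_encode (1, c)] \<and> (if z = x then X else Y) + b = a) \<or>
     (\<exists>g\<le>h. h = list_encode [1, g] \<and> g \<in> set_decode t0) \<or>
     (\<exists>g\<le>h. \<exists>g'\<le>h. h = list_encode [2, g, g'] \<and> g \<in> set_decode t1 \<and> g' \<in> set_decode t1)"

definition false_justified :: "nat \<Rightarrow> nat \<Rightarrow> nat \<Rightarrow> nat \<Rightarrow> nat \<Rightarrow> nat \<Rightarrow> nat \<Rightarrow> nat \<Rightarrow> nat \<Rightarrow> bool" where
  "false_justified u a b x X Y t1 t0 h \<longleftrightarrow>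
     (\<exists>z\<le>h. \<exists>c\<le>h. h = list_encode [0, z, 0, prod_encode (0, c)] \<and> \<not> (if z = x then X else Y) < c * u \<or>
        h = list_encode [0, z, 1, prod_encode (0, c)] \<and> \<not> (if z = x then X else Y) = c * u \<or>
        h = list_encode [0, z, 0, prod_encode (1, c)] \<and> \<not> (if z = x then X else Y) + b < a \<or>
        h = list_encode [0, z, 1, prod_encode (1, c)] \<and> \<not> (if z = x then X else Y) + b = a) \<or>
     (\<exists>g\<le>h. h = list_encode [1, g] \<and> g \<in> set_decode t1) \<or>
     (\<exists>g\<le>h. \<exists>g'\<le>h. h = list_encode [2, g, g'] \<and> (g \<in> set_decode t0 \<or> g' \<in> set_decode t0))"

text \<open>Truth of a coded guard: \<open>t1\<close> and \<open>t0\<close> code sets of true and of false subformulas. This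
  replaces the recursion over formulas by bounded quantifiers.\<close>

definition coded_sat :: "nat \<Rightarrow> nat \<Rightarrow> nat \<Rightarrow> nat \<Rightarrow> nat \<Rightarrow> nat \<Rightarrow> nat \<Rightarrow> nat \<Rightarrow> bool" where
  "coded_sat N u a b x X Y g \<longleftrightarrow> (\<exists>t1\<le>2 ^ (N + 1). \<exists>t0\<le>2 ^ (N + 1). g \<in> set_decode t1 \<and>
     (\<forall>h\<le>N. (h \<in> set_decode t1 \<longrightarrow> true_justified u a b x X Y t1 t0 h) \<and>
            (h \<in> set_decode t0 \<longrightarrow> false_justified u a b x X Y t1 t0 h)))"

lemma sub_le: "constraint_code \<gamma> \<le> constraint_code (Neg \<gamma>)"
  "constraint_code \<gamma> \<le> constraint_code (Conj \<gamma> \<gamma>')" "constraint_code \<gamma>' \<le> constraint_code (Conj \<gamma> \<gamma>')"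
  unfolding constraint_code.simps by (rule mem_le_list_encode, simp)+

text \<open>Local correctness suffices because each justification refers to smaller guards. Truth
  and falsity go through the induction together, since negation exchanges the two tables.\<close>

lemma coded_sat_sound:
  assumes j: "\<And>h. h \<le> N \<Longrightarrow> h \<in> set_decode t1 \<Longrightarrow> true_justified u a b x X Y t1 t0 h"
    "\<And>h. h \<le> N \<Longrightarrow> h \<in> set_decode t0 \<Longrightarrow> false_justified u a b x X Y t1 t0 h"
    and "constraint_code \<gamma> \<le> N"
  shows "(constraint_code \<gamma> \<in> set_decode t1 \<longrightarrow> sat u a b (\<lambda>z. if z = x then X else Y) \<gamma>) \<and>
    (constraint_code \<gamma> \<in> set_decode t0 \<longrightarrow> \<not> sat u a b (\<lambda>z. if z = x then X else Y) \<gamma>)"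
  using assms(3)
proof (induction \<gamma>)
  case (Atom z r \<beta>)
  show ?case
  proof (intro conjI impI)
    assume "constraint_code (Atom z r \<beta>) \<in> set_decode t1"
    from j(1)[OF Atom this] show "sat u a b (\<lambda>z. if z = x then X else Y) (Atom z r \<beta>)"
      unfolding true_justified_def by (cases \<beta>; cases r) (auto simp: list_encode_eq simp del:
          list_encode.simps)
  next
    assume "constraint_code (Atom z r \<beta>) \<in> set_decode t0"
    from j(2)[OF Atom this] show "\<not> sat u a b (\<lambda>z. if z = x then X else Y) (Atom z r \<beta>)"
      unfolding false_justified_def by (cases \<beta>; cases r) (auto simp: list_encode_eq simp del:
          list_encode.simps)
  qed
next
  case (Neg \<gamma>)
  have le: "constraint_code \<gamma> \<le> N" using Neg.prems sub_le(1) order_trans by blast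
  show ?case
  proof (intro conjI impI)
    assume "constraint_code (Neg \<gamma>) \<in> set_decode t1"
    from j(1)[OF Neg.prems this] show "sat u a b (\<lambda>z. if z = x then X else Y) (Neg \<gamma>)"
      using Neg.IH[OF le] unfolding true_justified_def by (auto simp: list_encode_eq simp del:
          list_encode.simps)
  next
    assume "constraint_code (Neg \<gamma>) \<in> set_decode t0"
    from j(2)[OF Neg.prems this] show "\<not> sat u a b (\<lambda>z. if z = x then X else Y) (Neg \<gamma>)"
      using Neg.IH[OF le] unfolding false_justified_def by (auto simp: list_encode_eq simp del:
          list_encode.simps)
  qed
next
  case (Conj \<gamma> \<gamma>')
  have le: "constraint_code \<gamma> \<le> N" "constraint_code \<gamma>' \<le> N" using Conj.prems sub_le(2,3) order_trans by blast+
  show ?case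
  proof (intro conjI impI)
    assume "constraint_code (Conj \<gamma> \<gamma>') \<in> set_decode t1"
    from j(1)[OF Conj.prems this] show "sat u a b (\<lambda>z. if z = x then X else Y) (Conj \<gamma> \<gamma>')"
      using Conj.IH(1)[OF le(1)] Conj.IH(2)[OF le(2)] unfolding true_justified_def
      by (auto simp: list_encode_eq simp del: list_encode.simps)
  next
    assume "constraint_code (Conj \<gamma> \<gamma>') \<in> set_decode t0"
    from j(2)[OF Conj.prems this] show "\<not> sat u a b (\<lambda>z. if z = x then X else Y) (Conj \<gamma> \<gamma>')"
      using Conj.IH(1)[OF le(1)] Conj.IH(2)[OF le(2)] unfolding false_justified_def
      by (auto simp: list_encode_eq simp del: list_encode.simps)
  qed
qed

lemma coded_sat_iff:
  assumes "constraint_code \<gamma> \<le> N"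
  shows "coded_sat N u a b x X Y (constraint_code \<gamma>) \<longleftrightarrow> sat u a b (\<lambda>z. if z = x then X else Y) \<gamma>"
proof
  assume "coded_sat N u a b x X Y (constraint_code \<gamma>)"
  then obtain t1 t0 where t: "constraint_code \<gamma> \<in> set_decode t1"
    "\<forall>h\<le>N. (h \<in> set_decode t1 \<longrightarrow> true_justified u a b x X Y t1 t0 h) \<and>
            (h \<in> set_decode t0 \<longrightarrow> false_justified u a b x X Y t1 t0 h)" unfolding coded_sat_def by (elim exE
                conjE)
  then show "sat u a b (\<lambda>z. if z = x then X else Y) \<gamma>" using coded_sat_sound[of N t1 u a b x X Y t0 \<gamma>] assms
      by blast
next
  let ?s = "sat u a b (\<lambda>z. if z = x then X else Y)"
  assume s: "?s \<gamma>"
  \<comment> \<open>For the converse the tables contain all guards with code at most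
    \<open>N\<close>, sorted by truth value. They are subsets of \<open>{..N}\<close>, whence the
    bound \<open>2 ^ (N + 1)\<close>.\<close>
  define S where "S P = {constraint_code \<gamma> | \<gamma>. constraint_code \<gamma> \<le> N \<and> (?s \<gamma> \<longleftrightarrow> P)}" for P
  have sub: "S P \<subseteq> {..N}" for P unfolding S_def by auto
  then have fin: "finite (S P)" for P by (rule finite_subset) simp
  have dec: "set_decode (set_encode (S P)) = S P" for P using fin by (rule set_encode_inverse)
  have mem: "constraint_code \<gamma> \<in> S P" if "constraint_code \<gamma> \<le> N" "?s \<gamma> \<longleftrightarrow> P" for \<gamma> P
    unfolding S_def using that by blast
  have just: "(h \<in> S True \<longrightarrow> true_justified u a b x X Y (set_encode (S True)) (set_encode (S False)) h) \<and>
      (h \<in> S False \<longrightarrow> false_justified u a b x X Y (set_encode (S True)) (set_encode (S False)) h)" for h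
  proof -
    have "if P then true_justified u a b x X Y (set_encode (S True)) (set_encode (S False)) h
          else false_justified u a b x X Y (set_encode (S True)) (set_encode (S False)) h" if hP: "h \<in> S P"
              for P
    proof -
      obtain \<gamma> where g: "h = constraint_code \<gamma>" "constraint_code \<gamma> \<le> N" "?s \<gamma> \<longleftrightarrow> P" using hP unfolding S_def by
          blast
      show ?thesis
      proof (cases \<gamma>)
        case (Atom z r \<beta>)
        have le: "z \<le> h" "bound_code \<beta> \<le> h" unfolding g(1) Atom constraint_code.simps by (rule
            mem_le_list_encode, simp)+
        obtain k c where \<beta>: "bound_code \<beta> = prod_encode (k, c)" "\<beta> = (if k = 0 then Const c else Param c)" "k
            = 0 \<or> k = 1"
          by (cases \<beta>) auto
        have c: "c \<le> h" using le(2) le_prod_encode_2[of c k] unfolding \<beta>(1) by linarith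
        have h: "h = list_encode [0, z, comparison_code r, prod_encode (k, c)]" unfolding g(1) Atom
            constraint_code.simps \<beta>(1) ..
        have "true_justified u a b x X Y t1 t0 h" if "?s \<gamma>" for t1 t0
          unfolding true_justified_def
        proof (rule disjI1, rule exI[of _ z], rule conjI[OF le(1)])
          show "\<exists>c\<le>h. h = list_encode [0, z, 0, prod_encode (0, c)] \<and> (if z = x then X else Y) < c * u \<or>
            h = list_encode [0, z, 1, prod_encode (0, c)] \<and> (if z = x then X else Y) = c * u \<or>
            h = list_encode [0, z, 0, prod_encode (1, c)] \<and> (if z = x then X else Y) + b < a \<or>
            h = list_encode [0, z, 1, prod_encode (1, c)] \<and> (if z = x then X else Y) + b = a"
            by (rule exI[of _ c], rule conjI[OF c])
              (use h \<beta>(2,3) that[unfolded Atom] in \<open>cases r; elim disjE; simp del: list_encode.simps\<close>)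
        qed
        moreover have "false_justified u a b x X Y t1 t0 h" if "\<not> ?s \<gamma>" for t1 t0
          unfolding false_justified_def
        proof (rule disjI1, rule exI[of _ z], rule conjI[OF le(1)])
          show "\<exists>c\<le>h. h = list_encode [0, z, 0, prod_encode (0, c)] \<and> \<not> (if z = x then X else Y) < c * u \<or>
            h = list_encode [0, z, 1, prod_encode (0, c)] \<and> \<not> (if z = x then X else Y) = c * u \<or>
            h = list_encode [0, z, 0, prod_encode (1, c)] \<and> \<not> (if z = x then X else Y) + b < a \<or>
            h = list_encode [0, z, 1, prod_encode (1, c)] \<and> \<not> (if z = x then X else Y) + b = a"
            by (rule exI[of _ c], rule conjI[OF c])
              (use h \<beta>(2,3) that[unfolded Atom] in \<open>cases r; elim disjE; simp del: list_encode.simps\<close>)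
        qed
        ultimately show ?thesis using g(3) by (cases P) simp_all
      next
        case (Neg \<gamma>1)
        have le: "constraint_code \<gamma>1 \<le> h" unfolding g(1) Neg by (rule sub_le)
        then have "constraint_code \<gamma>1 \<in> S (\<not> P)" using g Neg by (intro mem) (auto simp del:
            constraint_code.simps)
        moreover have "h = list_encode [1, constraint_code \<gamma>1]" unfolding g(1) Neg by (rule
            constraint_code.simps)
        ultimately show ?thesis unfolding true_justified_def false_justified_def
          using le by (cases P; simp only: if_True if_False; intro disjI2 disjI1 exI[of _ "constraint_code
              \<gamma>1"] conjI) (simp_all only: dec not_True_eq_False not_False_eq_True)
      next
        case (Conj \<gamma>1 \<gamma>2)
        have le: "constraint_code \<gamma>1 \<le> h" "constraint_code \<gamma>2 \<le> h" unfolding g(1) Conj by (rule sub_le)+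
        have h: "h = list_encode [2, constraint_code \<gamma>1, constraint_code \<gamma>2]" unfolding g(1) Conj by (rule
            constraint_code.simps)
        have m: "constraint_code \<gamma>1 \<in> S (?s \<gamma>1)" "constraint_code \<gamma>2 \<in> S (?s \<gamma>2)" using le g(1,2) by (intro
            mem; simp)+
        show ?thesis
        proof (cases P)
          case True
          then have "?s \<gamma>1" "?s \<gamma>2" using g(3) Conj by simp_all
          then show ?thesis using m le h True unfolding true_justified_def dec by auto
        next
          case False
          then have "\<not> ?s \<gamma>1 \<or> \<not> ?s \<gamma>2" using g(3) Conj by simp
          then have "constraint_code \<gamma>1 \<in> S False \<or> constraint_code \<gamma>2 \<in> S False" using m by auto
          then show ?thesis using le h False unfolding false_justified_def dec by auto
        qed
      qed
    qed
    from this[of True] this[of False] show ?thesis by simp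
  qed
  show "coded_sat N u a b x X Y (constraint_code \<gamma>)" unfolding coded_sat_def
    by (rule exI[of _ "set_encode (S True)"], intro conjI set_encode_le sub, rule exI[of _ "set_encode (S
        False)"],
        intro conjI set_encode_le sub allI impI)
      (use just mem[of \<gamma> True] assms s in \<open>auto simp: dec\<close>)
qed

section \<open>Coded steps and lassos\<close>

definition coded_step :: "nat \<Rightarrow> nat \<Rightarrow> nat \<Rightarrow> nat \<Rightarrow> nat \<Rightarrow> nat \<Rightarrow> nat \<Rightarrow> nat \<Rightarrow> nat \<Rightarrow> nat \<Rightarrow> nat \<Rightarrow> nat \<Rightarrow> nat \<Rightarrow> bool"
    where
  "coded_step N tr x y F u a b sq sd sX sY i \<longleftrightarrow> (\<exists>g\<le>N. \<exists>l\<le>N. \<exists>S\<le>N.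
     list_encode [digit F sq i, digit F sq (Suc i), g, l, S] \<in> set_decode tr \<and>
     coded_sat N u a b x (digit F sX i + digit F sd i) (digit F sY i + digit F sd i) g \<and>
     digit F sX (Suc i) = (if x \<in> set_decode S then 0 else digit F sX i + digit F sd i) \<and>
     digit F sY (Suc i) = (if y \<in> set_decode S then 0 else digit F sY i + digit F sd i))"

definition coded_samecell :: "nat \<Rightarrow> nat \<Rightarrow> nat \<Rightarrow> nat \<Rightarrow> nat \<Rightarrow> nat \<Rightarrow> bool" where
  "coded_samecell N u a b v w \<longleftrightarrow> (\<forall>c\<le>N. (v < c * u \<longleftrightarrow> w < c * u) \<and> (v = c * u \<longleftrightarrow> w = c * u)) \<and>
     (v + b < a \<longleftrightarrow> w + b < a) \<and> (v + b = a \<longleftrightarrow> w + b = a)"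

definition coded_loop_clock :: "nat \<Rightarrow> nat \<Rightarrow> nat \<Rightarrow> nat \<Rightarrow> nat \<Rightarrow> nat \<Rightarrow> nat \<Rightarrow> nat \<Rightarrow> nat \<Rightarrow> bool" where
  "coded_loop_clock N F u a b k n sd s \<longleftrightarrow>
     digit F s k = 0 \<and> digit F s n = 0 \<and> (\<forall>i\<le>n. k \<le> i \<and> i < n \<longrightarrow> digit F s i + digit F sd i < u \<and> (b < a \<longrightarrow>
         digit F s i + digit F sd i + b < a)) \<or>
     (\<forall>i\<le>n. k \<le> i \<and> i < n \<longrightarrow> digit F s (Suc i) = digit F s i + digit F sd i) \<and> coded_samecell N u a b (digit F
         s k) (digit F s n)"

definition coded_exact_clock :: "nat \<Rightarrow> nat \<Rightarrow> nat \<Rightarrow> nat \<Rightarrow> nat \<Rightarrow> nat \<Rightarrow> nat \<Rightarrow> nat \<Rightarrow> bool" where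
  "coded_exact_clock N F u a b k n s \<longleftrightarrow> digit F s k = digit F s n \<or>
     (N * u < digit F s k \<and> a < digit F s k + b) \<and> (N * u < digit F s n \<and> a < digit F s n + b)"

definition coded_lasso :: "nat \<Rightarrow> nat \<Rightarrow> nat \<Rightarrow> nat \<Rightarrow> nat \<Rightarrow> nat \<Rightarrow> nat \<Rightarrow> nat \<Rightarrow> nat \<Rightarrow> nat \<Rightarrow> nat \<Rightarrow> nat \<Rightarrow> nat \<Rightarrow> nat \<Rightarrow>
    nat \<Rightarrow> nat \<Rightarrow> nat \<Rightarrow> bool" where
  "coded_lasso N tr ini bu x y F n k p u a b sq sd sX sY \<longleftrightarrow> 0 < u \<and> digit F sq 0 = ini \<and> digit F sX 0 = 0 \<and>
      digit F sY 0 = 0 \<and>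
     (\<forall>i\<le>n. 0 < i \<and> i < n \<longrightarrow> 0 < digit F sd i) \<and> 0 < k \<and> k < p \<and> p \<le> n \<and>
     digit F sq p \<in> set_decode bu \<and> digit F sq n = digit F sq k \<and>
     (\<forall>i\<le>n. i < n \<longrightarrow> coded_step N tr x y F u a b sq sd sX sY i) \<and>
     (coded_exact_clock N F u a b k n sX \<and> coded_exact_clock N F u a b k n sY \<or> coded_loop_clock N F u a b k n
         sd sX \<and> coded_loop_clock N F u a b k n sd sY)"

text \<open>The coded definitions write their quantifiers with an explicit bound, as
  \<open>decidable_all\<close> expects them.\<close>

lemma bounded_all: "(\<forall>i\<le>n. k \<le> i \<and> i < n \<longrightarrow> P i) \<longleftrightarrow> (\<forall>i. k \<le> i \<and> i < n \<longrightarrow> P i)"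
  "(\<forall>i\<le>n. 0 < i \<and> i < n \<longrightarrow> P i) \<longleftrightarrow> (\<forall>i. 0 < i \<and> i < n \<longrightarrow> P i)"
  "(\<forall>i\<le>n. i < n \<longrightarrow> P i) \<longleftrightarrow> (\<forall>i<n. P i)" for n :: nat
  using less_imp_le by blast+

text \<open>The code \<open>N\<close> is at least every state, clock and constant of the automaton
  and the codes of its guards. Thus \<open>N\<close> serves both as the bound of quantifiers and as
  the bound \<open>C\<close> on constants.\<close>

locale coded_automaton =
  fixes A :: nat_pta and N tr :: nat
  assumes TA: "parametric_TA A" and N: "N = pta_code A" and tr: "tr = set_encode (transition_code `
      transitions A)"
begin

lemma finite_sets: "finite (alphabet A)" "finite (states A)" "finite (clocks A)" "finite (params A)" "finite
    (transitions A)" "finite (buechi A)"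
  using TA finite_subset unfolding parametric_TA_def by auto

lemma pieces_le: "set_encode (alphabet A) \<le> N" "set_encode (states A) \<le> N" "set_encode (clocks A) \<le> N"
  "set_encode (params A) \<le> N" "tr \<le> N" "initial A \<le> N" "set_encode (buechi A) \<le> N" "1 \<le> N"
proof -
  show "1 \<le> N" unfolding N pta_code_def list_encode.simps by simp
qed (unfold N pta_code_def tr, (rule mem_le_list_encode, simp)+)

lemma set_decode_tr: "set_decode tr = transition_code ` transitions A"
  unfolding tr using finite_sets(5) by (simp add: set_encode_inverse)

lemma transition_finite: "(q, q', \<gamma>, l, S) \<in> transitions A \<Longrightarrow> finite S"
  using TA finite_sets(3) finite_subset unfolding parametric_TA_def by blast

lemma transition_code_le: "t \<in> transitions A \<Longrightarrow> transition_code t \<le> N"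
  using mem_le_set_encode[of "transition_code ` transitions A" "transition_code t"] finite_sets(5)
      pieces_le(5)
  unfolding tr by simp

lemma transition_pieces_le:
  assumes "(q, q', \<gamma>, l, S) \<in> transitions A"
  shows "constraint_code \<gamma> \<le> N" "l \<le> N" "set_encode S \<le> N"
proof -
  have "constraint_code \<gamma> \<le> transition_code (q, q', \<gamma>, l, S)" "l \<le> transition_code (q, q', \<gamma>, l, S)"
    "set_encode S \<le> transition_code (q, q', \<gamma>, l, S)"
    unfolding transition_code.simps by (rule mem_le_list_encode, simp)+
  then show "constraint_code \<gamma> \<le> N" "l \<le> N" "set_encode S \<le> N" using transition_code_le[OF assms] by linarith+
qed

lemma states_le: "q \<in> states A \<Longrightarrow> q \<le> N"
  using mem_le_set_encode[OF finite_sets(2)] pieces_le(2) order_trans by blast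

lemma clocks_le: "z \<in> clocks A \<Longrightarrow> z \<le> N"
  using mem_le_set_encode[OF finite_sets(3)] pieces_le(3) order_trans by blast

lemma constraint_consts_le: "c \<in> constraint_consts \<gamma> \<Longrightarrow> c \<le> constraint_code \<gamma>"
proof (induction \<gamma>)
  case (Atom z r \<beta>)
  have "bound_code \<beta> \<le> constraint_code (Atom z r \<beta>)" unfolding constraint_code.simps by (rule
      mem_le_list_encode) simp
  moreover have "c \<le> bound_code \<beta>" using Atom le_prod_encode_2 by (cases \<beta>) auto
  ultimately show ?case by linarith
next
  case (Neg \<gamma>) then show ?case using sub_le(1)[of \<gamma>] by (simp del: constraint_code.simps)
next
  case (Conj \<gamma> \<gamma>')
  from Conj.prems have "c \<in> constraint_consts \<gamma> \<or> c \<in> constraint_consts \<gamma>'" by simp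
  then show ?case using Conj.IH sub_le(2)[of \<gamma> \<gamma>'] sub_le(3)[of \<gamma>' \<gamma>] order_trans by blast
qed

lemma const_le: "(q, q', \<gamma>, l, S) \<in> transitions A \<Longrightarrow> constraint_consts \<gamma> \<subseteq> {..N}"
  using constraint_consts_le transition_pieces_le(1) order_trans by blast

lemma coded_step_iff:
  "coded_step N tr x y F u a b sq sd sX sY i \<longleftrightarrow> timed_step A x y u a b (digit F sq) (digit F sd) (digit F sX)
      (digit F sY) i"
proof
  assume "coded_step N tr x y F u a b sq sd sX sY i"
  then obtain g l s where g: "g \<le> N" "list_encode [digit F sq i, digit F sq (Suc i), g, l, s] \<in> set_decode tr"
    "coded_sat N u a b x (digit F sX i + digit F sd i) (digit F sY i + digit F sd i) g"
    "digit F sX (Suc i) = (if x \<in> set_decode s then 0 else digit F sX i + digit F sd i)"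
    "digit F sY (Suc i) = (if y \<in> set_decode s then 0 else digit F sY i + digit F sd i)" unfolding
        coded_step_def by blast
  obtain t where t: "t \<in> transitions A" "list_encode [digit F sq i, digit F sq (Suc i), g, l, s] =
      transition_code t"
    using g(2) unfolding set_decode_tr by (rule imageE) simp
  obtain q q' \<gamma> l' S where tt: "t = (q, q', \<gamma>, l', S)" by (rule prod_cases5)
  have e: "q = digit F sq i" "q' = digit F sq (Suc i)" "constraint_code \<gamma> = g" "l' = l" "set_encode S = s"
    using t(2) unfolding tt transition_code.simps list_encode_eq by simp_all
  have tA: "(digit F sq i, digit F sq (Suc i), \<gamma>, l, S) \<in> transitions A" using t(1) unfolding tt e .
  have S: "set_decode s = S" using e(5) set_encode_inverse[OF transition_finite[OF tA]] by simp
  have "sat u a b (\<lambda>z. if z = x then digit F sX i + digit F sd i else digit F sY i + digit F sd i) \<gamma>"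
    using g(3) coded_sat_iff[OF transition_pieces_le(1)[OF tA]] unfolding e(3)[symmetric] by simp
  then show "timed_step A x y u a b (digit F sq) (digit F sd) (digit F sX) (digit F sY) i"
    unfolding timed_step_def using tA g(4,5) unfolding S by blast
next
  assume "timed_step A x y u a b (digit F sq) (digit F sd) (digit F sX) (digit F sY) i"
  then obtain \<gamma> l S where s: "(digit F sq i, digit F sq (Suc i), \<gamma>, l, S) \<in> transitions A"
    "sat u a b (\<lambda>z. if z = x then digit F sX i + digit F sd i else digit F sY i + digit F sd i) \<gamma>"
    "digit F sX (Suc i) = (if x \<in> S then 0 else digit F sX i + digit F sd i)"
    "digit F sY (Suc i) = (if y \<in> S then 0 else digit F sY i + digit F sd i)" unfolding timed_step_def by
        blast
  note le = transition_pieces_le[OF s(1)]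
  have S: "set_decode (set_encode S) = S" using transition_finite[OF s(1)] by (rule set_encode_inverse)
  have "list_encode [digit F sq i, digit F sq (Suc i), constraint_code \<gamma>, l, set_encode S] \<in> set_decode tr"
    unfolding set_decode_tr by (rule image_eqI[OF _ s(1)]) simp
  moreover have "coded_sat N u a b x (digit F sX i + digit F sd i) (digit F sY i + digit F sd i)
      (constraint_code \<gamma>)"
    unfolding coded_sat_iff[OF le(1)] by (rule s(2))
  ultimately show "coded_step N tr x y F u a b sq sd sX sY i" unfolding coded_step_def
    by (rule_tac exI[of _ "constraint_code \<gamma>"], intro conjI le(1), rule_tac exI[of _ l], intro conjI le(2),
        rule_tac exI[of _ "set_encode S"])
      (intro conjI le(3); (assumption | simp only: S s(3,4)))
qed

lemma coded_lasso_iff: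
  "coded_lasso N tr (initial A) (set_encode (buechi A)) x y F n k p u a b sq sd sX sY \<longleftrightarrow>
   timed_lasso A x y N n k p (digit F sq) u a b (digit F sd) (digit F sX) (digit F sY)"
proof -
  have s: "coded_samecell N u a b v w \<longleftrightarrow> samecell u a b N v w" for v w
    unfolding coded_samecell_def samecell_def by simp
  have l: "coded_loop_clock N F u a b k n sd s \<longleftrightarrow> loop_clock u a b N k n (digit F sd) (digit F s)" for s
    unfolding coded_loop_clock_def loop_clock_def s bounded_all ..
  have e: "coded_exact_clock N F u a b k n s \<longleftrightarrow> exact_clock u a b N k n (digit F s)" for s
    unfolding coded_exact_clock_def exact_clock_def above_def by simp
  show ?thesis
    unfolding coded_lasso_def timed_lasso_def bounded_all coded_step_iff l e set_encode_inverse[OF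
        finite_sets(6)] by simp
qed

end

section \<open>Computable versions of the length bounds\<close>

definition nonreset_length :: "nat \<Rightarrow> nat \<Rightarrow> nat" where "nonreset_length s \<kappa> = s * (\<kappa> * \<kappa>)"
definition single_length :: "nat \<Rightarrow> nat \<Rightarrow> nat" where "single_length s \<kappa> = (s * \<kappa>) * (nonreset_length s \<kappa> + 1)"
definition noswap_length :: "nat \<Rightarrow> nat \<Rightarrow> nat" where "noswap_length s \<kappa> = s * (2 * single_length s \<kappa> +
    nonreset_length s \<kappa> + 1) + 2 * single_length s \<kappa>"
definition label_number :: "nat \<Rightarrow> nat \<Rightarrow> nat" where "label_number s \<kappa> = \<kappa> * ((s * (\<kappa> * \<kappa>) + 1) ^
    nonreset_length s \<kappa> * (s * \<kappa>))"
definition loop_length :: "nat \<Rightarrow> nat \<Rightarrow> nat" where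
  "loop_length s \<kappa> = label_number s \<kappa> * (noswap_length s \<kappa> + 2 * (nonreset_length s \<kappa> + 1)) + (noswap_length s
      \<kappa> + nonreset_length s \<kappa>) + single_length s \<kappa> + nonreset_length s \<kappa>"

text \<open>Gives a closed upper bound for the number of words of length at most \<open>n\<close>
  over \<open>m\<close> letters.\<close>

lemma sum_powers_le: "(\<Sum>i\<le>n. m ^ i) \<le> (m + 1) ^ n" for m :: nat
proof (induction n)
  case (Suc n)
  have "m ^ n \<le> (m + 1) ^ n" by (rule power_mono) simp_all
  then have "m * m ^ n \<le> m * (m + 1) ^ n" by (rule mult_le_mono2)
  moreover have "(m + 1) ^ Suc n = m * (m + 1) ^ n + (m + 1) ^ n" by simp
  ultimately show ?case using Suc unfolding sum.atMost_Suc power_Suc by linarith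
qed simp

context two_clocks begin

text \<open>The exact bounds count states and transitions of the abstract system, which depends on
  the parameter. Their counterparts are monotone terms in a single number \<open>s\<close> above
  both counts, built from computable operations.\<close>

lemma loop_bound_le:
  assumes s: "card Qs \<le> s" "card T \<le> s"
  shows "loop_bound \<le> loop_length s \<kappa>"
proof -
  have \<nu>: "\<nu> \<le> s" unfolding \<nu>_def by (rule s(1))
  have nr: "nr_bound \<le> nonreset_length s \<kappa>" unfolding nr_bound_def nonreset_length_def by (intro mult_le_mono
      \<nu> order_refl)
  have si: "single_bound \<le> single_length s \<kappa>" unfolding single_bound_def single_length_def
    by (intro mult_le_mono add_le_mono \<nu> nr order_refl)
  have no: "noswap_bound \<le> noswap_length s \<kappa>" unfolding noswap_bound_def noswap_length_def
    by (intro mult_le_mono add_le_mono \<nu> nr si order_refl)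
  have la: "card labels \<le> label_number s \<kappa>"
  proof -
    let ?A = "T \<times> {..<\<kappa>} \<times> {..<\<kappa>}"
    have fin: "finite ?A" using finite_T by simp
    have cA: "card ?A \<le> s * (\<kappa> * \<kappa>)" unfolding card_cartesian_product card_lessThan by (intro mult_le_mono s
        order_refl)
    have "card {ls. set ls \<subseteq> ?A \<and> length ls \<le> nr_bound} = (\<Sum>i\<le>nr_bound. card ?A ^ i)" using fin by (rule
        card_lists_length_le)
    also have "\<dots> \<le> (card ?A + 1) ^ nr_bound" by (rule sum_powers_le)
    also have "\<dots> \<le> (s * (\<kappa> * \<kappa>) + 1) ^ nr_bound" by (intro power_mono add_le_mono cA) simp_all
    also have "\<dots> \<le> (s * (\<kappa> * \<kappa>) + 1) ^ nonreset_length s \<kappa>" by (intro power_increasing nr) simp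
    finally show ?thesis unfolding labels_def label_number_def card_cartesian_product card_lessThan
      by (intro mult_le_mono s order_refl)
  qed
  show ?thesis unfolding loop_bound_def path_bound_def swap_bound_def loop_length_def
    by (intro mult_le_mono add_le_mono la no nr si order_refl)
qed

end

text \<open>The recursion of \<open>sign_bound\<close> changes \<open>K\<close> at each level. Since
  \<open>2 * (2 * K ^ 2) = (2 * K) ^ 2\<close>, every level squares \<open>2 * K\<close>, so that
  \<open>(2 * K) ^ (2 ^ n)\<close> dominates the coefficient bounds of all levels. Each level then
  contributes at most one and the same factor, and adding 1 absorbs the additive terms.\<close>

lemma sign_bound_le:
  "(2 * K) ^ (2 ^ n) \<le> Z \<Longrightarrow> n \<le> m \<Longrightarrow> 1 \<le> K \<Longrightarrow> sign_bound n K + 1 \<le> (2 * Z ^ 2 * (m * Z + 1) + 1) ^ n"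
proof (induction n arbitrary: K)
  case (Suc n)
  let ?W = "2 * Z ^ 2 * (m * Z + 1)"
  let ?s = "sign_bound n (2 * K ^ 2)"
  have "2 * (2 * K ^ 2) = (2 * K) ^ 2" by (simp add: power2_eq_square)
  then have "(2 * (2 * K ^ 2)) ^ (2 ^ n) = ((2 * K) ^ 2) ^ (2 ^ n)" by (simp only:)
  also have "\<dots> = (2 * K) ^ (2 ^ Suc n)" by (simp only: power_mult[symmetric] power_Suc)
  finally have "(2 * (2 * K ^ 2)) ^ (2 ^ n) \<le> Z" using Suc.prems(1) by simp
  moreover have "1 \<le> 2 * K ^ 2" using Suc.prems(3) by (simp add: Suc_leI)
  moreover have "n \<le> m" using Suc.prems(2) by simp
  ultimately have IH: "?s + 1 \<le> (?W + 1) ^ n" by (intro Suc.IH)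
  have "K \<le> (2 * K) ^ 1" by simp
  also have "\<dots> \<le> (2 * K) ^ (2 ^ Suc n)" using Suc.prems(3) by (intro power_increasing) simp_all
  finally have KZ: "K \<le> Z" using Suc.prems(1) by simp
  have "sign_bound (Suc n) K = 2 * K ^ 2 * (n * K * ?s + 1)" by simp
  also have "\<dots> \<le> 2 * K ^ 2 * ((n * K + 1) * (?s + 1))" by (intro mult_le_mono order_refl) (simp add:
      algebra_simps)
  also have "\<dots> = (2 * K ^ 2 * (n * K + 1)) * (?s + 1)" by (simp only: mult.assoc)
  also have "\<dots> \<le> ?W * (?s + 1)"
    using KZ Suc.prems(2) by (intro mult_le_mono add_le_mono power_mono order_refl) simp_all
  finally have "sign_bound (Suc n) K + 1 \<le> ?W * (?s + 1) + 1" by simp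
  also have "\<dots> \<le> (?W + 1) * (?s + 1)" by simp
  also have "\<dots> \<le> (?W + 1) * (?W + 1) ^ n" using IH by (intro mult_le_mono order_refl)
  finally show ?case by simp
qed simp

section \<open>The arithmetical formula and its equivalence with nonemptiness\<close>

definition length_bound :: "nat \<Rightarrow> nat" where
  "length_bound N = 3 * loop_length (N + 1) ((2 * N + 3) * 3) + 2"

text \<open>The first summand bounds the integers of a lasso and the second its states, so one base
  serves for all coded sequences.\<close>

definition digit_bound :: "nat \<Rightarrow> nat \<Rightarrow> nat \<Rightarrow> nat" where
  "digit_bound N L Z = (L + 2) * (2 * Z ^ 2 * ((L + 2) * Z + 1) + 1) ^ (L + 2) + N"

text \<open>Quantifiers of the form \<open>\<exists>L\<le>t. L = t\<close> act as local definitions: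
  the large bounds become variables and the formula keeps a shape that the closure rules can take
  apart. The components of the automaton are guessed and compared with \<open>N\<close>.
  \<open>x\<close> and \<open>y\<close> range up to \<open>N + 1\<close> so that a fresh name is
  available for a missing clock, and \<open>G\<close> bounds codes of sequences of
  \<open>L + 1\<close> digits.\<close>

definition coded_problem :: "nat \<Rightarrow> bool" where
  "coded_problem N \<longleftrightarrow> (\<exists>L\<le>length_bound N. L = length_bound N \<and> (\<exists>Z\<le>(2 * (N + 2)) ^ (2 ^ (L + 2)). Z = (2 * (N +
      2)) ^ (2 ^ (L + 2)) \<and>
     (\<exists>F\<le>digit_bound N L Z. F = digit_bound N L Z \<and> (\<exists>G\<le>(F + 1) ^ (L + 1). G = (F + 1) ^ (L + 1) \<and>
     (\<exists>al\<le>N. \<exists>ss\<le>N. \<exists>ck\<le>N. \<exists>pr\<le>N. \<exists>tr\<le>N. \<exists>ini\<le>N. \<exists>bu\<le>N. N = list_encode [al, ss, ck, pr, tr, ini, bu] \<and>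
     (\<exists>x\<le>N + 1. \<exists>y\<le>N + 1. x \<noteq> y \<and> (\<forall>z\<le>N. z \<in> set_decode ck \<longrightarrow> z = x \<or> z = y) \<and>
     (\<exists>n\<le>L. \<exists>k\<le>L. \<exists>p\<le>L. \<exists>u\<le>F. \<exists>a\<le>F. \<exists>b\<le>F. \<exists>sq\<le>G. \<exists>sd\<le>G. \<exists>sX\<le>G. \<exists>sY\<le>G.
       coded_lasso N tr ini bu x y F n k p u a b sq sd sX sY)))))))"

lemma decidable_coded_problem: "decidable (\<lambda>\<rho>. coded_problem (\<rho> 0))"
  unfolding coded_problem_def coded_lasso_def coded_exact_clock_def coded_loop_clock_def coded_samecell_def
      coded_step_def coded_sat_def true_justified_def
    false_justified_def digit_def length_bound_def digit_bound_def loop_length_def label_number_def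
        noswap_length_def single_length_def nonreset_length_def list_encode.simps
  by (intro decidable_ex decidable_all decidable_conj decidable_disj decidable_imp decidable_not decidable_iff
      decidable_eq decidable_less decidable_le decidable_mem_set_decode computable_var computable_const
          computable_if
      computable_Suc computable_add computable_mult computable_power computable_div computable_mod
          computable_prod_encode)

lemma coded_problem_iff:
  assumes nrt: "parametric_nrtTA A" and ck: "card (clocks A) \<le> 2" and pr: "card (params A) \<le> 1"
  shows "coded_problem (pta_code A) \<longleftrightarrow> nonempty_language A"
proof -
  define N where "N = pta_code A"
  define tr where "tr = set_encode (transition_code ` transitions A)"
  have TA: "parametric_TA A" using nrt unfolding parametric_nrtTA_def by simp
  interpret coded_automaton A N tr using TA N_def tr_def by (rule coded_automaton.intro)
  define L where "L = length_bound N"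
  define Z where "Z = (2 * (N + 2)) ^ (2 ^ (L + 2))"
  define F where "F = digit_bound N L Z"
  define G where "G = (F + 1) ^ (L + 1)"
  obtain m where m: "params A \<subseteq> {m}"
  proof (cases "params A = {}")
    case False
    then have "card (params A) = 1" using pr finite_sets(4) by (metis One_nat_def card_0_eq le_Suc_eq
        le_zero_eq)
    then show ?thesis using that card_1_singletonE by (metis order_refl)
  qed (use that in blast)
  have au: "nrt_automaton A x y m N" if "x \<noteq> y" "clocks A \<subseteq> {x, y}" for x y
    using nrt that m const_le by (rule nrt_automaton.intro)
  have N_eq: "N = list_encode [set_encode (alphabet A), set_encode (states A), set_encode (clocks A),
      set_encode (params A), tr,
      initial A, set_encode (buechi A)]" unfolding N_def pta_code_def tr_def ..
  show ?thesis unfolding N_def[symmetric]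
  proof
    assume "coded_problem N"
    then show "nonempty_language A" unfolding coded_problem_def
    proof (elim exE conjE)
    fix L' Z' F G' al ss ck pr tr' ini bu x y n k p u a b sq sd sX sY
    assume N': "N = list_encode [al, ss, ck, pr, tr', ini, bu]" and xy: "x \<noteq> y" "\<forall>z\<le>N. z \<in> set_decode ck \<longrightarrow> z =
        x \<or> z = y"
      and cl: "coded_lasso N tr' ini bu x y F n k p u a b sq sd sX sY"
    have e: "ck = set_encode (clocks A)" "tr' = tr" "ini = initial A" "bu = set_encode (buechi A)"
    proof -
      have "[al, ss, ck, pr, tr', ini, bu] = [set_encode (alphabet A), set_encode (states A), set_encode
          (clocks A), set_encode (params A), tr,
          initial A, set_encode (buechi A)]" using trans[OF N'[symmetric] N_eq] unfolding list_encode_eq .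
      then show "ck = set_encode (clocks A)" "tr' = tr" "ini = initial A" "bu = set_encode (buechi A)" by
          simp_all
    qed
    have "clocks A \<subseteq> {x, y}"
      using xy(2) clocks_le unfolding e set_encode_inverse[OF finite_sets(3)] by blast
    then interpret nrt_automaton A x y m N by (rule au[OF xy(1)])
    have "timed_lasso A x y N n k p (digit F sq) u a b (digit F sd) (digit F sX) (digit F sY)" using cl
        unfolding e coded_lasso_iff .
    \<comment> \<open>The integer lasso is read as a real one with unit \<open>u\<close>, which is
      then normalized to 1.\<close>
    then have "timed_lasso A x y N n k p (digit F sq) (real u) (real a) (real b) (\<lambda>i. real (digit F sd i))
        (\<lambda>i. real (digit F sX i)) (\<lambda>i. real (digit F sY i))"
      unfolding timed_lasso_of_nat .
    from timed_lasso_imp_nonempty[OF timed_lasso_scale[OF this]] show "nonempty_language A" .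
    qed
  next
    assume ne: "nonempty_language A"
    obtain x y where xy: "x \<noteq> y" "clocks A \<subseteq> {x, y}" "x \<le> N + 1" "y \<le> N + 1"
    proof -
      have "card (clocks A) = 0 \<or> card (clocks A) = 1 \<or> card (clocks A) = 2" using ck by linarith
      then consider "clocks A = {}" | z where "clocks A = {z}" | z w where "clocks A = {z, w}" "z \<noteq> w"
        using finite_sets(3) by (metis card_0_eq card_1_singletonE card_2_iff)
      then show ?thesis
      proof cases
        case 1 then show ?thesis using that[of 0 1] by simp
      next
        \<comment> \<open>All clocks are at most \<open>N\<close>, so \<open>N + 1\<close> is a
          fresh name.\<close>
        case (2 z) then show ?thesis using that[of z "N + 1"] clocks_le[of z] by simp
      next
        case (3 z w) then show ?thesis using that[of z w] clocks_le[of z] clocks_le[of w] by simp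
      qed
    qed
    note x_le = xy(3) and y_le = xy(4)
    interpret nrt_automaton A x y m N by (rule au[OF xy(1,2)])
    obtain \<mu> n k p q d X Y where n: "n \<le> 3 * two_clocks.loop_bound (states A) (T \<mu>) ((2 * N + 3) * 3) + 2"
      and pl: "timed_lasso A x y N n k p q (1::real) (max \<mu> 0) (max (- \<mu>) 0) d X Y" using
          nonempty_imp_timed_lasso[OF ne] by (elim exE conjE)
    have "card (states A) \<le> N + 1"
    proof -
      have "card (states A) \<le> card {..N}" using states_le by (intro card_mono) auto
      then show ?thesis by simp
    qed
    moreover have "card (T \<mu>) \<le> N + 1"
    proof -
      \<comment> \<open>Distinct transitions have distinct codes, and these are at most
        \<open>N\<close>; this bounds their number for every \<open>\<mu>\<close>.\<close>
      have "card (T \<mu>) \<le> card (transitions A)" unfolding T_def using finite_sets(5) by (rule card_image_le)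
      also have "\<dots> = card (transition_code ` transitions A)"
      proof (rule card_image[symmetric], rule inj_on_subset[OF inj_on_transition_code])
        show "transitions A \<subseteq> {(q, q', \<gamma>, a, S). finite S}" using transition_finite by auto
      qed
      also have "\<dots> \<le> card {..N}" using transition_code_le by (intro card_mono) auto
      finally show ?thesis by simp
    qed
    ultimately have nL: "n \<le> L" using n two_clocks.loop_bound_le[OF two_clocks_T, of "N + 1" \<mu>]
      unfolding L_def length_bound_def by linarith
    have "(n + 2) * sign_bound (n + 2) (N + 2) \<le> (L + 2) * (2 * Z ^ 2 * ((L + 2) * Z + 1) + 1) ^ (L + 2)"
    proof (rule mult_le_mono)
      show "n + 2 \<le> L + 2" using nL by simp
      have "(2 * (N + 2)) ^ (2 ^ (n + 2)) \<le> Z" unfolding Z_def using nL by (intro power_increasing) simp_all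
      from sign_bound_le[OF this, of "L + 2"]
      have "sign_bound (n + 2) (N + 2) + 1 \<le> (2 * Z ^ 2 * ((L + 2) * Z + 1) + 1) ^ (n + 2)" using nL by simp
      also have "\<dots> \<le> (2 * Z ^ 2 * ((L + 2) * Z + 1) + 1) ^ (L + 2)" using nL by (intro power_increasing)
          simp_all
      finally show "sign_bound (n + 2) (N + 2) \<le> (2 * Z ^ 2 * ((L + 2) * Z + 1) + 1) ^ (L + 2)" by linarith
    qed
    then have bF: "(n + 2) * sign_bound (n + 2) (N + 2) \<le> F" unfolding F_def digit_bound_def by simp
    obtain u a b d' X' Y' where pl': "timed_lasso A x y N n k p q (real u) (real a) (real b) (\<lambda>i. real (d' i))
        (\<lambda>i. real (X' i)) (\<lambda>i. real (Y' i))"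
      and le: "u \<le> F" "a \<le> F" "b \<le> F" "\<forall>i\<le>n. d' i \<le> F \<and> X' i \<le> F \<and> Y' i \<le> F"
      using timed_lasso_integers[OF pl pieces_le(8) bF] by (elim exE conjE)
    note pln = pl'[unfolded timed_lasso_of_nat]
    have kn: "k < p" "p \<le> n" "0 < n" using pln unfolding timed_lasso_def by simp_all
    have qF: "q i \<le> F" if "i \<le> n" for i
    proof -
      have "q i \<in> states A"
      proof (cases "i < n")
        case True
        then have "timed_step A x y u a b q d' X' Y' i" using pln unfolding timed_lasso_def by simp
        then show ?thesis unfolding timed_step_def using transition_facts(1) by blast
      next
        case False
        then have i: "i = Suc (n - 1)" using that kn by simp
        have "timed_step A x y u a b q d' X' Y' (n - 1)" using pln kn(3) unfolding timed_lasso_def by simp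
        then show ?thesis unfolding timed_step_def using transition_facts(2) i by metis
      qed
      then show ?thesis using states_le unfolding F_def digit_bound_def by (simp add: trans_le_add2)
    qed
    have code: "\<exists>s\<le>G. \<forall>i\<le>n. digit F s i = f i" if fF: "\<And>i. i \<le> n \<Longrightarrow> f i \<le> F" for f
    proof -
      obtain s where s: "s < (F + 1) ^ (n + 1)" "\<forall>i\<le>n. digit F s i = f i" using digit_exists[of n f F] fF by
          blast
      have "(F + 1) ^ (n + 1) \<le> G" unfolding G_def using nL by (intro power_increasing) simp_all
      then show ?thesis using s by (intro exI[of _ s]) simp
    qed
    obtain sq where sq: "sq \<le> G" "\<forall>i\<le>n. digit F sq i = q i" using code[of q] qF by blast
    obtain sd where sd: "sd \<le> G" "\<forall>i\<le>n. digit F sd i = d' i" using code[of d'] le(4) by blast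
    obtain sX where sX: "sX \<le> G" "\<forall>i\<le>n. digit F sX i = X' i" using code[of X'] le(4) by blast
    obtain sY where sY: "sY \<le> G" "\<forall>i\<le>n. digit F sY i = Y' i" using code[of Y'] le(4) by blast
    have "timed_lasso A x y N n k p (digit F sq) u a b (digit F sd) (digit F sX) (digit F sY)"
      using sq sd sX sY by (intro timed_lasso_cong[OF pln]) simp_all
    then have cl: "coded_lasso N tr (initial A) (set_encode (buechi A)) x y F n k p u a b sq sd sX sY"
        unfolding coded_lasso_iff .
    have ckd: "\<forall>z\<le>N. z \<in> set_decode (set_encode (clocks A)) \<longrightarrow> z = x \<or> z = y"
      using xy(2) unfolding set_encode_inverse[OF finite_sets(3)] by blast
    have kpL: "k \<le> L" "p \<le> L" using kn nL by simp_all
    show "coded_problem N" unfolding coded_problem_def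
      unfolding L_def[symmetric]
      apply (rule exI[of _ L], intro conjI order_refl refl)
      unfolding Z_def[symmetric]
      apply (rule exI[of _ Z], intro conjI order_refl refl)
      unfolding F_def[symmetric]
      apply (rule exI[of _ F], intro conjI order_refl refl)
      unfolding G_def[symmetric]
      apply (rule exI[of _ G], intro conjI order_refl refl)
      apply (rule exI[of _ "set_encode (alphabet A)"], rule conjI[OF pieces_le(1)])
      apply (rule exI[of _ "set_encode (states A)"], rule conjI[OF pieces_le(2)])
      apply (rule exI[of _ "set_encode (clocks A)"], rule conjI[OF pieces_le(3)])
      apply (rule exI[of _ "set_encode (params A)"], rule conjI[OF pieces_le(4)])
      apply (rule exI[of _ tr], rule conjI[OF pieces_le(5)])
      apply (rule exI[of _ "initial A"], rule conjI[OF pieces_le(6)])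
      apply (rule exI[of _ "set_encode (buechi A)"], rule conjI[OF pieces_le(7)])
      apply (rule conjI[OF N_eq])
      apply (rule exI[of _ x], rule conjI[OF x_le], rule exI[of _ y], rule conjI[OF y_le], rule conjI[OF
          xy(1)], rule conjI[OF ckd])
      apply (rule exI[of _ n], rule conjI[OF nL], rule exI[of _ k], rule conjI[OF kpL(1)], rule exI[of _ p],
          rule conjI[OF kpL(2)])
      apply (rule exI[of _ u], rule conjI[OF le(1)], rule exI[of _ a], rule conjI[OF le(2)], rule exI[of _ b],
          rule conjI[OF le(3)])
      apply (rule exI[of _ sq], rule conjI[OF sq(1)], rule exI[of _ sd], rule conjI[OF sd(1)])
      apply (rule exI[of _ sX], rule conjI[OF sX(1)], rule exI[of _ sY], rule conjI[OF sY(1)])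
      by (rule cl)
  qed
qed

theorem theorem1:
  shows "decidable_problem pta_code
           {A. parametric_nrtTA A \<and> card (clocks A) \<le> 2 \<and> card (params A) \<le> 1}
           (\<lambda>A. nonempty_language A)"
  by (rule decidable_problemI[OF decidable_coded_problem]) (simp add: coded_problem_iff)

end
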